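(* Let $\Phi_1:\mathcal{K}^n\to\mathcal{K}^n$ be a translation invariant monotone Minkowski valuation of degree $1$ which commutes with $\mathrm{SO}(n)$, with generating function $g$ of class $C^2$. Then, for all $K\in\mathcal{K}^n$, $$d_H(\gamma_m\Phi_1^mK,\mathbb{B}^n)\to0\quad\text{as } m\to\infty,$$ with $\gamma_m^{-1}=\frac{w(K)}{2}\left(\int_{\mathbb{S}^{n-1}}g(u)\,du\right)^m$, where $w(K)$ denotes the mean width of $K$.
   Context: $\mathcal{K}^n$ is the set of convex bodies in $\mathbb{R}^n$ (compact convex sets with non-empty interior; in particular $\Phi_1K$ has non-empty interior for every $K\in\mathcal{K}^n$), with the Hausdorff metric $d_H$; $\mathbb{B}^n$ is the Euclidean unit ball, $\mathbb{S}^{n-1}$ the unit sphere, and $du$ denotes (unnormalized) spherical Lebesgue measure. The support function of $K$ is $h_K(x)=\max\{x\cdot y:y\in K\}$; the mean width is $w(K)=\frac{2}{\omega_n}\int_{\mathbb{S}^{n-1}}h_K(u)\,du$, with $\omega_n$ the surface area of $\mathbb{B}^n$. A Minkowski valuation is a map $\Phi:\mathcal{K}^n\to\mathcal{K}^n$ with $\Phi K+\Phi L=\Phi(K\cup L)+\Phi(K\cap L)$ (Minkowski addition) whenever $K,L,K\cap L\in\mathcal{K}^n$ and $K\cup L$ is convex. It is translation invariant if $\Phi(K+x)=\Phi K$ for all $x\in\mathbb{R}^n$; monotone if $K\subseteq L$ implies $\Phi K\subseteq\Phi L$; of degree $1$ if $\Phi(\lambda K)=\lambda\Phi K$ for all $\lambda>0$;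 it commutes with $\mathrm{SO}(n)$ if $\Phi(\vartheta K)=\vartheta\Phi K$ for all $\vartheta\in\mathrm{SO}(n)$. $\Phi^m$ is the $m$-fold iterate. The first-order area measure is $S_1(K,\cdot)=S(K,\mathbb{B}^n[n-2],\cdot)$ ($n-2$ copies of $\mathbb{B}^n$), where the mixed area measure $S(K_2,\dots,K_n,\cdot)$ is the finite Borel measure on $\mathbb{S}^{n-1}$ with mixed volume $V(K_1,\dots,K_n)=\frac1n\int_{\mathbb{S}^{n-1}}h_{K_1}\,dS(K_2,\dots,K_n,\cdot)$ for all $K_1\in\mathcal{K}^n$. Fix a pole $\bar e\in\mathbb{S}^{n-1}$. A zonal function $f$ on $\mathbb{S}^{n-1}$ (invariant under the stabilizer $\mathrm{SO}(n-1)$ of $\bar e$) has the form $f(u)=\bar f(u\cdot\bar e)$. For a finite measure $\mu$ and continuous zonal $f$, the spherical convolution is $(\mu*f)(u)=\int_{\mathbb{S}^{n-1}}\bar f(u\cdot v)\,d\mu(v)$. The generating function of $\Phi_1$ is the zonal function $g$ on $\mathbb{S}^{n-1}$ with center of mass at the origin ($\int_{\mathbb{S}^{n-1}}u\,g(u)\,du=0$) such that $h_{\Phi_1K}=S_1(K,\cdot)*g$ for every $K\in\mathcal{K}^n$. *)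

theory Defs
  imports "HOL-Analysis.Analysis"
begin

section \<open>Convex bodies\<close>

definition convex_body :: "(real ^ 'n) set \<Rightarrow> bool" where
  "convex_body K \<longleftrightarrow> compact K \<and> convex K \<and> interior K \<noteq> {}"

text \<open>For compact non-empty \<open>K\<close> the supremum is attained.\<close>
definition support_fun :: "(real ^ 'n) set \<Rightarrow> real ^ 'n \<Rightarrow> real" where
  "support_fun K x = (SUP y\<in>K. x \<bullet> y)"

definition hausdorff_dist :: "(real ^ 'n) set \<Rightarrow> (real ^ 'n) set \<Rightarrow> real" where
  "hausdorff_dist K L = max (SUP x\<in>K. infdist x L) (SUP y\<in>L. infdist y K)"

abbreviation dilate :: "real \<Rightarrow> (real ^ 'n) set \<Rightarrow> (real ^ 'n) set" where
  "dilate c K \<equiv> (\<lambda>x. c *\<^sub>R x) ` K"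


section \<open>Spherical Lebesgue measure and mean width\<close>

text \<open>The Borel space of the unit sphere; measures on the sphere are measures on it.\<close>
abbreviation sphere_borel :: "(real ^ 'n) measure" where
  "sphere_borel \<equiv> restrict_space borel (sphere 0 1)"

text \<open>
  By polar coordinates, the surface measure of a Borel set \<open>A\<close> in the sphere is \<open>n\<close> times the volume
  of the cone of all \<open>r u\<close> with \<open>u\<close> in \<open>A\<close> and \<open>0 < r \<le> 1\<close>. Recall that \<open>sgn x = x / norm x\<close>.
\<close>
definition sphere_measure :: "(real ^ 'n) measure" where
  "sphere_measure =
     scale_measure (of_nat CARD('n)) (distr (restrict_space lborel (cball 0 1 - {0})) sphere_borel sgn)"

definition mean_width :: "(real ^ 'n) set \<Rightarrow> real" where
  "mean_width K =
     2 / measure (sphere_measure :: (real ^ 'n) measure) (sphere 0 1) * (LINT u|sphere_measure. support_fun K u)"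

lemma sgn_measurable_sphere:
  "sgn \<in> restrict_space lborel (cball (0 :: real ^ 'n) 1 - {0}) \<rightarrow>\<^sub>M sphere_borel"
proof (rule measurable_restrict_space2)
  show "sgn \<in> space (restrict_space lborel (cball (0 :: real ^ 'n) 1 - {0})) \<rightarrow> sphere 0 1"
    by (auto simp: space_restrict_space norm_sgn)
  have "(sgn :: real ^ 'n \<Rightarrow> real ^ 'n) \<in> borel_measurable borel"
    unfolding sgn_div_norm by measurable
  then show "(sgn :: real ^ 'n \<Rightarrow> real ^ 'n) \<in> borel_measurable (restrict_space lborel (cball 0 1 - {0}))"
    by (intro measurable_restrict_space1) simp
qed

lemma emeasure_sphere_measure:
  fixes A :: "(real ^ 'n) set"
  assumes "A \<in> sets sphere_borel"
  shows "emeasure sphere_measure A = of_nat CARD('n) * emeasure lborel {x \<in> cball 0 1 - {0}. sgn x \<in> A}"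
proof -
  have "emeasure (distr (restrict_space lborel (cball 0 1 - {0})) sphere_borel sgn) A
      = emeasure lborel (sgn -` A \<inter> (cball 0 1 - {0}))"
    using assms
    by (subst emeasure_distr[OF sgn_measurable_sphere])
       (auto simp: space_restrict_space intro!: emeasure_restrict_space)
  moreover have "sgn -` A \<inter> (cball 0 1 - {0}) = {x \<in> cball 0 1 - {0}. sgn x \<in> A}"
    by auto
  ultimately show ?thesis
    by (simp add: sphere_measure_def)
qed


section \<open>Mixed volumes and area measures\<close>

text \<open>
  With \<open>Ks = [K\<^sub>0, \<dots>, K\<^sub>n\<^sub>-\<^sub>1]\<close>, the numbers \<open>a [i\<^sub>1, \<dots>, i\<^sub>n]\<close> are the symmetric coefficients
  \<open>V(K\<^sub>i\<^sub>1, \<dots>, K\<^sub>i\<^sub>n)\<close> of the polynomial \<open>vol (c\<^sub>0 K\<^sub>0 + \<dots> + c\<^sub>n\<^sub>-\<^sub>1 K\<^sub>n\<^sub>-\<^sub>1)\<close> (Minkowski's theorem), and \<open>v\<close> is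
  the coefficient \<open>V(K\<^sub>0, \<dots>, K\<^sub>n\<^sub>-\<^sub>1)\<close>. A polynomial has only one symmetric coefficient family, so \<open>v\<close>
  is unique. Sums of sets are Minkowski sums.
\<close>
definition has_mixed_volume :: "(real ^ 'n) set list \<Rightarrow> real \<Rightarrow> bool" where
  "has_mixed_volume Ks v \<longleftrightarrow> length Ks = CARD('n) \<and>
     (\<exists>a :: nat list \<Rightarrow> real.
        (\<forall>is js. mset is = mset js \<longrightarrow> a is = a js) \<and>
        (\<forall>c :: nat \<Rightarrow> real. (\<forall>i. c i \<ge> 0) \<longrightarrow>
           measure lborel (\<Sum>i<CARD('n). dilate (c i) (Ks ! i)) =
             (\<Sum>is | length is = CARD('n) \<and> set is \<subseteq> {..<CARD('n)}. a is * (\<Prod>i\<leftarrow>is. c i))) \<and>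
        v = a [0..<CARD('n)])"

text \<open>\<open>S\<close> is the measure \<open>S(K\<^sub>2, \<dots>, K\<^sub>n, \<cdot>)\<close> for \<open>Ks = [K\<^sub>2, \<dots>, K\<^sub>n]\<close>.\<close>
definition is_mixed_area_measure :: "(real ^ 'n) set list \<Rightarrow> (real ^ 'n) measure \<Rightarrow> bool" where
  "is_mixed_area_measure Ks S \<longleftrightarrow>
     sets S = sets sphere_borel \<and> finite_measure S \<and>
     (\<forall>K. convex_body K \<longrightarrow>
        has_mixed_volume (K # Ks) (1 / real CARD('n) * (LINT u|S. support_fun K u)))"

definition is_first_area_measure :: "(real ^ 'n) set \<Rightarrow> (real ^ 'n) measure \<Rightarrow> bool" where
  "is_first_area_measure K S \<longleftrightarrow> is_mixed_area_measure (K # replicate (CARD('n) - 2) (cball 0 1)) S"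


section \<open>Zonal functions and spherical convolution\<close>

definition zonal :: "real ^ 'n \<Rightarrow> (real ^ 'n \<Rightarrow> real) \<Rightarrow> bool" where
  "zonal e f \<longleftrightarrow> (\<exists>F :: real \<Rightarrow> real. \<forall>u\<in>sphere 0 1. f u = F (u \<bullet> e))"

text \<open>
  For zonal \<open>f\<close>, a unit vector \<open>e\<close> and dimension at least 2, the values on \<open>[-1, 1]\<close> do not depend on
  the choice.
\<close>
definition zonal_profile :: "real ^ 'n \<Rightarrow> (real ^ 'n \<Rightarrow> real) \<Rightarrow> real \<Rightarrow> real" where
  "zonal_profile e f = (SOME F. \<forall>u\<in>sphere 0 1. f u = F (u \<bullet> e))"

definition sphere_conv ::
  "real ^ 'n \<Rightarrow> (real ^ 'n) measure \<Rightarrow> (real ^ 'n \<Rightarrow> real) \<Rightarrow> real ^ 'n \<Rightarrow> real" where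
  "sphere_conv e \<mu> f u = (LINT v|\<mu>. zonal_profile e f (u \<bullet> v))"

text \<open>A function on the sphere is of class \<open>C\<^sup>2\<close> if it extends to a \<open>C\<^sup>2\<close> function on a neighbourhood.\<close>
definition C2_on_sphere :: "(real ^ 'n \<Rightarrow> real) \<Rightarrow> bool" where
  "C2_on_sphere f \<longleftrightarrow>
     (\<exists>U F (F' :: real ^ 'n \<Rightarrow> (real ^ 'n) \<Rightarrow>\<^sub>L real) (F'' :: real ^ 'n \<Rightarrow> (real ^ 'n) \<Rightarrow>\<^sub>L ((real ^ 'n) \<Rightarrow>\<^sub>L real)).
        open U \<and> sphere 0 1 \<subseteq> U \<and> (\<forall>u\<in>sphere 0 1. F u = f u) \<and>
        (\<forall>x\<in>U. (F has_derivative blinfun_apply (F' x)) (at x)) \<and>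
        (\<forall>x\<in>U. (F' has_derivative blinfun_apply (F'' x)) (at x)) \<and>
        continuous_on U F'')"


section \<open>Minkowski valuations\<close>

text \<open>
  Maps between convex bodies are functions on all sets, of which only the values at convex bodies
  matter.
\<close>
definition minkowski_valuation :: "((real ^ 'n) set \<Rightarrow> (real ^ 'n) set) \<Rightarrow> bool" where
  "minkowski_valuation \<Phi> \<longleftrightarrow>
     (\<forall>K. convex_body K \<longrightarrow> convex_body (\<Phi> K)) \<and>
     (\<forall>K L. convex_body K \<and> convex_body L \<and> convex_body (K \<inter> L) \<and> convex (K \<union> L) \<longrightarrow>
        \<Phi> K + \<Phi> L = \<Phi> (K \<union> L) + \<Phi> (K \<inter> L))"

definition translation_invariant :: "((real ^ 'n) set \<Rightarrow> (real ^ 'n) set) \<Rightarrow> bool" where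
  "translation_invariant \<Phi> \<longleftrightarrow> (\<forall>K x. convex_body K \<longrightarrow> \<Phi> ((\<lambda>y. y + x) ` K) = \<Phi> K)"

definition monotone_on_bodies :: "((real ^ 'n) set \<Rightarrow> (real ^ 'n) set) \<Rightarrow> bool" where
  "monotone_on_bodies \<Phi> \<longleftrightarrow> (\<forall>K L. convex_body K \<and> convex_body L \<and> K \<subseteq> L \<longrightarrow> \<Phi> K \<subseteq> \<Phi> L)"

definition degree_one :: "((real ^ 'n) set \<Rightarrow> (real ^ 'n) set) \<Rightarrow> bool" where
  "degree_one \<Phi> \<longleftrightarrow> (\<forall>K c. convex_body K \<and> c > 0 \<longrightarrow> \<Phi> (dilate c K) = dilate c (\<Phi> K))"

definition commutes_with_SO :: "((real ^ 'n) set \<Rightarrow> (real ^ 'n) set) \<Rightarrow> bool" where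
  "commutes_with_SO \<Phi> \<longleftrightarrow>
     (\<forall>K (Q :: real ^ 'n ^ 'n). convex_body K \<and> rotation_matrix Q \<longrightarrow>
        \<Phi> ((\<lambda>x. Q *v x) ` K) = (\<lambda>x. Q *v x) ` \<Phi> K)"

text \<open>
  \<open>g\<close> is zonal with respect to the pole \<open>e\<close>, centred, and \<open>h(\<Phi> K, \<cdot>) = S\<^sub>1(K, \<cdot>) * g\<close> for all convex
  bodies \<open>K\<close>. The measure \<open>S\<^sub>1(K, \<cdot>)\<close> exists and is unique, so the quantifier over \<open>S\<close> only names it.
\<close>
definition generating_function ::
  "real ^ 'n \<Rightarrow> ((real ^ 'n) set \<Rightarrow> (real ^ 'n) set) \<Rightarrow> (real ^ 'n \<Rightarrow> real) \<Rightarrow> bool" where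
  "generating_function e \<Phi> g \<longleftrightarrow>
     zonal e g \<and>
     (LINT u|sphere_measure. g u *\<^sub>R u) = 0 \<and>
     (\<forall>K. convex_body K \<longrightarrow>
        (\<exists>S. is_first_area_measure K S \<and> (\<forall>u\<in>sphere 0 1. support_fun (\<Phi> K) u = sphere_conv e S g u)))"

end

(*
  The support function of Phi K is S_1(K) * g. Since g is of class C^2, g plus a constant is itself a
  support function, and the symmetry of mixed volumes moves it into the measure: h(Phi K) is the image
  of h(K) under a positive linear operator on the continuous functions of the sphere, which commutes
  with O(n) and, after division by G, the integral of g, preserves constants and integrals. Great
  subspheres carry no mass of its representing measures, because a kink of h(K) along a great subsphere
  would otherwise survive in h(Phi K), which is as smooth as g.
  By Arzela-Ascoli the normalized iterates have uniform limit points. Along the iteration the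
  integrals of max(h, t) decrease, so they are preserved at a limit point, which forces the limit to
  be constant almost everywhere for each representing measure. As these measures are not finitely
  supported, the limit is invariant under arbitrarily small rotations, hence constant; its value is
  the mean of h(K), that is w(K) / 2.
*)
theory Submission
  imports Defs "HOL-Complex_Analysis.Great_Picard"
begin

section \<open>Support functions\<close>

text \<open>The obstacle is the map that sends \<open>K\<close> to half of \<open>K + (-K)\<close>:
  it is a translation invariant monotone valuation of degree 1 that commutes with SO(n), yet it
  fixes every origin-symmetric body. Its representing measures sit at \<open>u\<close> and
  \<open>-u\<close>. Smoothness of \<open>g\<close> is what excludes this: a kink produces a gain of
  first order in a small angle, while \<open>g\<close> permits only second order.

  The representing measures are never constructed. \<open>\<Lambda> u\<close> starts as a difference
  of two integrals, monotonicity makes it positive, and its support is described by the nonnegative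
  functions that it annihilates.

  Truncations max(h, t) suit this setting because Jensen's inequality for them follows from
  monotonicity and the value on constants alone, and because \<open>t\<close> can be adapted to each
  direction \<open>u\<close>.

  The full group O(n) enters because in the plane a rotation preserves orientation and cannot carry
  a pair of unit vectors to every other pair with the same inner product.\<close>

lemma support_fun_eqI:
  assumes "y \<in> K" "x \<bullet> y = a" "\<And>z. z \<in> K \<Longrightarrow> x \<bullet> z \<le> a"
  shows "support_fun K x = a"
  unfolding support_fun_def using assms by (intro cSup_eq_maximum) auto

lemma support_fun_attained:
  assumes "compact K" "K \<noteq> {}"
  obtains y where "y \<in> K" "support_fun K x = x \<bullet> y" "\<And>z. z \<in> K \<Longrightarrow> x \<bullet> z \<le> x \<bullet> y"
proof -
  have "\<exists>y\<in>K. \<forall>z\<in>K. x \<bullet> z \<le> x \<bullet> y"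
    using assms by (intro continuous_attains_sup continuous_intros)
  then show ?thesis
    using that support_fun_eqI by metis
qed

lemma inner_le_support_fun:
  assumes "compact K" "y \<in> K"
  shows "x \<bullet> y \<le> support_fun K x"
  by (metis assms empty_iff support_fun_attained)

lemma convex_bodyD:
  assumes "convex_body K"
  shows "compact K" "convex K" "K \<noteq> {}" "interior K \<noteq> {}" "closed K" "bounded K"
  using assms interior_subset by (auto simp: convex_body_def compact_imp_closed compact_imp_bounded)

lemma convex_body_cball: "r > 0 \<Longrightarrow> convex_body (cball 0 r)"
  by (simp add: convex_body_def)

lemma convex_body_orthogonal_image:
  fixes Q :: "real ^ 'n \<Rightarrow> real ^ 'n"
  assumes "orthogonal_transformation Q" "convex_body K"
  shows "convex_body (Q ` K)"
proof -
  have "linear Q" "inj Q"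
    using orthogonal_transformation_linear orthogonal_transformation_inj assms(1) by blast+
  moreover have "interior (Q ` K) = Q ` interior K"
    using \<open>linear Q\<close> \<open>inj Q\<close> by (simp add: interior_injective_linear_image)
  ultimately show ?thesis
    using assms(2) unfolding convex_body_def
    by (simp add: compact_continuous_image linear_continuous_on linear_conv_bounded_linear convex_linear_image)
qed

lemma support_fun_cball:
  assumes "r \<ge> 0" "norm u = 1"
  shows "support_fun (cball 0 r) u = r"
proof (rule support_fun_eqI[of "r *\<^sub>R u"])
  show "u \<bullet> (r *\<^sub>R u) = r"
    using assms by (simp add: dot_square_norm)
  show "u \<bullet> z \<le> r" if "z \<in> cball 0 r" for z
    using that norm_cauchy_schwarz[of u z] assms by simp
qed (use assms in simp)

lemma support_fun_orthogonal_image: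
  assumes "orthogonal_transformation Q" "compact K" "K \<noteq> {}"
  shows "support_fun (Q ` K) (Q x) = support_fun K x"
proof -
  obtain y where y: "y \<in> K" "support_fun K x = x \<bullet> y" "\<And>z. z \<in> K \<Longrightarrow> x \<bullet> z \<le> x \<bullet> y"
    using support_fun_attained[OF assms(2,3)] by blast
  show ?thesis
    using assms(1) y by (intro support_fun_eqI[of "Q y"]) (auto simp: orthogonal_transformation_def)
qed

lemma support_fun_dilate:
  assumes "compact K" "K \<noteq> {}" "c \<ge> 0"
  shows "support_fun (dilate c K) x = c * support_fun K x"
proof -
  obtain y where y: "y \<in> K" "support_fun K x = x \<bullet> y" "\<And>z. z \<in> K \<Longrightarrow> x \<bullet> z \<le> x \<bullet> y"
    using support_fun_attained[OF assms(1,2)] by blast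
  show ?thesis
    using y \<open>c \<ge> 0\<close> by (intro support_fun_eqI[of "c *\<^sub>R y"]) (auto simp: mult_left_mono)
qed

lemma support_fun_mono:
  assumes "compact L" "K \<subseteq> L" "compact K" "K \<noteq> {}"
  shows "support_fun K x \<le> support_fun L x"
  by (metis assms inner_le_support_fun subsetD support_fun_attained)

lemma support_fun_lipschitz:
  assumes "compact K" "K \<noteq> {}" "K \<subseteq> cball 0 R"
  shows "\<bar>support_fun K u - support_fun K v\<bar> \<le> R * norm (u - v)"
proof -
  have *: "support_fun K u - support_fun K v \<le> R * norm (u - v)" for u v
  proof -
    obtain y where y: "y \<in> K" "support_fun K u = u \<bullet> y"
      using support_fun_attained[OF assms(1,2)] by blast
    have "support_fun K u - support_fun K v \<le> u \<bullet> y - v \<bullet> y"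
      using y inner_le_support_fun[OF assms(1) y(1)] by simp
    also have "\<dots> = (u - v) \<bullet> y"
      by (simp add: inner_diff_left)
    also have "\<dots> \<le> norm (u - v) * norm y"
      by (rule norm_cauchy_schwarz)
    also have "\<dots> \<le> norm (u - v) * R"
      using y assms(3) by (intro mult_left_mono) auto
    finally show ?thesis
      by (simp add: mult.commute)
  qed
  show ?thesis
    using *[of u v] *[of v u] by (simp add: abs_le_iff norm_minus_commute)
qed

lemma continuous_on_support_fun:
  assumes "compact K" "K \<noteq> {}"
  shows "continuous_on A (support_fun K)"
proof -
  obtain R where "R > 0" "K \<subseteq> cball 0 R"
    using compact_imp_bounded[OF assms(1)] by (meson bounded_subset_ballD ball_subset_cball subset_trans)
  then have "R-lipschitz_on A (support_fun K)"
    using support_fun_lipschitz[OF assms] by (intro lipschitz_onI) (auto simp: dist_norm)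
  then show ?thesis
    by (rule lipschitz_on_continuous_on)
qed

lemma support_fun_le_imp_subset:
  assumes "compact K" "K \<noteq> {}" "compact L" "L \<noteq> {}" "convex L"
    and le: "\<And>u. norm u = 1 \<Longrightarrow> support_fun K u \<le> support_fun L u"
  shows "K \<subseteq> L"
proof
  fix y assume "y \<in> K"
  show "y \<in> L"
  proof (rule ccontr)
    assume "y \<notin> L"
    then obtain a b where ab: "a \<bullet> y < b" "\<And>x. x \<in> L \<Longrightarrow> b < a \<bullet> x"
      using separating_hyperplane_closed_point[OF \<open>convex L\<close> compact_imp_closed[OF \<open>compact L\<close>]] by metis
    have "a \<noteq> 0"
      using ab \<open>L \<noteq> {}\<close> by force
    \<comment> \<open>The separation puts \<open>L\<close> on the side where \<open>a\<close> is
      larger, so the outward direction towards \<open>y\<close> is \<open>- a\<close>.\<close>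
    define u where "u = - (a /\<^sub>R norm a)"
    have "norm u = 1"
      using \<open>a \<noteq> 0\<close> by (simp add: u_def)
    obtain x where x: "x \<in> L" "support_fun L u = u \<bullet> x"
      using support_fun_attained[OF assms(3,4)] by blast
    have "a \<bullet> y < a \<bullet> x"
      using ab x by force
    then have "u \<bullet> x < u \<bullet> y"
      using \<open>a \<noteq> 0\<close> by (simp add: u_def)
    then show False
      using le[OF \<open>norm u = 1\<close>] x inner_le_support_fun[OF assms(1) \<open>y \<in> K\<close>, of u] by simp
  qed
qed

text \<open>The bound on the support function sandwiches \<open>K\<close> between the balls of radii
  1 - \<epsilon> and 1 + \<epsilon>, and each inclusion controls one of the two suprema.
  Nonnegativity is recorded as well because the limit at the end is about the absolute
  value.\<close>

lemma hausdorff_dist_cball_le: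
  fixes K :: "(real ^ 'n) set"
  assumes "compact K" "convex K" "K \<noteq> {}" "\<epsilon> \<ge> 0" "\<epsilon> < 1"
    and h: "\<And>u. norm u = 1 \<Longrightarrow> \<bar>support_fun K u - 1\<bar> \<le> \<epsilon>"
  shows "0 \<le> hausdorff_dist K (cball 0 1)" "hausdorff_dist K (cball 0 1) \<le> \<epsilon>"
proof -
  have h': "support_fun K u \<le> 1 + \<epsilon>" "1 - \<epsilon> \<le> support_fun K u" if "norm u = 1" for u
    using h[OF that] by linarith+
  have K1: "K \<subseteq> cball 0 (1 + \<epsilon>)"
    using assms(1-5) h' by (intro support_fun_le_imp_subset) (simp_all add: support_fun_cball)
  have K2: "cball 0 (1 - \<epsilon>) \<subseteq> K"
    using assms(1-5) h' by (intro support_fun_le_imp_subset) (simp_all add: support_fun_cball)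
  \<comment> \<open>Radial projection to the smaller ball. It serves both inclusions, with (r, s)
    equal to (1, \<epsilon>) and to (1 - \<epsilon>, \<epsilon>).\<close>
  have near: "\<exists>y\<in>cball 0 r. dist x y \<le> s"
    if "norm x \<le> r + s" "r \<ge> 0" "s \<ge> 0" for x :: "real ^ 'n" and r s
  proof (cases "norm x \<le> r")
    case True
    then show ?thesis
      using that by (intro bexI[of _ x]) auto
  next
    case False
    have nz: "norm x > 0"
      using False \<open>r \<ge> 0\<close> by linarith
    have "dist x ((r / norm x) *\<^sub>R x) = norm ((1 - r / norm x) *\<^sub>R x)"
      by (simp add: dist_norm algebra_simps)
    also have "\<dots> = \<bar>1 - r / norm x\<bar> * norm x"
      by simp
    also have "\<dots> = norm x - r"
      using False nz by (simp add: abs_if field_simps)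
    finally show ?thesis
      using that nz by (intro bexI[of _ "(r / norm x) *\<^sub>R x"]) auto
  qed
  have a: "infdist x (cball 0 1) \<le> \<epsilon>" if "x \<in> K" for x
  proof -
    have "norm x \<le> 1 + \<epsilon>"
      using K1 that by auto
    then obtain y where "y \<in> cball 0 1" "dist x y \<le> \<epsilon>"
      using near[of x 1 \<epsilon>] assms by auto
    then show ?thesis
      by (meson infdist_le2)
  qed
  have b: "infdist y K \<le> \<epsilon>" if "y \<in> cball 0 1" for y
  proof -
    have "norm y \<le> (1 - \<epsilon>) + \<epsilon>"
      using that by auto
    then obtain x where "x \<in> cball 0 (1 - \<epsilon>)" "dist y x \<le> \<epsilon>"
      using near[of y "1 - \<epsilon>" \<epsilon>] assms by auto
    then show ?thesis
      using K2 by (meson infdist_le2 subsetD)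
  qed
  have "(SUP x\<in>K. infdist x (cball 0 1)) \<le> \<epsilon>" "(SUP y\<in>cball 0 1. infdist y K) \<le> \<epsilon>"
    using a b \<open>K \<noteq> {}\<close> by (auto intro!: cSUP_least)
  then show "hausdorff_dist K (cball 0 1) \<le> \<epsilon>"
    by (simp add: hausdorff_dist_def)
  obtain x where "x \<in> K"
    using \<open>K \<noteq> {}\<close> by blast
  have "0 \<le> infdist x (cball 0 1)"
    by (rule infdist_nonneg)
  also have "\<dots> \<le> (SUP x\<in>K. infdist x (cball 0 1))"
    using a \<open>x \<in> K\<close> by (intro cSUP_upper) (auto simp: bdd_above_def)
  finally show "0 \<le> hausdorff_dist K (cball 0 1)"
    by (simp add: hausdorff_dist_def)
qed


section \<open>Support functions from second-order tangents\<close>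

text \<open>This lets a quadratic error on the sphere be traded for a constant minus a linear
  function, so that adding a multiple of the unit ball absorbs it.\<close>

lemma inner_unit_eq:
  fixes x z :: "'a :: real_inner"
  assumes "norm x = 1" "norm z = 1"
  shows "1 - x \<bullet> z = (norm (x - z))\<^sup>2 / 2"
  using assms by (simp add: power2_norm_eq_inner inner_diff inner_commute norm_eq_1)

text \<open>
  The Wulff shape of \<open>f + c\<close>: it has support function \<open>f + c\<close> because \<open>G z + c z\<close> is a point of it
  that attains the bound in direction \<open>z\<close>.
\<close>
lemma convex_body_of_tangents:
  fixes f :: "real ^ 'n \<Rightarrow> real"
  assumes cont: "continuous_on (sphere 0 1) f"
    and tangent: "\<And>z. norm z = 1 \<Longrightarrow> G z \<bullet> z = f z"
      "\<And>x z. norm x = 1 \<Longrightarrow> norm z = 1 \<Longrightarrow> G z \<bullet> x - C * (norm (x - z))\<^sup>2 \<le> f x"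
  obtains K c where "convex_body K" "c \<ge> 1" "\<And>u. norm u = 1 \<Longrightarrow> support_fun K u = f u + c"
proof -
  obtain M where M: "\<And>u. norm u = 1 \<Longrightarrow> \<bar>f u\<bar> \<le> M"
    using compact_imp_bounded[OF compact_continuous_image[OF cont compact_sphere]]
    unfolding bounded_iff by (metis imageI mem_sphere_0 real_norm_def)
  obtain u :: "real ^ 'n" where "norm u = 1"
    using vector_choose_size[of 1] by auto
  then have "M \<ge> 0"
    using M by force
  \<comment> \<open>\<open>2 * C\<close> absorbs the quadratic error, by
    \<open>inner_unit_eq\<close>; \<open>1 + M\<close> makes \<open>f + c\<close> at least 1, so
    that \<open>K\<close> contains the unit ball.\<close>
  define c where "c = max (2 * C) (1 + M)"
  define K where "K = {y. \<forall>x\<in>sphere 0 1. x \<bullet> y \<le> f x + c}"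
  have Kint: "K = (\<Inter>x\<in>sphere 0 1. {y. x \<bullet> y \<le> f x + c})"
    by (auto simp: K_def)
  have "closed K" "convex K"
    unfolding Kint by (auto intro!: closed_halfspace_le convex_INT convex_halfspace_le)
  moreover have "norm y \<le> M + c" if "y \<in> K" for y
  proof (cases "y = 0")
    case True
    then show ?thesis
      using \<open>M \<ge> 0\<close> by (simp add: c_def)
  next
    case False
    then have "norm (y /\<^sub>R norm y) = 1"
      by simp
    then have "(y /\<^sub>R norm y) \<bullet> y \<le> f (y /\<^sub>R norm y) + c" "f (y /\<^sub>R norm y) \<le> M"
      using that M[of "y /\<^sub>R norm y"] unfolding K_def mem_Collect_eq by (auto simp del: inner_scaleR_left)
    moreover have "(y /\<^sub>R norm y) \<bullet> y = norm y"
      using False by (simp add: dot_square_norm power2_eq_square)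
    ultimately show ?thesis
      by linarith
  qed
  then have "bounded K"
    by (auto simp: bounded_iff)
  moreover have "cball 0 1 \<subseteq> K"
  proof
    fix y :: "real ^ 'n" assume y: "y \<in> cball 0 1"
    show "y \<in> K"
      unfolding K_def
    proof safe
      fix x :: "real ^ 'n" assume x: "x \<in> sphere 0 1"
      have "x \<bullet> y \<le> norm x * norm y"
        by (rule norm_cauchy_schwarz)
      also have "\<dots> \<le> 1"
        using x y by simp
      also have "\<dots> \<le> f x + c"
        using M[of x] x by (auto simp: c_def abs_le_iff max_def)
      finally show "x \<bullet> y \<le> f x + c" .
    qed
  qed
  then have "ball 0 1 \<subseteq> interior K"
    using interior_mono[of "cball 0 1" K] by simp
  then have "interior K \<noteq> {}"
    by auto
  ultimately have "convex_body K"
    by (simp add: convex_body_def compact_eq_bounded_closed)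
  moreover have "support_fun K z = f z + c" if z: "norm z = 1" for z
  proof (rule support_fun_eqI)
    show "z \<bullet> (G z + c *\<^sub>R z) = f z + c"
      using tangent(1)[OF z] z by (simp add: inner_add_right inner_commute norm_eq_1)
    show "z \<bullet> y \<le> f z + c" if "y \<in> K" for y
      using that z by (simp add: K_def)
    show "G z + c *\<^sub>R z \<in> K"
      unfolding K_def
    proof safe
      fix x :: "real ^ 'n" assume x: "x \<in> sphere 0 1"
      have xz: "x \<bullet> z = 1 - (norm (x - z))\<^sup>2 / 2"
        using inner_unit_eq[of x z] x z by simp
      have "x \<bullet> (G z + c *\<^sub>R z) = G z \<bullet> x + c * (x \<bullet> z)"
        by (simp add: inner_add_right inner_commute)
      also have "\<dots> = G z \<bullet> x + c - c * ((norm (x - z))\<^sup>2 / 2)"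
        by (subst xz) (simp add: algebra_simps)
      also have "\<dots> \<le> G z \<bullet> x + c - C * (norm (x - z))\<^sup>2"
        using mult_right_mono[of "2 * C" c "(norm (x - z))\<^sup>2"] by (simp add: c_def del: mult_le_cancel_right)
      also have "\<dots> \<le> f x + c"
        using tangent(2)[of x z] x z by simp
      finally show "x \<bullet> (G z + c *\<^sub>R z) \<le> f x + c" .
    qed
  qed
  moreover have "c \<ge> 1"
    using \<open>M \<ge> 0\<close> by (simp add: c_def)
  ultimately show ?thesis
    using that by blast
qed

text \<open>A substitute for class C^2 that lives on the sphere alone: a linear form touches
  \<open>f\<close> at \<open>z\<close> to second order, with \<open>C\<close> uniform in
  \<open>z\<close>. Taking x = z gives \<open>G z \<bullet> z = f z\<close>, so no constant term
  appears. The lower estimate produces support functions, the upper one is played against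
  kinks.\<close>

definition second_order :: "(real ^ 'n \<Rightarrow> real) \<Rightarrow> bool" where
  "second_order f \<longleftrightarrow> (\<exists>G C. \<forall>x z. norm x = 1 \<longrightarrow> norm z = 1 \<longrightarrow>
     \<bar>f x - G z \<bullet> x\<bar> \<le> C * (norm (x - z))\<^sup>2)"

lemma second_order_cong:
  assumes "second_order f" "\<And>v. norm v = 1 \<Longrightarrow> f v = g v"
  shows "second_order g"
  using assms unfolding second_order_def by simp

lemma second_orderE:
  assumes "second_order f"
  obtains G C where "C \<ge> 0" "\<And>z. norm z = 1 \<Longrightarrow> G z \<bullet> z = f z"
    "\<And>x z. norm x = 1 \<Longrightarrow> norm z = 1 \<Longrightarrow> \<bar>f x - G z \<bullet> x\<bar> \<le> C * (norm (x - z))\<^sup>2"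
proof -
  obtain G C where GC: "\<And>x z. norm x = 1 \<Longrightarrow> norm z = 1 \<Longrightarrow> \<bar>f x - G z \<bullet> x\<bar> \<le> C * (norm (x - z))\<^sup>2"
    using assms unfolding second_order_def by blast
  have "\<bar>f x - G z \<bullet> x\<bar> \<le> max C 0 * (norm (x - z))\<^sup>2" if "norm x = 1" "norm z = 1" for x z
    using GC[OF that] mult_right_mono[of C "max C 0" "(norm (x - z))\<^sup>2"] by auto
  then show ?thesis
    using that[of "max C 0" G] GC[of z z for z] by auto
qed

lemma second_order_continuous_on:
  assumes "second_order f"
  shows "continuous_on (sphere 0 1) f"
proof -
  obtain G C where "C \<ge> 0" and G: "\<And>z. norm z = 1 \<Longrightarrow> G z \<bullet> z = f z"
    and C: "\<And>x z. norm x = 1 \<Longrightarrow> norm z = 1 \<Longrightarrow> \<bar>f x - G z \<bullet> x\<bar> \<le> C * (norm (x - z))\<^sup>2"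
    by (rule second_orderE[OF assms]) blast
  have "(f \<longlongrightarrow> f z) (at z within sphere 0 1)" if z: "z \<in> sphere 0 1" for z
  proof -
    have "continuous (at z within sphere 0 1) (\<lambda>x. C * (norm (x - z))\<^sup>2)"
      by (intro continuous_intros)
    then have "((\<lambda>x. C * (norm (x - z))\<^sup>2) \<longlongrightarrow> C * (norm (z - z))\<^sup>2) (at z within sphere 0 1)"
      unfolding continuous_within .
    then have lim: "((\<lambda>x. C * (norm (x - z))\<^sup>2) \<longlongrightarrow> 0) (at z within sphere 0 1)"
      by (simp only: diff_self norm_zero power_zero_numeral mult_zero_right)
    have "\<forall>\<^sub>F x in at z within sphere 0 1. norm (f x - G z \<bullet> x) \<le> C * (norm (x - z))\<^sup>2"
      unfolding eventually_at_filter by (rule always_eventually) (use C z in simp)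
    then have "((\<lambda>x. f x - G z \<bullet> x) \<longlongrightarrow> 0) (at z within sphere 0 1)"
      using lim by (rule Lim_null_comparison)
    moreover have "((\<lambda>x. G z \<bullet> x) \<longlongrightarrow> G z \<bullet> z) (at z within sphere 0 1)"
      by (intro tendsto_intros)
    ultimately have "((\<lambda>x. (f x - G z \<bullet> x) + G z \<bullet> x) \<longlongrightarrow> 0 + G z \<bullet> z) (at z within sphere 0 1)"
      by (rule tendsto_add)
    then show ?thesis
      using G z by simp
  qed
  then show ?thesis
    by (simp add: continuous_on_def)
qed

lemma convex_body_of_second_order:
  assumes "second_order f"
  obtains K c where "convex_body K" "c \<ge> 1" "\<And>u. norm u = 1 \<Longrightarrow> support_fun K u = f u + c"
proof -
  obtain G C where "C \<ge> 0" and G: "\<And>z. norm z = 1 \<Longrightarrow> G z \<bullet> z = f z"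
    and C: "\<And>x z. norm x = 1 \<Longrightarrow> norm z = 1 \<Longrightarrow> \<bar>f x - G z \<bullet> x\<bar> \<le> C * (norm (x - z))\<^sup>2"
    by (rule second_orderE[OF assms]) blast
  have "G z \<bullet> x - C * (norm (x - z))\<^sup>2 \<le> f x" if "norm x = 1" "norm z = 1" for x z
    using C[OF that] by (simp add: abs_le_iff)
  then show ?thesis
    using convex_body_of_tangents[OF second_order_continuous_on[OF assms] G] that by metis
qed

lemma second_order_orthogonal:
  fixes Q :: "real ^ 'n \<Rightarrow> real ^ 'n"
  assumes "second_order f" "orthogonal_transformation Q"
  shows "second_order (\<lambda>v. f (Q v))"
proof -
  obtain G C where "C \<ge> 0" "\<And>z. norm z = 1 \<Longrightarrow> G z \<bullet> z = f z" and
    C: "\<And>x z. norm x = 1 \<Longrightarrow> norm z = 1 \<Longrightarrow> \<bar>f x - G z \<bullet> x\<bar> \<le> C * (norm (x - z))\<^sup>2"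
    by (rule second_orderE[OF assms(1)]) blast
  have Q: "linear Q" "surj Q" "\<And>x. norm (Q x) = norm x" "\<And>x y. Q x \<bullet> Q y = x \<bullet> y"
    using assms(2) orthogonal_transformation_surj by (auto simp: orthogonal_transformation_def norm_eq_sqrt_inner)
  define R where "R = inv Q"
  have R: "Q (R x) = x" for x
    using Q(2) by (simp add: R_def surj_f_inv_f)
  have "\<bar>f (Q x) - R (G (Q z)) \<bullet> x\<bar> \<le> C * (norm (x - z))\<^sup>2" if "norm x = 1" "norm z = 1" for x z
  proof -
    have "R (G (Q z)) \<bullet> x = G (Q z) \<bullet> Q x"
      using Q(4)[of "R (G (Q z))" x] R by simp
    moreover have "norm (Q x - Q z) = norm (x - z)"
      using Q(1,3) by (metis linear_diff)
    ultimately show ?thesis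
      using C[of "Q x" "Q z"] that Q(3) by simp
  qed
  then show ?thesis
    unfolding second_order_def by (intro exI[of _ "\<lambda>z. R (G (Q z))"]) blast
qed

lemma linear_functional_inner:
  fixes l :: "real ^ 'n \<Rightarrow> real"
  assumes "linear l"
  shows "l x = adjoint l 1 \<bullet> x"
  using adjoint_works[OF assms, of x 1] by (simp add: inner_commute)

text \<open>The constant \<open>b z\<close> is replaced by the linear function
  \<open>b z * (z \<bullet> x)\<close>. By \<open>inner_unit_eq\<close> this costs half of
  \<open>b z\<close> times the squared distance, hence the uniform bound on
  \<open>b\<close>.\<close>

lemma second_order_of_affine:
  fixes f :: "real ^ 'n \<Rightarrow> real"
  assumes lin: "\<And>z. norm z = 1 \<Longrightarrow> linear (l z)" and bd: "\<And>z. norm z = 1 \<Longrightarrow> \<bar>b z\<bar> \<le> B"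
    and C: "\<And>x z. norm x = 1 \<Longrightarrow> norm z = 1 \<Longrightarrow> \<bar>f x - (l z x + b z)\<bar> \<le> C * (norm (x - z))\<^sup>2"
  shows "second_order f"
  unfolding second_order_def
proof (intro exI allI impI)
  fix x z :: "real ^ 'n" assume xz: "norm x = 1" "norm z = 1"
  define q where "q = (norm (x - z))\<^sup>2 / 2"
  have "x \<bullet> z = 1 - q"
    using inner_unit_eq[OF xz] by (simp add: q_def)
  then have "f x - (adjoint (l z) 1 + b z *\<^sub>R z) \<bullet> x = (f x - (l z x + b z)) + b z * q"
    using linear_functional_inner[OF lin[OF xz(2)], of x]
    by (simp add: inner_add_left inner_commute[of z] right_diff_distrib)
  then have "\<bar>f x - (adjoint (l z) 1 + b z *\<^sub>R z) \<bullet> x\<bar> \<le> \<bar>f x - (l z x + b z)\<bar> + \<bar>b z\<bar> * ((norm (x - z))\<^sup>2 / 2)"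
    using abs_triangle_ineq[of "f x - (l z x + b z)" "b z * q"] by (simp add: abs_mult q_def)
  also have "\<dots> \<le> C * (norm (x - z))\<^sup>2 + B * ((norm (x - z))\<^sup>2 / 2)"
    using C[OF xz] bd[OF xz(2)] by (intro add_mono mult_right_mono) auto
  also have "\<dots> = (C + B / 2) * (norm (x - z))\<^sup>2"
    by (simp add: algebra_simps)
  finally show "\<bar>f x - (adjoint (l z) 1 + b z *\<^sub>R z) \<bullet> x\<bar> \<le> (C + B / 2) * (norm (x - z))\<^sup>2" .
qed

text \<open>Testing the estimate at the unit vector in direction \<open>G z\<close> bounds its
  length: two unit vectors are at distance at most 2, which yields \<open>A + 4 * C\<close>.\<close>

lemma second_order_boundedE:
  assumes "second_order f"
  obtains G B C where "B \<ge> 0" "C \<ge> 0" "\<And>z. norm z = 1 \<Longrightarrow> G z \<bullet> z = f z"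
    "\<And>z. norm z = 1 \<Longrightarrow> norm (G z) \<le> B"
    "\<And>x z. norm x = 1 \<Longrightarrow> norm z = 1 \<Longrightarrow> \<bar>f x - G z \<bullet> x\<bar> \<le> C * (norm (x - z))\<^sup>2"
proof -
  obtain G C where "C \<ge> 0" and G: "\<And>z. norm z = 1 \<Longrightarrow> G z \<bullet> z = f z"
    and C: "\<And>x z. norm x = 1 \<Longrightarrow> norm z = 1 \<Longrightarrow> \<bar>f x - G z \<bullet> x\<bar> \<le> C * (norm (x - z))\<^sup>2"
    by (rule second_orderE[OF assms]) blast
  have "bounded (f ` sphere 0 1)"
    using compact_continuous_image[OF second_order_continuous_on[OF assms] compact_sphere]
    by (rule compact_imp_bounded)
  then obtain A where A: "\<And>x. norm x = 1 \<Longrightarrow> \<bar>f x\<bar> \<le> A"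
    unfolding bounded_iff by (metis imageI mem_sphere_0 real_norm_def)
  have le2: "norm (x - z) \<le> 2" if "norm x = 1" "norm z = 1" for x z :: "real ^ 'a"
    using norm_triangle_ineq4[of x z] that by simp
  have G_le: "norm (G z) \<le> A + 4 * C" if z: "norm z = 1" for z
  proof (cases "G z = 0")
    case True
    then show ?thesis
      using A[OF z] \<open>C \<ge> 0\<close> by simp
  next
    case False
    define x where "x = G z /\<^sub>R norm (G z)"
    have x: "norm x = 1"
      using False by (simp add: x_def)
    have "norm (G z) = G z \<bullet> x"
      using False by (simp add: x_def dot_square_norm power2_eq_square)
    also have "\<dots> \<le> f x + C * (norm (x - z))\<^sup>2"
      using C[OF x z] by (simp add: abs_le_iff)
    also have "\<dots> \<le> A + C * 4"
      using A[OF x] power_mono[OF le2[OF x z], of 2] \<open>C \<ge> 0\<close>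
      by (intro add_mono mult_left_mono) (auto simp: abs_le_iff)
    finally show ?thesis
      by simp
  qed
  moreover have "A + 4 * C \<ge> 0"
  proof -
    obtain z :: "real ^ 'a" where "norm z = 1"
      using vector_choose_size[of 1] by auto
    then show ?thesis
      using A[of z] \<open>C \<ge> 0\<close> by simp
  qed
  ultimately show ?thesis
    using that[of "A + 4 * C" C G] \<open>C \<ge> 0\<close> G C by blast
qed

lemma second_order_lipschitz:
  assumes "second_order f"
  obtains L where "L \<ge> 0" "\<And>x z. norm x = 1 \<Longrightarrow> norm z = 1 \<Longrightarrow> \<bar>f x - f z\<bar> \<le> L * norm (x - z)"
proof -
  obtain G B C where "B \<ge> 0" "C \<ge> 0" and G: "\<And>z. norm z = 1 \<Longrightarrow> G z \<bullet> z = f z"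
    and B: "\<And>z. norm z = 1 \<Longrightarrow> norm (G z) \<le> B"
    and C: "\<And>x z. norm x = 1 \<Longrightarrow> norm z = 1 \<Longrightarrow> \<bar>f x - G z \<bullet> x\<bar> \<le> C * (norm (x - z))\<^sup>2"
    by (rule second_order_boundedE[OF assms]) blast
  have sq: "(norm (x - z))\<^sup>2 \<le> 2 * norm (x - z)" if "norm x = 1" "norm z = 1" for x z :: "real ^ 'a"
    using mult_right_mono[of "norm (x - z)" 2 "norm (x - z)"] norm_triangle_ineq4[of x z] that
    by (simp add: power2_eq_square)
  have "\<bar>f x - f z\<bar> \<le> (B + 2 * C) * norm (x - z)" if x: "norm x = 1" and z: "norm z = 1" for x z
  proof -
    have "f x - f z = (f x - G z \<bullet> x) + G z \<bullet> (x - z)"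
      using G[OF z] by (simp add: inner_diff_right)
    then have "\<bar>f x - f z\<bar> \<le> \<bar>f x - G z \<bullet> x\<bar> + \<bar>G z \<bullet> (x - z)\<bar>"
      by simp
    also have "\<dots> \<le> C * (2 * norm (x - z)) + B * norm (x - z)"
    proof (rule add_mono)
      show "\<bar>f x - G z \<bullet> x\<bar> \<le> C * (2 * norm (x - z))"
        using C[OF x z] mult_left_mono[OF sq[OF x z] \<open>C \<ge> 0\<close>] by linarith
      show "\<bar>G z \<bullet> (x - z)\<bar> \<le> B * norm (x - z)"
        using Cauchy_Schwarz_ineq2[of "G z" "x - z"] mult_right_mono[OF B[OF z], of "norm (x - z)"]
        by simp
    qed
    finally show ?thesis
      by (simp add: algebra_simps)
  qed
  moreover have "B + 2 * C \<ge> 0"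
    using \<open>B \<ge> 0\<close> \<open>C \<ge> 0\<close> by simp
  ultimately show ?thesis
    using that by blast
qed

lemma second_order_add:
  assumes "second_order f" "second_order g"
  shows "second_order (\<lambda>x. f x + g x)"
proof -
  obtain G C where C: "\<And>x z. norm x = 1 \<Longrightarrow> norm z = 1 \<Longrightarrow> \<bar>f x - G z \<bullet> x\<bar> \<le> C * (norm (x - z))\<^sup>2"
    using assms(1) unfolding second_order_def by blast
  obtain H D where D: "\<And>x z. norm x = 1 \<Longrightarrow> norm z = 1 \<Longrightarrow> \<bar>g x - H z \<bullet> x\<bar> \<le> D * (norm (x - z))\<^sup>2"
    using assms(2) unfolding second_order_def by blast
  have "\<bar>f x + g x - (G z + H z) \<bullet> x\<bar> \<le> (C + D) * (norm (x - z))\<^sup>2" if "norm x = 1" "norm z = 1" for x z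
    using C[OF that] D[OF that] by (simp add: inner_add_left distrib_right)
  then show ?thesis
    unfolding second_order_def by (intro exI[of _ "\<lambda>z. G z + H z"] exI[of _ "C + D"]) blast
qed

text \<open>The product rule. What the affine tangent leaves over, besides the two given errors, is
  the product of the increments of \<open>f\<close> and \<open>g\<close>, which is of second order
  because both are Lipschitz.\<close>

lemma second_order_mult:
  assumes "second_order f" "second_order g"
  shows "second_order (\<lambda>x. f x * g x)"
proof -
  obtain G C where "C \<ge> 0" and G: "\<And>z. norm z = 1 \<Longrightarrow> G z \<bullet> z = f z"
    and C: "\<And>x z. norm x = 1 \<Longrightarrow> norm z = 1 \<Longrightarrow> \<bar>f x - G z \<bullet> x\<bar> \<le> C * (norm (x - z))\<^sup>2"
    by (rule second_orderE[OF assms(1)]) blast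
  obtain H D where "D \<ge> 0" and H: "\<And>z. norm z = 1 \<Longrightarrow> H z \<bullet> z = g z"
    and D: "\<And>x z. norm x = 1 \<Longrightarrow> norm z = 1 \<Longrightarrow> \<bar>g x - H z \<bullet> x\<bar> \<le> D * (norm (x - z))\<^sup>2"
    by (rule second_orderE[OF assms(2)]) blast
  obtain L where L: "L \<ge> 0" "\<And>x z. norm x = 1 \<Longrightarrow> norm z = 1 \<Longrightarrow> \<bar>f x - f z\<bar> \<le> L * norm (x - z)"
    by (rule second_order_lipschitz[OF assms(1)]) blast
  obtain M where M: "M \<ge> 0" "\<And>x z. norm x = 1 \<Longrightarrow> norm z = 1 \<Longrightarrow> \<bar>g x - g z\<bar> \<le> M * norm (x - z)"
    by (rule second_order_lipschitz[OF assms(2)]) blast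
  have bd: "bounded (f ` sphere 0 1)" "bounded (g ` sphere 0 1)"
    using assms compact_continuous_image[OF second_order_continuous_on compact_sphere] compact_imp_bounded
    by blast+
  then obtain A where A: "\<And>x. norm x = 1 \<Longrightarrow> \<bar>f x\<bar> \<le> A"
    unfolding bounded_iff by (metis imageI mem_sphere_0 real_norm_def)
  obtain B where B: "\<And>x. norm x = 1 \<Longrightarrow> \<bar>g x\<bar> \<le> B"
    using bd(2) unfolding bounded_iff by (metis imageI mem_sphere_0 real_norm_def)
  show ?thesis
  proof (rule second_order_of_affine)
    show "linear (\<lambda>x. g z * (G z \<bullet> x) + f z * (H z \<bullet> x))" for z
      by (intro linearI) (simp_all add: inner_add_right algebra_simps)
    show "\<bar>- (f z * g z)\<bar> \<le> A * B" if z: "norm z = 1" for z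
      using mult_mono[OF A[OF z] B[OF z]] A[OF z] by (simp add: abs_mult)
    show "\<bar>f x * g x - (g z * (G z \<bullet> x) + f z * (H z \<bullet> x) + - (f z * g z))\<bar>
        \<le> (C * B + D * A + L * M) * (norm (x - z))\<^sup>2" if x: "norm x = 1" and z: "norm z = 1" for x z
    proof -
      have "f x * g x - (g z * (G z \<bullet> x) + f z * (H z \<bullet> x) + - (f z * g z))
          = (f x - G z \<bullet> x) * g z + (g x - H z \<bullet> x) * f z + (f x - f z) * (g x - g z)"
        by (simp add: algebra_simps)
      moreover have "\<bar>(f x - G z \<bullet> x) * g z\<bar> \<le> (C * (norm (x - z))\<^sup>2) * B"
        unfolding abs_mult using C[OF x z] B[OF z] by (intro mult_mono) auto
      moreover have "\<bar>(g x - H z \<bullet> x) * f z\<bar> \<le> (D * (norm (x - z))\<^sup>2) * A"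
        unfolding abs_mult using D[OF x z] A[OF z] by (intro mult_mono) auto
      moreover have "\<bar>(f x - f z) * (g x - g z)\<bar> \<le> (L * norm (x - z)) * (M * norm (x - z))"
        unfolding abs_mult using L(2)[OF x z] M(2)[OF x z] L(1) by (intro mult_mono) auto
      ultimately show ?thesis
        by (simp add: algebra_simps power2_eq_square)
    qed
  qed
qed

section \<open>Density of support functions, and C^2 functions\<close>

lemma second_order_real_polynomial_function:
  fixes p :: "real ^ 'n \<Rightarrow> real"
  assumes "real_polynomial_function p"
  shows "second_order p"
  using assms
proof (induction rule: real_polynomial_function.induct)
  case (linear f)
  then show ?case
    by (intro second_order_of_affine[of "\<lambda>_. f" "\<lambda>_. 0" 0 f 0]) (auto simp: bounded_linear.linear)
next
  case (const c)
  then show ?case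
    by (intro second_order_of_affine[of "\<lambda>_ _. 0" "\<lambda>_. c" "\<bar>c\<bar>" _ 0]) (auto intro: linear_zero)
qed (intro second_order_add second_order_mult; assumption)+

text \<open>Polynomials are dense by Stone-Weierstrass and become support functions after adding a
  constant. The bound \<open>c \<ge> 1\<close> is kept so that a ball of radius
  \<open>c - \<epsilon>\<close> makes sense in the positivity proof.\<close>

lemma support_fun_dense:
  fixes f :: "real ^ 'n \<Rightarrow> real"
  assumes "continuous_on (sphere 0 1) f" "\<epsilon> > 0"
  obtains K c where "convex_body K" "c \<ge> 1" "\<And>v. norm v = 1 \<Longrightarrow> \<bar>f v - (support_fun K v - c)\<bar> \<le> \<epsilon>"
proof -
  obtain p where p: "real_polynomial_function p" "\<And>x. x \<in> sphere 0 1 \<Longrightarrow> \<bar>f x - p x\<bar> < \<epsilon>"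
    using Stone_Weierstrass_real_polynomial_function[OF compact_sphere assms] by blast
  obtain K c where K: "convex_body K" "c \<ge> 1" "\<And>u. norm u = 1 \<Longrightarrow> support_fun K u = p u + c"
    by (rule convex_body_of_second_order[OF second_order_real_polynomial_function[OF p(1)]]) blast
  have "\<bar>f v - (support_fun K v - c)\<bar> \<le> \<epsilon>" if "norm v = 1" for v
    using K(3)[OF that] p(2)[of v] that by simp
  then show ?thesis
    using that K(1,2) by blast
qed

text \<open>The segment between two points leaves the sphere, so a tube of balls of one radius
  \<open>e\<close> inside \<open>U\<close> is fixed first. Points closer than \<open>e\<close> are
  handled by the mean value inequality in such a ball; for points farther apart everything is
  bounded and division by \<open>e\<^sup>2\<close> gives the constant.\<close>

lemma C2_on_sphere_imp_second_order:
  fixes f :: "real ^ 'n \<Rightarrow> real"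
  assumes "C2_on_sphere f"
  shows "second_order f"
proof -
  obtain U F and F' :: "real ^ 'n \<Rightarrow> (real ^ 'n) \<Rightarrow>\<^sub>L real"
    and F'' :: "real ^ 'n \<Rightarrow> (real ^ 'n) \<Rightarrow>\<^sub>L ((real ^ 'n) \<Rightarrow>\<^sub>L real)"
    where U: "open U" "sphere 0 1 \<subseteq> U" and F: "\<And>u. u \<in> sphere 0 1 \<Longrightarrow> F u = f u"
      and F': "\<And>x. x \<in> U \<Longrightarrow> (F has_derivative blinfun_apply (F' x)) (at x)"
      and F'': "\<And>x. x \<in> U \<Longrightarrow> (F' has_derivative blinfun_apply (F'' x)) (at x)" "continuous_on U F''"
    using assms unfolding C2_on_sphere_def by blast
  obtain e where e: "e > 0" "(\<Union>x\<in>sphere 0 1. cball x e) \<subseteq> U"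
    using compact_subset_open_imp_cball_epsilon_subset[OF compact_sphere U] by blast
  define N where "N = (\<Union>x\<in>sphere (0 :: real ^ 'n) 1. cball x e)"
  have "compact N"
    unfolding N_def by (rule compact_minkowski_sum_cball[OF compact_sphere])
  have cball_N: "cball z e \<subseteq> N" if "z \<in> sphere 0 1" for z
    using that unfolding N_def by blast
  have "N \<subseteq> U"
    using e(2) by (simp only: N_def)
  have "bounded (F'' ` N)"
    using \<open>compact N\<close> \<open>N \<subseteq> U\<close> F''(2)
    by (intro compact_imp_bounded compact_continuous_image) (auto intro: continuous_on_subset)
  then obtain M where M: "M > 0" "\<And>x. x \<in> N \<Longrightarrow> norm (F'' x) \<le> M"
    unfolding bounded_pos by blast
  have "continuous_on (sphere 0 1) F"
    using U(2) F' has_derivative_at_withinI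
    by (intro has_derivative_continuous_on[of _ _ "\<lambda>x. blinfun_apply (F' x)"]) blast
  then have "bounded (F ` sphere 0 1)"
    using compact_continuous_image[OF _ compact_sphere] compact_imp_bounded by metis
  moreover have "continuous_on (sphere 0 1) F'"
    using U(2) F''(1) has_derivative_at_withinI
    by (intro has_derivative_continuous_on[of _ _ "\<lambda>x. blinfun_apply (F'' x)"]) blast
  then have "bounded (F' ` sphere 0 1)"
    using compact_continuous_image[OF _ compact_sphere] compact_imp_bounded by metis
  ultimately obtain A B where "A > 0" "\<forall>x\<in>F ` sphere 0 1. norm x \<le> A"
    and "B > 0" "\<forall>x\<in>F' ` sphere 0 1. norm x \<le> B"
    unfolding bounded_pos by blast
  then have A: "A > 0" "\<And>x. x \<in> sphere 0 1 \<Longrightarrow> norm (F x) \<le> A"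
    and B: "B > 0" "\<And>x. x \<in> sphere 0 1 \<Longrightarrow> norm (F' x) \<le> B"
    by blast+
  have F'_le: "\<bar>F' z x\<bar> \<le> B * norm x" if "z \<in> sphere 0 1" for x z
    using norm_blinfun[of "F' z" x] mult_right_mono[OF B(2)[OF that], of "norm x"] by simp
  have close: "\<bar>F x - F z - F' z (x - z)\<bar> \<le> M * (norm (x - z))\<^sup>2"
    if xz: "x \<in> sphere 0 1" "z \<in> sphere 0 1" "norm (x - z) \<le> e" for x z
  proof -
    define d where "d = norm (x - z)"
    have sub: "cball z d \<subseteq> N"
      using cball_N[OF xz(2)] xz(3) by (auto simp: d_def)
    have zx: "z \<in> cball z d" "x \<in> cball z d"
      by (auto simp: d_def dist_norm norm_minus_commute)
    have F'_diff: "norm (F' y - F' z) \<le> M * d" if y: "y \<in> cball z d" for y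
    proof -
      have "norm (F' y - F' z) \<le> M * norm (y - z)"
      proof (rule differentiable_bound[OF convex_cball _ _ y zx(1)])
        show "(F' has_derivative blinfun_apply (F'' w)) (at w within cball z d)" if "w \<in> cball z d" for w
          using that sub \<open>N \<subseteq> U\<close> F''(1) by (blast intro: has_derivative_at_withinI)
        show "onorm (blinfun_apply (F'' w)) \<le> M" if "w \<in> cball z d" for w
          using that sub M(2) by (auto simp: norm_blinfun.rep_eq[symmetric])
      qed
      also have "\<dots> \<le> M * d"
        using y M(1) by (simp add: dist_norm norm_minus_commute)
      finally show ?thesis .
    qed
    \<comment> \<open>The mean value inequality is applied twice: to \<open>F'\<close> above, and
      here to \<open>F\<close> minus its linear part at \<open>z\<close>.\<close>
    have "norm ((F x - F' z x) - (F z - F' z z)) \<le> M * d * norm (x - z)"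
    proof (rule differentiable_bound[OF convex_cball _ _ zx(2) zx(1)])
      show "((\<lambda>y. F y - F' z y) has_derivative blinfun_apply (F' w - F' z)) (at w within cball z d)"
        if "w \<in> cball z d" for w
      proof -
        have "(F has_derivative blinfun_apply (F' w)) (at w within cball z d)"
          using that sub \<open>N \<subseteq> U\<close> F' by (blast intro: has_derivative_at_withinI)
        then have "((\<lambda>y. F y - F' z y) has_derivative (\<lambda>h. F' w h - F' z h)) (at w within cball z d)"
          by (intro has_derivative_diff bounded_linear_imp_has_derivative blinfun.bounded_linear_right)
        moreover have "blinfun_apply (F' w - F' z) = (\<lambda>h. F' w h - F' z h)"
          by (simp add: fun_eq_iff blinfun.diff_left)
        ultimately show ?thesis
          by simp
      qed
      show "onorm (blinfun_apply (F' w - F' z)) \<le> M * d" if "w \<in> cball z d" for w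
        using F'_diff[OF that] by (simp add: norm_blinfun.rep_eq)
    qed
    moreover have "(F x - F' z x) - (F z - F' z z) = F x - F z - F' z (x - z)"
      by (simp add: blinfun.diff_right)
    ultimately show ?thesis
      by (simp add: d_def power2_eq_square mult.assoc)
  qed
  have far: "\<bar>F x - F z - F' z (x - z)\<bar> \<le> (2 * A + 2 * B) / e\<^sup>2 * (norm (x - z))\<^sup>2"
    if xz: "x \<in> sphere 0 1" "z \<in> sphere 0 1" "norm (x - z) > e" for x z
  proof -
    have "norm (x - z) \<le> 2"
      using norm_triangle_ineq4[of x z] xz by simp
    then have "\<bar>F' z (x - z)\<bar> \<le> 2 * B"
      using F'_le[OF xz(2), of "x - z"] mult_left_mono[of "norm (x - z)" 2 B] B(1) by linarith
    then have "\<bar>F x - F z - F' z (x - z)\<bar> \<le> 2 * A + 2 * B"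
      using A(2)[OF xz(1)] A(2)[OF xz(2)] by (simp add: abs_le_iff)
    also have "\<dots> \<le> (2 * A + 2 * B) / e\<^sup>2 * (norm (x - z))\<^sup>2"
    proof -
      have "e\<^sup>2 \<le> (norm (x - z))\<^sup>2"
        using xz(3) e(1) by (intro power_mono) auto
      then have "(2 * A + 2 * B) * e\<^sup>2 \<le> (2 * A + 2 * B) * (norm (x - z))\<^sup>2"
        using A(1) B(1) by (intro mult_left_mono) auto
      then show ?thesis
        using e(1) by (simp add: pos_le_divide_eq)
    qed
    finally show ?thesis .
  qed
  show ?thesis
  proof (rule second_order_of_affine)
    show "linear (blinfun_apply (F' z))" for z
      by (simp add: blinfun.bounded_linear_right bounded_linear.linear)
    show "\<bar>F z - F' z z\<bar> \<le> A + B" if "norm z = 1" for z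
      using A(2)[of z] F'_le[of z z] that by (simp add: abs_le_iff)
    show "\<bar>f x - (F' z x + (F z - F' z z))\<bar> \<le> (M + (2 * A + 2 * B) / e\<^sup>2) * (norm (x - z))\<^sup>2"
      if "norm x = 1" "norm z = 1" for x z
    proof -
      have "M * (norm (x - z))\<^sup>2 \<ge> 0" "(2 * A + 2 * B) / e\<^sup>2 * (norm (x - z))\<^sup>2 \<ge> 0"
        using M(1) A(1) B(1) e(1) by simp_all
      then have "\<bar>F x - F z - F' z (x - z)\<bar> \<le> (M + (2 * A + 2 * B) / e\<^sup>2) * (norm (x - z))\<^sup>2"
        using close[of x z] far[of x z] that unfolding distrib_right
        by (cases "norm (x - z) \<le> e") auto
      then show ?thesis
        using F[of x] that by (simp add: blinfun.diff_right algebra_simps)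
    qed
  qed
qed


section \<open>Continuous functionals on the sphere\<close>

text \<open>Lipschitz continuity for the supremum norm on the sphere, the norm being expressed by an
  arbitrary bound \<epsilon>. Only continuous functions are compared, since only they are
  approximated by support functions.\<close>

definition sphere_lipschitz :: "real \<Rightarrow> ((real ^ 'n \<Rightarrow> real) \<Rightarrow> real) \<Rightarrow> bool" where
  "sphere_lipschitz C T \<longleftrightarrow>
     (\<forall>f g \<epsilon>. continuous_on (sphere 0 1) f \<longrightarrow> continuous_on (sphere 0 1) g \<longrightarrow>
       (\<forall>v. norm v = 1 \<longrightarrow> \<bar>f v - g v\<bar> \<le> \<epsilon>) \<longrightarrow> \<bar>T f - T g\<bar> \<le> C * \<epsilon>)"

lemma sphere_lipschitzD:
  assumes "sphere_lipschitz C T" "continuous_on (sphere 0 1) f" "continuous_on (sphere 0 1) g"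
    "\<And>v. norm v = 1 \<Longrightarrow> \<bar>f v - g v\<bar> \<le> \<epsilon>"
  shows "\<bar>T f - T g\<bar> \<le> C * \<epsilon>"
  using assms unfolding sphere_lipschitz_def by blast

lemma sphere_lipschitz_nonneg: "sphere_lipschitz C T \<Longrightarrow> C \<ge> 0"
  using sphere_lipschitzD[of C T "\<lambda>_. 0" "\<lambda>_. 0" 1] by simp

lemma sphere_lipschitz_diff:
  assumes "sphere_lipschitz C S" "sphere_lipschitz D T"
  shows "sphere_lipschitz (C + D) (\<lambda>f. S f - T f)"
  unfolding sphere_lipschitz_def
proof (intro allI impI)
  fix f g :: "real ^ 'a \<Rightarrow> real" and \<epsilon>
  assume *: "continuous_on (sphere 0 1) f" "continuous_on (sphere 0 1) g"
    "\<forall>v. norm v = 1 \<longrightarrow> \<bar>f v - g v\<bar> \<le> \<epsilon>"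
  show "\<bar>(S f - T f) - (S g - T g)\<bar> \<le> (C + D) * \<epsilon>"
    using sphere_lipschitzD[OF assms(1) *(1,2)] sphere_lipschitzD[OF assms(2) *(1,2)] *(3)
    by (force simp: distrib_right)
qed

lemma sphere_lipschitz_cmult:
  assumes "sphere_lipschitz C T"
  shows "sphere_lipschitz (\<bar>a\<bar> * C) (\<lambda>f. a * T f)"
  using assms unfolding sphere_lipschitz_def
  by (simp add: right_diff_distrib[symmetric] abs_mult mult.assoc mult_left_mono)

lemma orthogonal_transformation_sphere:
  fixes Q :: "real ^ 'n \<Rightarrow> real ^ 'n"
  assumes "orthogonal_transformation Q"
  shows "norm (Q x) = norm x" "Q \<in> sphere 0 1 \<rightarrow> sphere 0 1" "continuous_on A Q"
  using assms by (auto simp: orthogonal_transformation linear_continuous_on linear_conv_bounded_linear)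

lemma continuous_on_sphere_compose_orthogonal:
  fixes Q :: "real ^ 'n \<Rightarrow> real ^ 'n"
  assumes "orthogonal_transformation Q" "continuous_on (sphere 0 1) f"
  shows "continuous_on (sphere 0 1) (\<lambda>v. f (Q v))"
  using orthogonal_transformation_sphere[OF assms(1)]
  by (intro continuous_on_compose2[OF assms(2)]) auto

lemma sphere_lipschitz_orthogonal:
  fixes Q :: "real ^ 'n \<Rightarrow> real ^ 'n"
  assumes "sphere_lipschitz C T" "orthogonal_transformation Q"
  shows "sphere_lipschitz C (\<lambda>f. T (\<lambda>v. f (Q v)))"
  unfolding sphere_lipschitz_def
proof (intro allI impI)
  fix f g :: "real ^ 'n \<Rightarrow> real" and \<epsilon>
  assume "continuous_on (sphere 0 1) f" "continuous_on (sphere 0 1) g"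
    "\<forall>v. norm v = 1 \<longrightarrow> \<bar>f v - g v\<bar> \<le> \<epsilon>"
  then show "\<bar>T (\<lambda>v. f (Q v)) - T (\<lambda>v. g (Q v))\<bar> \<le> C * \<epsilon>"
    using orthogonal_transformation_sphere(1)[OF assms(2)]
    by (intro sphere_lipschitzD[OF assms(1)] continuous_on_sphere_compose_orthogonal[OF assms(2)]) simp_all
qed

text \<open>Density of the functions \<open>support_fun K v - c\<close>. This is how identities that
  mixed volumes provide for bodies pass to all continuous functions.\<close>

lemma sphere_lipschitz_eqI:
  assumes S: "sphere_lipschitz C S" and T: "sphere_lipschitz D T" and f: "continuous_on (sphere 0 1) f"
    and eq: "\<And>K c. convex_body K \<Longrightarrow> S (\<lambda>v. support_fun K v - c) = T (\<lambda>v. support_fun K v - c)"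
  shows "S f = T f"
proof -
  define E where "E = C + D"
  have E: "E \<ge> 0"
    using sphere_lipschitz_nonneg[OF S] sphere_lipschitz_nonneg[OF T] by (simp add: E_def)
  have "\<bar>S f - T f\<bar> \<le> \<epsilon>" if "\<epsilon> > 0" for \<epsilon>
  proof -
    \<comment> \<open>\<open>E + 1\<close> replaces \<open>E\<close> because \<open>E\<close> may be
      zero.\<close>
    obtain K c where K: "convex_body K"
      "\<And>v. norm v = 1 \<Longrightarrow> \<bar>f v - (support_fun K v - c)\<bar> \<le> \<epsilon> / (E + 1)"
      using support_fun_dense[OF f, of "\<epsilon> / (E + 1)"] E \<open>\<epsilon> > 0\<close>
      by (metis add_nonneg_pos divide_pos_pos zero_less_one)
    have "continuous_on (sphere 0 1) (\<lambda>v. support_fun K v - c)"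
      using convex_bodyD[OF K(1)] by (intro continuous_intros continuous_on_support_fun)
    then have "\<bar>(S f - T f) - (S (\<lambda>v. support_fun K v - c) - T (\<lambda>v. support_fun K v - c))\<bar> \<le> E * (\<epsilon> / (E + 1))"
      unfolding E_def[symmetric] using K(2) by (intro sphere_lipschitzD[OF sphere_lipschitz_diff[OF S T, folded E_def]] f)
    also have "\<dots> \<le> \<epsilon>"
      using E \<open>\<epsilon> > 0\<close> by (simp add: field_simps)
    finally show ?thesis
      using eq[OF K(1)] by simp
  qed
  then have "\<bar>S f - T f\<bar> \<le> 0"
    by (rule field_le_epsilon[of _ 0, simplified])
  then show ?thesis
    by simp
qed

lemma space_sphere_borel: "sets M = sets sphere_borel \<Longrightarrow> space M = sphere 0 1"
  using sets_eq_imp_space_eq[of M sphere_borel] by (simp add: space_restrict_space)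

lemma integrable_continuous_on_sphere:
  fixes f :: "real ^ 'n \<Rightarrow> real"
  assumes "finite_measure M" "sets M = sets sphere_borel" "continuous_on (sphere 0 1) f"
  shows "integrable M f"
proof -
  interpret finite_measure M
    by fact
  have "bounded (f ` sphere 0 1)"
    using compact_continuous_image[OF assms(3) compact_sphere] by (rule compact_imp_bounded)
  then obtain B where "\<And>x. x \<in> sphere 0 1 \<Longrightarrow> norm (f x) \<le> B"
    unfolding bounded_iff by blast
  moreover have "f \<in> borel_measurable M"
    using borel_measurable_continuous_on_restrict[OF assms(3)] measurable_cong_sets[OF assms(2) refl] by blast
  ultimately show ?thesis
    using space_sphere_borel[OF assms(2)] by (intro integrable_const_bound[where B = B] AE_I2) auto
qed

lemma integral_mono_sphere:
  fixes f :: "real ^ 'n \<Rightarrow> real"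
  assumes "finite_measure M" "sets M = sets sphere_borel"
    "continuous_on (sphere 0 1) f" "continuous_on (sphere 0 1) g" "\<And>v. norm v = 1 \<Longrightarrow> f v \<le> g v"
  shows "(LINT v|M. f v) \<le> (LINT v|M. g v)"
  using assms space_sphere_borel[OF assms(2)]
  by (intro integral_mono integrable_continuous_on_sphere[OF assms(1,2)]) auto

lemma integral_dist_le_sphere:
  fixes f :: "real ^ 'n \<Rightarrow> real"
  assumes "finite_measure M" "sets M = sets sphere_borel"
    "continuous_on (sphere 0 1) f" "continuous_on (sphere 0 1) g" "\<And>v. norm v = 1 \<Longrightarrow> \<bar>f v - g v\<bar> \<le> \<epsilon>"
  shows "\<bar>(LINT v|M. f v) - (LINT v|M. g v)\<bar> \<le> measure M (sphere 0 1) * \<epsilon>"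
proof -
  have "(LINT v|M. f v) - (LINT v|M. g v) = (LINT v|M. f v - g v)"
    using assms integrable_continuous_on_sphere[OF assms(1,2)] by simp
  also have "\<bar>\<dots>\<bar> \<le> (LINT v|M. \<bar>f v - g v\<bar>)"
    by (rule integral_abs_bound)
  also have "\<dots> \<le> (LINT v|M. \<epsilon>)"
    using assms by (intro integral_mono_sphere continuous_intros)
  finally show ?thesis
    using space_sphere_borel[OF assms(2)] by simp
qed

lemma sphere_lipschitz_integral:
  fixes M :: "(real ^ 'n) measure"
  assumes "finite_measure M" "sets M = sets sphere_borel"
  shows "sphere_lipschitz (measure M (sphere 0 1)) (\<lambda>f. LINT v|M. f v)"
  unfolding sphere_lipschitz_def using integral_dist_le_sphere[OF assms] by blast


section \<open>Mixed volumes\<close>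

lemma alternating_sum_Pow:
  fixes A :: "'a set"
  assumes "finite A"
  shows "(\<Sum>T\<in>Pow A. (-1) ^ card T) = (if A = {} then 1 else (0 :: real))"
proof (cases "A = {}")
  case False
  have "(\<Sum>T\<in>Pow A. (-1) ^ card T) = (\<Prod>x\<in>A. 1 - 1 :: real)"
    using prod_diff_conv_sum[OF assms, of "\<lambda>_. 1 :: real" "\<lambda>_. 1"] by simp
  also have "\<dots> = 0"
    using assms False by (simp add: power_0_left)
  finally show ?thesis
    using False by simp
qed simp

lemma sum_power_eq_sum_lists:
  fixes c :: "'a \<Rightarrow> 'b :: comm_semiring_1"
  assumes "finite A"
  shows "(\<Sum>i\<in>A. c i) ^ m = (\<Sum>is | length is = m \<and> set is \<subseteq> A. \<Prod>i\<leftarrow>is. c i)"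
proof (induction m)
  case 0
  have "{is :: 'a list. length is = 0 \<and> set is \<subseteq> A} = {[]}"
    by auto
  then show ?case
    by simp
next
  case (Suc m)
  have eq: "{is. length is = Suc m \<and> set is \<subseteq> A}
      = (\<lambda>(i, is). i # is) ` (A \<times> {is. length is = m \<and> set is \<subseteq> A})" (is "?L = ?f ` ?R")
    by (auto simp: length_Suc_conv image_iff)
  have "inj_on ?f ?R"
    by (auto simp: inj_on_def)
  then have "(\<Sum>is | length is = Suc m \<and> set is \<subseteq> A. \<Prod>i\<leftarrow>is. c i)
      = (\<Sum>(i, is)\<in>?R. c i * (\<Prod>j\<leftarrow>is. c j))"
    unfolding eq by (subst sum.reindex) (auto simp: case_prod_unfold)
  also have "\<dots> = (\<Sum>i\<in>A. c i) * (\<Sum>is | length is = m \<and> set is \<subseteq> A. \<Prod>i\<leftarrow>is. c i)"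
    by (simp add: sum_product sum.cartesian_product)
  finally show ?case
    using Suc by simp
qed

text \<open>\<open>T\<close> is the set of variables put to 0, the others being 1. The alternating
  sum cancels every word that misses an index; the surviving words are the arrangements of
  \<open>[0..<n]\<close>, on which \<open>a\<close> is constant by symmetry.\<close>

lemma polarization:
  fixes a :: "nat list \<Rightarrow> real"
  assumes sym: "\<And>is js. mset is = mset js \<Longrightarrow> a is = a js"
  shows "(\<Sum>T\<in>Pow {..<n}. (-1) ^ card T *
       (\<Sum>is | length is = n \<and> set is \<subseteq> {..<n}. a is * (\<Prod>i\<leftarrow>is. if i \<in> T then 0 else 1)))
     = a [0..<n] * real (card {is. length is = n \<and> set is = {..<n}})"
proof -
  let ?L = "{is. length is = n \<and> set is \<subseteq> {..<n}}"
  have "finite ?L"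
    using finite_lists_length_eq[of "{..<n}" n] by (simp add: conj_commute)
  have prod: "(\<Prod>i\<leftarrow>is. if i \<in> T then 0 else 1 :: real) = (if T \<inter> set is = {} then 1 else 0)" for T "is"
    by (induction "is") auto
  have "(\<Sum>T\<in>Pow {..<n}. (-1) ^ card T *
       (\<Sum>is\<in>?L. a is * (\<Prod>i\<leftarrow>is. if i \<in> T then 0 else 1)))
     = (\<Sum>is\<in>?L. a is * (\<Sum>T\<in>Pow {..<n}. if T \<inter> set is = {} then (-1) ^ card T else 0))"
    unfolding sum_distrib_left prod by (subst sum.swap) (intro sum.cong; simp)
  also have "\<dots> = (\<Sum>is\<in>?L. if set is = {..<n} then a is else 0)"
  proof (intro sum.cong refl)
    fix "is" assume "is \<in> ?L"
    have "{T \<in> Pow {..<n}. T \<inter> set is = {}} = Pow ({..<n} - set is)"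
      by auto
    then have "(\<Sum>T\<in>Pow {..<n}. if T \<inter> set is = {} then (-1) ^ card T else 0)
        = (if {..<n} - set is = {} then 1 else (0 :: real))"
      using alternating_sum_Pow[of "{..<n} - set is"] by (simp add: sum.inter_filter[symmetric])
    then show "a is * (\<Sum>T\<in>Pow {..<n}. if T \<inter> set is = {} then (-1) ^ card T else 0)
        = (if set is = {..<n} then a is else 0)"
      using \<open>is \<in> ?L\<close> by auto
  qed
  also have "\<dots> = (\<Sum>is | length is = n \<and> set is = {..<n}. a is)"
    using \<open>finite ?L\<close> by (subst sum.inter_filter[symmetric]) (auto intro: sum.cong)
  also have "\<dots> = (\<Sum>is | length is = n \<and> set is = {..<n}. a [0..<n])"
  proof (intro sum.cong refl sym)
    fix "is" :: "nat list" assume "is \<in> {is. length is = n \<and> set is = {..<n}}"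
    then have "distinct is" "set is = set [0..<n]"
      by (auto simp: lessThan_atLeast0 intro: card_distinct)
    then show "mset is = mset [0..<n]"
      by (metis distinct_upt set_eq_iff_mset_eq_distinct)
  qed
  finally show ?thesis
    by (simp add: mult.commute)
qed

text \<open>
  Polarization recovers the mixed volume from the values of the volume polynomial.
\<close>
lemma has_mixed_volume_eqI:
  fixes Ks Ls :: "(real ^ 'n) set list"
  assumes K: "has_mixed_volume Ks v" and L: "has_mixed_volume Ls w"
    and \<tau>: "\<tau> permutes {..<CARD('n)}"
    and vol: "\<And>c :: nat \<Rightarrow> real. (\<And>i. c i \<ge> 0) \<Longrightarrow>
      measure lborel (\<Sum>i<CARD('n). dilate (c i) (Ks ! i)) =
      measure lborel (\<Sum>i<CARD('n). dilate (c (\<tau> i)) (Ls ! i))"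
  shows "v = w"
proof -
  let ?n = "CARD('n)"
  let ?ls = "{is. length is = ?n \<and> set is = {..<?n}}"
  define ind where "ind T i = (if i \<in> T then 0 else 1 :: real)" for T and i :: nat
  have val: "(\<Sum>T\<in>Pow {..<?n}. (-1) ^ card T * measure lborel (\<Sum>i<?n. dilate (ind T i) (Ms ! i)))
      = m * real (card ?ls)" if "has_mixed_volume Ms m" for Ms :: "(real ^ 'n) set list" and m
  proof -
    have "\<exists>a :: nat list \<Rightarrow> real. (\<forall>is js. mset is = mset js \<longrightarrow> a is = a js) \<and>
        (\<forall>c :: nat \<Rightarrow> real. (\<forall>i. c i \<ge> 0) \<longrightarrow> measure lborel (\<Sum>i<?n. dilate (c i) (Ms ! i)) =
           (\<Sum>is | length is = ?n \<and> set is \<subseteq> {..<?n}. a is * (\<Prod>i\<leftarrow>is. c i))) \<and>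
        m = a [0..<?n]" (is "\<exists>a. ?P a")
      using that unfolding has_mixed_volume_def by (rule conjunct2)
    then obtain a where "?P a"
      by (rule exE)
    note a = this[THEN conjunct1] this[THEN conjunct2, THEN conjunct1] this[THEN conjunct2, THEN conjunct2]
    have "ind T i \<ge> 0" for T i
      by (simp add: ind_def)
    then have "measure lborel (\<Sum>i<?n. dilate (ind T i) (Ms ! i)) =
         (\<Sum>is | length is = ?n \<and> set is \<subseteq> {..<?n}. a is * (\<Prod>i\<leftarrow>is. ind T i))" for T
      using a(2) by blast
    then show ?thesis
      using polarization[where a = a and n = ?n, OF a(1)[rule_format]] a(3) by (simp add: ind_def[abs_def])
  qed
  have "inj \<tau>"
    using \<tau> by (rule permutes_inj)
  \<comment> \<open>Permuting the bodies permutes the 0/1 vectors at which the two volume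
    polynomials are evaluated, and cardinalities, hence signs, are preserved.\<close>
  have "bij_betw (image \<tau>) (Pow {..<?n}) (Pow {..<?n})"
    using \<tau> by (intro bij_betw_Pow permutes_imp_bij)
  then have "v * real (card ?ls)
      = (\<Sum>T\<in>Pow {..<?n}. (-1) ^ card (\<tau> ` T) * measure lborel (\<Sum>i<?n. dilate (ind (\<tau> ` T) i) (Ks ! i)))"
    unfolding val[OF K, symmetric] by (rule sum.reindex_bij_betw[symmetric])
  also have "\<dots> = (\<Sum>T\<in>Pow {..<?n}. (-1) ^ card T * measure lborel (\<Sum>i<?n. dilate (ind T i) (Ls ! i)))"
  proof (intro sum.cong refl)
    fix T
    have "ind (\<tau> ` T) (\<tau> i) = ind T i" for i
      using \<open>inj \<tau>\<close> by (auto simp: ind_def inj_def)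
    moreover have "card (\<tau> ` T) = card T"
      using \<open>inj \<tau>\<close> by (intro card_image inj_on_subset[OF \<open>inj \<tau>\<close>]) auto
    ultimately show "(-1) ^ card (\<tau> ` T) * measure lborel (\<Sum>i<?n. dilate (ind (\<tau> ` T) i) (Ks ! i))
        = (-1) ^ card T * measure lborel (\<Sum>i<?n. dilate (ind T i) (Ls ! i))"
      using vol[of "ind (\<tau> ` T)"] by (simp add: ind_def)
  qed
  also have "\<dots> = w * real (card ?ls)"
    by (rule val[OF L])
  finally have "v * real (card ?ls) = w * real (card ?ls)" .
  moreover have "finite ?ls"
    using finite_lists_length_eq[of "{..<?n}" ?n] by (rule finite_subset[rotated]) auto
  then have "card ?ls > 0"
    by (auto simp: card_gt_0_iff lessThan_atLeast0 intro!: exI[of _ "[0..<?n]"])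
  ultimately show ?thesis
    by simp
qed

lemma has_mixed_volume_unique:
  assumes "has_mixed_volume Ks v" "has_mixed_volume Ks w"
  shows "v = w"
  using assms by (rule has_mixed_volume_eqI[OF _ _ permutes_id]) simp

lemma has_mixed_volume_swap:
  assumes "has_mixed_volume (K # L # Ks) v" "has_mixed_volume (L # K # Ks) w"
  shows "v = w"
proof (rule has_mixed_volume_eqI[OF assms])
  let ?n = "CARD('a)"
  have "?n = length (K # L # Ks)"
    using assms(1) unfolding has_mixed_volume_def by simp
  then show \<tau>: "Transposition.transpose 0 1 permutes {..<?n}"
    by (intro permutes_swap_id) auto
  fix c :: "nat \<Rightarrow> real"
  have "(K # L # Ks) ! Transposition.transpose 0 1 i = (L # K # Ks) ! i" for i
    by (auto simp: Transposition.transpose_def nth_Cons split: nat.splits)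
  then show "measure lborel (\<Sum>i<?n. dilate (c i) ((K # L # Ks) ! i))
      = measure lborel (\<Sum>i<?n. dilate (c (Transposition.transpose 0 1 i)) ((L # K # Ks) ! i))"
    using sum.permute[OF \<tau>, of "\<lambda>i. dilate (c i) ((K # L # Ks) ! i)"] by (simp add: o_def)
qed

lemma sum_dilate_cball:
  assumes "finite I" "\<And>i. i \<in> I \<Longrightarrow> c i \<ge> 0"
  shows "(\<Sum>i\<in>I. dilate (c i) (cball 0 1)) = (cball 0 (\<Sum>i\<in>I. c i) :: (real ^ 'n) set)"
proof -
  have dil: "dilate r (cball 0 1) = (cball 0 r :: (real ^ 'n) set)" if "r \<ge> 0" for r
    using that cball_scale[of r "0 :: real ^ 'n" 1] by (cases "r = 0") (auto simp: image_constant_conv)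
  have add: "cball 0 r + cball 0 s = (cball 0 (r + s) :: (real ^ 'n) set)" if "r \<ge> 0" "s \<ge> 0" for r s
  proof
    show "cball 0 r + cball 0 s \<subseteq> (cball 0 (r + s) :: (real ^ 'n) set)"
      by (auto elim!: set_plus_elim intro!: order_trans[OF norm_triangle_ineq add_mono])
    show "(cball 0 (r + s) :: (real ^ 'n) set) \<subseteq> cball 0 r + cball 0 s"
    proof
      fix x :: "real ^ 'n" assume x: "x \<in> cball 0 (r + s)"
      show "x \<in> cball 0 r + cball 0 s"
      proof (cases "r + s = 0")
        case True
        then show ?thesis
          using x that set_plus_intro[of "0 :: real ^ 'n" "cball 0 r" 0 "cball 0 s"] by simp
      next
        case False
        then have pos: "r + s > 0"
          using that by simp
        have "x = (r / (r + s)) *\<^sub>R x + (s / (r + s)) *\<^sub>R x"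
          using pos by (simp add: scaleR_add_left[symmetric] add_divide_distrib[symmetric])
        moreover have "(t / (r + s)) * norm x \<le> t" if "t \<ge> 0" for t
          using x pos mult_left_mono[of "norm x" "r + s" t] that by (simp add: field_simps)
        then have "(r / (r + s)) *\<^sub>R x \<in> cball 0 r" "(s / (r + s)) *\<^sub>R x \<in> cball 0 s"
          using that pos by simp_all
        ultimately show ?thesis
          by (metis set_plus_intro)
      qed
    qed
  qed
  show ?thesis
    using assms
  proof (induction I rule: finite_induct)
    case empty
    then show ?case
      by (simp add: set_zero)
  next
    case (insert i I)
    then show ?case
      by (simp add: dil add sum_nonneg)
  qed
qed

text \<open>The \<open>n\<close>-th power of the sum of the \<open>c i\<close> expands over words
  with one and the same coefficient. This fixes the total mass of \<open>S\<^sub>1\<close> of the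
  unit ball later on.\<close>

lemma has_mixed_volume_cball:
  "has_mixed_volume (replicate CARD('n) (cball (0 :: real ^ 'n) 1)) (measure lborel (cball (0 :: real ^ 'n) 1))"
proof -
  let ?B = "cball (0 :: real ^ 'n) 1"
  let ?n = "CARD('n)"
  have "measure lborel (\<Sum>i<?n. dilate (c i) (replicate ?n ?B ! i))
      = (\<Sum>is | length is = ?n \<and> set is \<subseteq> {..<?n}. measure lborel ?B * (\<Prod>i\<leftarrow>is. c i))"
    if "\<And>i. c i \<ge> 0" for c :: "nat \<Rightarrow> real"
  proof -
    have "measure lborel (\<Sum>i<?n. dilate (c i) (replicate ?n ?B ! i)) = measure lborel (cball (0 :: real ^ 'n) (\<Sum>i<?n. c i))"
      using that by (subst sum_dilate_cball[symmetric]) auto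
    also have "\<dots> = measure lborel ?B * (\<Sum>i<?n. c i) ^ ?n"
      using that by (simp add: content_cball sum_nonneg)
    finally show ?thesis
      by (simp add: sum_power_eq_sum_lists sum_distrib_left)
  qed
  then show ?thesis
    unfolding has_mixed_volume_def by (intro conjI exI[of _ "\<lambda>_. measure lborel ?B"]) auto
qed


section \<open>Orthogonal invariance of Lebesgue measure\<close>

lemma orthogonal_transformation_inverse:
  fixes Q :: "real ^ 'n \<Rightarrow> real ^ 'n"
  assumes "orthogonal_transformation Q"
  obtains R where "orthogonal_transformation R" "\<And>x. Q (R x) = x" "\<And>x. R (Q x) = x"
  using orthogonal_transformation_inv[OF assms] orthogonal_transformation_bij[OF assms] that[of "inv Q"]
  by (simp add: bij_def surj_f_inv_f)

lemma borel_measurable_orthogonal: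
  fixes Q :: "real ^ 'n \<Rightarrow> real ^ 'n"
  assumes "orthogonal_transformation Q"
  shows "Q \<in> borel_measurable borel"
  using orthogonal_transformation_sphere(3)[OF assms] by (rule borel_measurable_continuous_onI)

lemma nn_integral_lborel_translation:
  fixes f :: "'a :: euclidean_space \<Rightarrow> ennreal"
  assumes [measurable]: "f \<in> borel_measurable borel"
  shows "(\<integral>\<^sup>+x. f (c + x) \<partial>lborel) = (\<integral>\<^sup>+x. f x \<partial>lborel)"
proof -
  have "(\<integral>\<^sup>+x. f x \<partial>lborel) = (\<integral>\<^sup>+x. f x \<partial>distr lborel borel ((+) c))"
    by (simp only: lborel_distr_plus)
  also have "\<dots> = (\<integral>\<^sup>+x. f (c + x) \<partial>lborel)"
    by (rule nn_integral_distr) auto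
  finally show ?thesis
    by simp
qed

text \<open>
  Any translation invariant measure \<open>\<mu>\<close> satisfies \<open>\<mu> A \<cdot> \<lambda> B = \<lambda> A \<cdot> \<mu> B\<close> by Tonelli, for symmetric \<open>B\<close>. Here
  \<open>\<mu>\<close> is the image of Lebesgue measure under \<open>Q\<close>, and \<open>B\<close> is the unit ball, where the two agree.
\<close>
lemma emeasure_lborel_orthogonal_vimage:
  fixes Q :: "real ^ 'n \<Rightarrow> real ^ 'n"
  assumes Q: "orthogonal_transformation Q" and [measurable]: "A \<in> sets borel"
  shows "emeasure lborel (Q -` A) = emeasure lborel A"
proof -
  obtain R where R: "\<And>x. Q (R x) = x"
    using orthogonal_transformation_inverse[OF Q] by metis
  have [measurable]: "Q \<in> borel_measurable borel"
    by (rule borel_measurable_orthogonal[OF Q])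
  have Q_add: "Q (x + y) = Q x + Q y" for x y
    using orthogonal_transformation_linear[OF Q] by (rule linear_add)
  define a b where "a x = (indicator A x :: ennreal)" and "b x = (indicator (cball 0 1) x :: ennreal)"
    for x :: "real ^ 'n"
  have [measurable]: "a \<in> borel_measurable borel" "b \<in> borel_measurable borel"
    unfolding a_def b_def by (intro borel_measurable_indicator; simp)+
  have int: "integral\<^sup>N lborel a = emeasure lborel A"
    "integral\<^sup>N lborel b = emeasure lborel (cball (0 :: real ^ 'n) 1)"
    by (simp_all add: a_def[abs_def] b_def[abs_def])
  have b_uminus: "b (- x) = b x" for x
    by (simp add: b_def indicator_def)
  have b_Q: "b (Q x) = b x" for x
    using orthogonal_transformation_sphere(1)[OF Q] by (simp add: b_def indicator_def)
  have vimage: "Q -` A \<in> sets lborel"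
    using measurable_sets_borel[OF \<open>Q \<in> borel_measurable borel\<close> \<open>A \<in> sets borel\<close>] by simp
  have "emeasure lborel (Q -` A) * emeasure lborel (cball (0 :: real ^ 'n) 1)
      = (\<integral>\<^sup>+x. a (Q x) \<partial>lborel) * (\<integral>\<^sup>+y. b y \<partial>lborel)"
    using vimage by (simp add: a_def b_def indicator_vimage[symmetric])
  also have "\<dots> = (\<integral>\<^sup>+x. a (Q x) * (\<integral>\<^sup>+y. b y \<partial>lborel) \<partial>lborel)"
    by (subst nn_integral_multc) auto
  \<comment> \<open>Translation invariance inserts the shift by \<open>- Q x\<close> into the
    integral of \<open>b\<close>; it couples the two variables, after which the order of integration
    is exchanged.\<close>
  also have "\<dots> = (\<integral>\<^sup>+x. \<integral>\<^sup>+y. a (Q x) * b (- Q x + y) \<partial>lborel \<partial>lborel)"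
  proof (rule nn_integral_cong)
    fix x
    have "(\<lambda>y. b (- Q x + y)) \<in> borel_measurable lborel"
      by measurable
    from nn_integral_cmult[OF this, of "a (Q x)"]
    show "a (Q x) * (\<integral>\<^sup>+y. b y \<partial>lborel) = (\<integral>\<^sup>+y. a (Q x) * b (- Q x + y) \<partial>lborel)"
      by (simp only: nn_integral_lborel_translation \<open>b \<in> borel_measurable borel\<close>)
  qed
  also have "\<dots> = (\<integral>\<^sup>+y. \<integral>\<^sup>+x. a (Q x) * b (- Q x + y) \<partial>lborel \<partial>lborel)"
    by (rule lborel_pair.Fubini'[symmetric]) measurable
  \<comment> \<open>Shifting \<open>x\<close> by \<open>R y\<close> turns \<open>Q x\<close> into
    \<open>y + Q x\<close>. What is left inside \<open>b\<close> is \<open>- Q x\<close>, and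
    \<open>b\<close> is even and invariant under \<open>Q\<close>.\<close>
  also have "\<dots> = (\<integral>\<^sup>+y. \<integral>\<^sup>+x. a (Q (R y + x)) * b (- Q (R y + x) + y) \<partial>lborel \<partial>lborel)"
    by (intro nn_integral_cong nn_integral_lborel_translation[symmetric]) measurable
  also have "\<dots> = (\<integral>\<^sup>+y. \<integral>\<^sup>+x. a (Q x + y) * b x \<partial>lborel \<partial>lborel)"
    by (simp add: Q_add R b_uminus b_Q add.commute)
  also have "\<dots> = (\<integral>\<^sup>+x. \<integral>\<^sup>+y. a (Q x + y) * b x \<partial>lborel \<partial>lborel)"
    by (rule lborel_pair.Fubini') measurable
  also have "\<dots> = (\<integral>\<^sup>+x. (\<integral>\<^sup>+y. a y \<partial>lborel) * b x \<partial>lborel)"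
    by (simp add: nn_integral_lborel_translation nn_integral_multc)
  also have "\<dots> = emeasure lborel A * emeasure lborel (cball (0 :: real ^ 'n) 1)"
    by (subst nn_integral_cmult) (simp_all add: int)
  finally have "emeasure lborel (Q -` A) * emeasure lborel (cball (0 :: real ^ 'n) 1)
      = emeasure lborel A * emeasure lborel (cball (0 :: real ^ 'n) 1)" .
  moreover have "emeasure lborel (cball (0 :: real ^ 'n) 1) \<noteq> top"
    using emeasure_lborel_cball_finite[of "0 :: real ^ 'n" 1] by auto
  moreover have "emeasure lborel (cball (0 :: real ^ 'n) 1) \<noteq> 0"
    using content_cball_pos[of 1 "0 :: real ^ 'n"] by (auto simp: measure_def)
  ultimately show ?thesis
    by (simp add: ennreal_mult_cancel_left mult.commute[of _ "emeasure lborel (cball 0 1)"])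
qed

lemma emeasure_lborel_orthogonal_image:
  fixes Q :: "real ^ 'n \<Rightarrow> real ^ 'n"
  assumes "orthogonal_transformation Q" "A \<in> sets borel"
  shows "emeasure lborel (Q ` A) = emeasure lborel A"
proof -
  obtain R where R: "orthogonal_transformation R" "\<And>x. Q (R x) = x" "\<And>x. R (Q x) = x"
    using orthogonal_transformation_inverse[OF assms(1)] by blast
  have "Q ` A = R -` A"
    using R by (auto simp: image_iff) metis
  then show ?thesis
    using emeasure_lborel_orthogonal_vimage[OF R(1) assms(2)] by simp
qed

section \<open>Minkowski sums and mixed volumes under orthogonal maps\<close>

lemma compact_sum_sets:
  fixes K :: "'b \<Rightarrow> (real ^ 'n) set"
  assumes "finite I" "\<And>i. i \<in> I \<Longrightarrow> compact (K i)"
  shows "compact (\<Sum>i\<in>I. K i)"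
  using assms
proof (induction I rule: finite_induct)
  case empty
  then show ?case
    by (simp add: set_zero)
next
  case (insert i I)
  have "K i + sum K I = {x + y |x y. x \<in> K i \<and> y \<in> sum K I}"
    by (auto simp: set_plus_def)
  then show ?case
    using insert compact_sums[of "K i" "sum K I"] by simp
qed

lemma linear_image_sum_sets:
  fixes K :: "'b \<Rightarrow> (real ^ 'n) set"
  assumes "linear f"
  shows "f ` (\<Sum>i\<in>I. K i) = (\<Sum>i\<in>I. f ` K i)"
proof -
  have "f ` A + f ` B = f ` (A + B)" for A B
    using assms by (force simp: set_plus_def linear_add image_iff)
  then show ?thesis
    using assms linear_0[OF assms] sum_set_linear[of "image f" K I] by (simp add: o_def)
qed

lemma has_mixed_volume_orthogonal:
  fixes Q :: "real ^ 'n \<Rightarrow> real ^ 'n"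
  assumes "has_mixed_volume Ks v" "has_mixed_volume (map (image Q) Ks) w"
    and Q: "orthogonal_transformation Q" and Ks: "\<And>K. K \<in> set Ks \<Longrightarrow> compact K"
  shows "v = w"
proof (rule has_mixed_volume_eqI[OF assms(1,2) permutes_id])
  fix c :: "nat \<Rightarrow> real"
  have "linear Q"
    using Q by (rule orthogonal_transformation_linear)
  have len: "length Ks = CARD('n)"
    using assms(1) unfolding has_mixed_volume_def by simp
  have "compact (\<Sum>i<CARD('n). dilate (c i) (Ks ! i))"
    using Ks len by (intro compact_sum_sets compact_scaling) auto
  then have "measure lborel (\<Sum>i<CARD('n). dilate (c i) (Ks ! i))
      = measure lborel (Q ` (\<Sum>i<CARD('n). dilate (c i) (Ks ! i)))"
    using emeasure_lborel_orthogonal_image[OF Q] by (simp add: measure_def borel_compact)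
  also have "Q ` (\<Sum>i<CARD('n). dilate (c i) (Ks ! i)) = (\<Sum>i<CARD('n). dilate (c i) (map (image Q) Ks ! i))"
    unfolding linear_image_sum_sets[OF \<open>linear Q\<close>] using len \<open>linear Q\<close>
    by (intro sum.cong) (auto simp: image_image linear_scale)
  finally show "measure lborel (\<Sum>i<CARD('n). dilate (c i) (Ks ! i)) =
      measure lborel (\<Sum>i<CARD('n). dilate (c (id i)) (map (image Q) Ks ! i))"
    by simp
qed

section \<open>Orthogonally invariant measures on the sphere\<close>

text \<open>Invariance is tested on continuous functions rather than on Borel sets because this is
  the form in which density of support functions delivers it for \<open>S\<^sub>1\<close>.\<close>

definition orthogonal_invariant :: "(real ^ 'n) measure \<Rightarrow> bool" where
  "orthogonal_invariant M \<longleftrightarrow> (\<forall>Q f. orthogonal_transformation Q \<longrightarrow> continuous_on (sphere 0 1) f \<longrightarrow>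
     (LINT v|M. f (Q v)) = (LINT v|M. f v :: real))"

lemma sets_sphere_measure: "sets (sphere_measure :: (real ^ 'n) measure) = sets sphere_borel"
  by (simp add: sphere_measure_def)

lemma space_sphere_measure: "space (sphere_measure :: (real ^ 'n) measure) = sphere 0 1"
  by (rule space_sphere_borel[OF sets_sphere_measure])

lemma emeasure_sphere_measure_sphere:
  "emeasure (sphere_measure :: (real ^ 'n) measure) (sphere 0 1)
     = ennreal (real CARD('n) * measure lborel (cball (0 :: real ^ 'n) 1))"
proof -
  have "emeasure (sphere_measure :: (real ^ 'n) measure) (sphere 0 1)
      = of_nat CARD('n) * emeasure lborel {x \<in> cball 0 1 - {0 :: real ^ 'n}. sgn x \<in> sphere 0 1}"
    by (rule emeasure_sphere_measure) (auto simp: sets_restrict_space intro!: image_eqI[of _ _ UNIV])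
  also have "{x \<in> cball 0 1 - {0 :: real ^ 'n}. sgn x \<in> sphere 0 1} = cball 0 1 - {0}"
    by (auto simp: norm_sgn)
  also have "emeasure lborel (cball 0 1 - {0 :: real ^ 'n}) = emeasure lborel (cball (0 :: real ^ 'n) 1)"
    by (rule emeasure_Diff_null_set) (auto intro: null_setsI)
  also have "\<dots> = ennreal (measure lborel (cball (0 :: real ^ 'n) 1))"
    using emeasure_lborel_cball_finite[of "0 :: real ^ 'n" 1] by (intro emeasure_eq_ennreal_measure) auto
  finally show ?thesis
    by (simp add: ennreal_mult ennreal_of_nat_eq_real_of_nat)
qed

lemma measure_sphere_measure:
  "measure (sphere_measure :: (real ^ 'n) measure) (sphere 0 1)
     = real CARD('n) * measure lborel (cball (0 :: real ^ 'n) 1)"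
  by (simp add: measure_def[of sphere_measure] emeasure_sphere_measure_sphere)

lemma measure_sphere_measure_pos: "measure (sphere_measure :: (real ^ 'n) measure) (sphere 0 1) > 0"
  using content_cball_pos[of 1 "0 :: real ^ 'n"] by (simp add: measure_sphere_measure)

lemma finite_sphere_measure: "finite_measure (sphere_measure :: (real ^ 'n) measure)"
  by (rule finite_measureI) (simp add: space_sphere_measure emeasure_sphere_measure_sphere)

lemma measurable_orthogonal_sphere_borel:
  fixes Q :: "real ^ 'n \<Rightarrow> real ^ 'n"
  assumes "orthogonal_transformation Q"
  shows "Q \<in> sphere_borel \<rightarrow>\<^sub>M sphere_borel"
proof (rule measurable_restrict_space2)
  show "Q \<in> space sphere_borel \<rightarrow> sphere 0 1"
    using orthogonal_transformation_sphere(2)[OF assms] by (simp add: space_restrict_space)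
  show "Q \<in> borel_measurable sphere_borel"
    using borel_measurable_orthogonal[OF assms] by (rule measurable_restrict_space1)
qed

lemma dist_orthogonal_transformation:
  "orthogonal_transformation Q \<Longrightarrow> dist (Q x) (Q y) = dist x y"
  unfolding dist_norm orthogonal_transformation by (metis linear_diff)

text \<open>\<open>sgn\<close> commutes with \<open>Q\<close>, so the cone over a preimage is the
  preimage of the cone, and invariance of Lebesgue measure applies.\<close>

lemma distr_sphere_measure_orthogonal:
  fixes Q :: "real ^ 'n \<Rightarrow> real ^ 'n"
  assumes Q: "orthogonal_transformation Q"
  shows "distr sphere_measure sphere_borel Q = sphere_measure"
proof (rule measure_eqI)
  have meas: "Q \<in> sphere_measure \<rightarrow>\<^sub>M sphere_borel"
    using measurable_orthogonal_sphere_borel[OF Q] measurable_cong_sets[OF sets_sphere_measure refl] by blast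
  fix A assume "A \<in> sets (distr sphere_measure sphere_borel Q)"
  then have A: "A \<in> sets sphere_borel"
    by simp
  have A': "Q -` A \<inter> sphere 0 1 \<in> sets sphere_borel"
    using measurable_sets[OF meas A] by (simp add: space_sphere_measure sets_sphere_measure)
  let ?W = "\<lambda>A. {x \<in> cball 0 1 - {0 :: real ^ 'n}. sgn x \<in> A}"
  have "sgn (Q x) = Q (sgn x)" for x
    using orthogonal_transformation_linear[OF Q] orthogonal_transformation_sphere(1)[OF Q]
    by (simp add: sgn_div_norm linear_scale)
  moreover have "Q x = 0 \<longleftrightarrow> x = 0" for x
    using orthogonal_transformation_sphere(1)[OF Q] by (metis norm_eq_zero)
  ultimately have W: "?W (Q -` A \<inter> sphere 0 1) = Q -` ?W A"
    using orthogonal_transformation_sphere(1)[OF Q] by (auto simp: norm_sgn)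
  have "sgn -` A \<inter> space (restrict_space lborel (cball 0 1 - {0 :: real ^ 'n}))
      \<in> sets (restrict_space lborel (cball 0 1 - {0}))"
    using sgn_measurable_sphere A by (rule measurable_sets)
  then have "?W A \<in> sets (restrict_space lborel (cball 0 1 - {0}))"
    by (simp add: space_restrict_space vimage_def Int_def conj_ac)
  then have "?W A \<in> sets borel"
    by (subst (asm) sets_restrict_space_iff) auto
  have "emeasure (distr sphere_measure sphere_borel Q) A = emeasure sphere_measure (Q -` A \<inter> sphere 0 1)"
    using emeasure_distr[OF meas A] by (simp add: space_sphere_measure)
  also have "\<dots> = of_nat CARD('n) * emeasure lborel (Q -` ?W A)"
    by (simp only: emeasure_sphere_measure[OF A'] W)
  also have "\<dots> = emeasure sphere_measure A"
    using emeasure_lborel_orthogonal_vimage[OF Q \<open>?W A \<in> sets borel\<close>] by (simp add: emeasure_sphere_measure[OF A])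
  finally show "emeasure (distr sphere_measure sphere_borel Q) A = emeasure sphere_measure A" .
qed (simp add: sets_sphere_measure)

lemma integral_distr_orthogonal:
  fixes Q :: "real ^ 'n \<Rightarrow> real ^ 'n" and f :: "real ^ 'n \<Rightarrow> real"
  assumes "orthogonal_transformation Q" "sets M = sets sphere_borel" "continuous_on (sphere 0 1) f"
  shows "(LINT v|distr M sphere_borel Q. f v) = (LINT v|M. f (Q v))"
proof (rule integral_distr)
  show "Q \<in> M \<rightarrow>\<^sub>M sphere_borel"
    using measurable_orthogonal_sphere_borel[OF assms(1)] measurable_cong_sets[OF assms(2) refl] by blast
  show "f \<in> borel_measurable sphere_borel"
    by (rule borel_measurable_continuous_on_restrict[OF assms(3)])
qed

lemma orthogonal_invariant_sphere_measure: "orthogonal_invariant (sphere_measure :: (real ^ 'n) measure)"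
  unfolding orthogonal_invariant_def
proof (intro allI impI)
  fix Q :: "real ^ 'n \<Rightarrow> real ^ 'n" and f :: "real ^ 'n \<Rightarrow> real"
  assume "orthogonal_transformation Q" "continuous_on (sphere 0 1) f"
  then show "(LINT v|sphere_measure. f (Q v)) = (LINT v|sphere_measure. f v)"
    using integral_distr_orthogonal[OF _ sets_sphere_measure, of Q f]
    by (simp add: distr_sphere_measure_orthogonal)
qed

lemma sphere_Fubini:
  fixes k :: "real ^ 'n \<Rightarrow> real ^ 'n \<Rightarrow> real"
  assumes M: "finite_measure M" "sets M = sets sphere_borel"
    and N: "finite_measure N" "sets N = sets sphere_borel"
    and k: "continuous_on (sphere 0 1 \<times> sphere 0 1) (case_prod k)"
  shows "(LINT v|N. LINT u|M. k u v) = (LINT u|M. LINT v|N. k u v)"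
    and "integrable M (\<lambda>u. LINT v|N. k u v)"
proof -
  interpret M: finite_measure M
    by fact
  interpret N: finite_measure N
    by fact
  interpret P: pair_sigma_finite M N ..
  interpret MN: finite_measure "M \<Otimes>\<^sub>M N"
    by (rule finite_measure_pair_measure) (rule M N)+
  have space: "space M = sphere 0 1" "space N = sphere 0 1"
    using M N by (simp_all add: space_sphere_borel)
  \<comment> \<open>Joint continuity of the kernel gives Borel measurability on the product of the
    spheres; this step relates it to the product sigma-algebra of \<open>M\<close> and
    \<open>N\<close>.\<close>
  have "(\<lambda>p. p) \<in> M \<Otimes>\<^sub>M N \<rightarrow>\<^sub>M restrict_space borel (sphere 0 1 \<times> sphere 0 1)"
  proof (rule measurable_restrict_space2)
    have id: "(\<lambda>x. x) \<in> borel_measurable (sphere_borel :: (real ^ 'n) measure)"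
      by (intro measurable_restrict_space1) simp
    have "(\<lambda>x. x) \<in> borel_measurable M" "(\<lambda>x. x) \<in> borel_measurable N"
      using id measurable_cong_sets[OF M(2) refl] measurable_cong_sets[OF N(2) refl] by blast+
    then have "fst \<in> borel_measurable (M \<Otimes>\<^sub>M N)" "snd \<in> borel_measurable (M \<Otimes>\<^sub>M N)"
      using measurable_compose[OF measurable_fst] measurable_compose[OF measurable_snd] by blast+
    then have "(\<lambda>p. (fst p, snd p)) \<in> borel_measurable (M \<Otimes>\<^sub>M N)"
      by (rule borel_measurable_Pair)
    then show "(\<lambda>p. p) \<in> borel_measurable (M \<Otimes>\<^sub>M N)"
      by simp
  qed (simp add: space_pair_measure space)
  then have meas: "case_prod k \<in> borel_measurable (M \<Otimes>\<^sub>M N)"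
    using borel_measurable_continuous_on_restrict[OF k] by (rule measurable_compose)
  have "bounded (case_prod k ` (sphere 0 1 \<times> sphere 0 1))"
    using compact_continuous_image[OF k compact_Times[OF compact_sphere compact_sphere]] by (rule compact_imp_bounded)
  then obtain B where B: "\<And>p. p \<in> sphere 0 1 \<times> sphere 0 1 \<Longrightarrow> norm (case_prod k p) \<le> B"
    unfolding bounded_iff by blast
  have "integrable (M \<Otimes>\<^sub>M N) (case_prod k)"
    using B meas by (intro MN.integrable_const_bound[where B = B] AE_I2) (simp_all add: space_pair_measure space)
  then show "(LINT v|N. LINT u|M. k u v) = (LINT u|M. LINT v|N. k u v)" "integrable M (\<lambda>u. LINT v|N. k u v)"
    using P.Fubini_integral P.integrable_fst by auto
qed

lemma integral_nonneg_sphere: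
  fixes f :: "real ^ 'n \<Rightarrow> real"
  assumes "sets M = sets sphere_borel" "\<And>v. norm v = 1 \<Longrightarrow> f v \<ge> 0"
  shows "(LINT v|M. f v) \<ge> 0"
  using assms space_sphere_borel[OF assms(1)] by (intro integral_nonneg_AE AE_I2) auto

lemma integral_cong_sphere:
  fixes f :: "real ^ 'n \<Rightarrow> real"
  assumes "sets M = sets sphere_borel" "\<And>v. norm v = 1 \<Longrightarrow> f v = g v"
  shows "(LINT v|M. f v) = (LINT v|M. g v)"
  using assms space_sphere_borel[OF assms(1)] by (intro Bochner_Integration.integral_cong) auto

lemma integral_const_sphere:
  assumes "sets M = sets (sphere_borel :: (real ^ 'n) measure)"
  shows "(LINT v|M. c) = c * measure M (sphere 0 1)"
  using space_sphere_borel[OF assms] by simp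

text \<open>Finitely many rotated copies of a superlevel set of \<open>f\<close> cover the sphere.\<close>
lemma orthogonal_invariant_full_support:
  fixes f :: "real ^ 'n \<Rightarrow> real"
  assumes M: "finite_measure M" "sets M = sets sphere_borel" "orthogonal_invariant M"
    and mass: "measure M (sphere 0 1) > 0"
    and f: "continuous_on (sphere 0 1) f" "\<And>v. norm v = 1 \<Longrightarrow> f v \<ge> 0" "(LINT v|M. f v) = 0"
    and w: "norm w = 1"
  shows "f w = 0"
proof (rule ccontr)
  assume "f w \<noteq> 0"
  then have "f w > 0"
    using f(2)[OF w] by simp
  then obtain d where d: "d > 0" "\<And>v. v \<in> sphere 0 1 \<Longrightarrow> dist v w < d \<Longrightarrow> dist (f v) (f w) < f w / 2"
    using f(1) w unfolding continuous_on_iff by (metis half_gt_zero mem_sphere_0)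
  have large: "f v > f w / 2" if "norm v = 1" "dist v w < d" for v
    using d(2)[of v] that \<open>f w > 0\<close> by (auto simp: dist_real_def abs_if split: if_splits)
  have "\<exists>q. orthogonal_transformation q \<and> q u = w" if "norm u = 1" for u :: "real ^ 'n"
    using orthogonal_transformation_exists_1[OF that w] by blast
  note ex = this
  \<comment> \<open>\<open>Q u\<close> carries \<open>u\<close> to \<open>w\<close>, so that
    \<open>f\<close> composed with \<open>Q u\<close> exceeds \<open>f w / 2\<close> on the ball of
    radius \<open>d\<close> about \<open>u\<close>.\<close>
  define Q where "Q u = (SOME q. orthogonal_transformation q \<and> q u = w)" for u :: "real ^ 'n"
  have Q: "orthogonal_transformation (Q u)" "Q u u = w" if "norm u = 1" for u
    using someI_ex[OF ex[OF that]] by (simp_all add: Q_def)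
  have "seq_compact (sphere (0 :: real ^ 'n) 1)"
    using compact_sphere by (simp only: compact_eq_seq_compact_metric)
  then have "\<exists>U. finite U \<and> U \<subseteq> sphere (0 :: real ^ 'n) 1 \<and> sphere 0 1 \<subseteq> (\<Union>u\<in>U. ball u d)"
    by (rule seq_compact_imp_totally_bounded[rule_format, OF _ d(1)])
  then obtain U where "finite U \<and> U \<subseteq> sphere (0 :: real ^ 'n) 1 \<and> sphere 0 1 \<subseteq> (\<Union>u\<in>U. ball u d)" ..
  then have U: "finite U" "U \<subseteq> sphere (0 :: real ^ 'n) 1" "sphere 0 1 \<subseteq> (\<Union>u\<in>U. ball u d)"
    by simp_all
  have U_norm: "norm u = 1" if "u \<in> U" for u
    using subsetD[OF U(2) that] by simp
  have cont: "continuous_on (sphere 0 1) (\<lambda>v. f (Q u v))" if "u \<in> U" for u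
    by (rule continuous_on_sphere_compose_orthogonal[OF Q(1)[OF U_norm[OF that]] f(1)])
  have "f w / 2 * measure M (sphere 0 1) = (LINT v|M. f w / 2)"
    by (rule integral_const_sphere[OF M(2), symmetric])
  also have "\<dots> \<le> (LINT v|M. (\<Sum>u\<in>U. f (Q u v)))"
  proof (rule integral_mono_sphere[OF M(1,2)])
    fix v :: "real ^ 'n" assume v: "norm v = 1"
    then have "v \<in> (\<Union>u\<in>U. ball u d)"
      by (intro subsetD[OF U(3)]) simp
    then obtain u where u: "u \<in> U" "dist u v < d"
      by (elim UN_E) simp
    note nu = U_norm[OF u(1)]
    have "dist (Q u v) w = dist v u"
      using Q(2)[OF nu] dist_orthogonal_transformation[OF Q(1)[OF nu], of v u] by simp
    then have "f w / 2 \<le> f (Q u v)"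
      using large[of "Q u v"] u v orthogonal_transformation_sphere(1)[OF Q(1)[OF nu]]
      by (simp add: dist_commute)
    also have "\<dots> \<le> (\<Sum>u\<in>U. f (Q u v))"
    proof (rule member_le_sum[OF u(1) _ U(1)])
      show "0 \<le> f (Q t v)" if "t \<in> U - {u}" for t
        using that v by (intro f(2)) (simp add: orthogonal_transformation_sphere(1)[OF Q(1)[OF U_norm]])
    qed
    finally show "f w / 2 \<le> (\<Sum>u\<in>U. f (Q u v))" .
  qed (auto intro!: continuous_intros cont)
  also have "\<dots> = (\<Sum>u\<in>U. (LINT v|M. f (Q u v)))"
    by (intro Bochner_Integration.integral_sum integrable_continuous_on_sphere[OF M(1,2)] cont)
  also have "\<dots> = (\<Sum>u\<in>U. (LINT v|M. f v))"
    using M(3) Q(1)[OF U_norm] f(1) unfolding orthogonal_invariant_def by (intro sum.cong refl) blast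
  finally show False
    using f(3) \<open>f w > 0\<close> mass by (simp add: mult_le_0_iff)
qed

text \<open>
  Integrating \<open>k (u, v) f (v)\<close> against both measures, with a kernel \<open>k\<close> of small support that depends
  only on the distance of \<open>u\<close> and \<open>v\<close>, compares the two integrals of \<open>f\<close>.
\<close>
lemma orthogonal_invariant_unique:
  fixes f :: "real ^ 'n \<Rightarrow> real"
  assumes M: "finite_measure M" "sets M = sets sphere_borel" "orthogonal_invariant M"
    and N: "finite_measure N" "sets N = sets sphere_borel" "orthogonal_invariant N"
    and mass: "measure M (sphere 0 1) = measure N (sphere 0 1)" "measure M (sphere 0 1) > 0"
    and f: "continuous_on (sphere 0 1) f"
  shows "(LINT v|M. f v) = (LINT v|N. f v)"
proof -
  let ?m = "measure M (sphere 0 1)"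
  obtain w :: "real ^ 'n" where w: "norm w = 1"
    using vector_choose_size[of 1] by auto
  have "\<bar>(LINT v|M. f v) - (LINT v|N. f v)\<bar> \<le> 0 + \<epsilon>" if "\<epsilon> > 0" for \<epsilon>
  proof -
    define \<eta> where "\<eta> = \<epsilon> / ?m"
    have "\<eta> > 0"
      using mass(2) that by (simp add: \<eta>_def)
    have "uniformly_continuous_on (sphere 0 1) f"
      using f compact_sphere by (rule compact_uniformly_continuous)
    then obtain d where d: "d > 0"
      "\<And>u v. u \<in> sphere 0 1 \<Longrightarrow> v \<in> sphere 0 1 \<Longrightarrow> dist v u < d \<Longrightarrow> dist (f v) (f u) < \<eta>"
      using \<open>\<eta> > 0\<close> unfolding uniformly_continuous_on_def by metis
    \<comment> \<open>A tent of radius \<open>d\<close>. Depending only on the distance, it has the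
      same integral around every point of the sphere, and it vanishes where uniform continuity of
      \<open>f\<close> gives no information.\<close>
    define k where "k u v = max 0 (d - dist u v)" for u v :: "real ^ 'n"
    have k_nonneg: "k u v \<ge> 0" for u v
      by (simp add: k_def)
    have k_cont: "continuous_on A (k u)" "continuous_on A (\<lambda>v. k v u)" for A u
      unfolding k_def by (auto intro!: continuous_intros)
    have mean: "(LINT v|L. k u v) = (LINT v|L. k w v)" "(LINT v|L. k v u) = (LINT v|L. k w v)"
      if L: "orthogonal_invariant L" "norm u = 1" for L u
    proof -
      obtain Q where Q: "orthogonal_transformation Q" "Q w = u"
        using orthogonal_transformation_exists_1[OF w L(2)] by blast
      have "(LINT v|L. k u v) = (LINT v|L. k u (Q v))"
        using L Q k_cont unfolding orthogonal_invariant_def by simp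
      also have "(\<lambda>v. k u (Q v)) = k w"
        using Q dist_orthogonal_transformation[OF Q(1), of w] by (auto simp: k_def)
      finally show "(LINT v|L. k u v) = (LINT v|L. k w v)" .
      then show "(LINT v|L. k v u) = (LINT v|L. k w v)"
        by (simp add: k_def dist_commute)
    qed
    define a b where "a = (LINT v|M. k w v)" and "b = (LINT v|N. k w v)"
    have "a \<noteq> 0"
    proof
      assume "a = 0"
      then have "k w w = 0"
        by (intro orthogonal_invariant_full_support[OF M mass(2) k_cont(1) k_nonneg _ w]) (simp add: a_def)
      then show False
        using d(1) by (simp add: k_def)
    qed
    moreover have "a \<ge> 0"
      unfolding a_def using k_nonneg by (intro integral_nonneg_sphere[OF M(2)])
    ultimately have "a > 0"
      by simp
    have k_pair: "continuous_on (sphere 0 1 \<times> sphere 0 1) (\<lambda>(u, v). k u v * h v)"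
      if h: "continuous_on (sphere 0 1) h" for h
    proof -
      have "continuous_on (sphere 0 1 \<times> sphere 0 1) (\<lambda>p. k (fst p) (snd p) * h (snd p))"
        unfolding k_def by (intro continuous_intros continuous_on_compose2[OF h]) auto
      then show ?thesis
        by (simp add: case_prod_unfold)
    qed
    have *: "(LINT u|N. LINT v|M. k u v * h v) = b * (LINT v|M. h v)" if h: "continuous_on (sphere 0 1) h" for h
    proof -
      have "(LINT u|N. LINT v|M. k u v * h v) = (LINT v|M. LINT u|N. k u v * h v)"
        by (rule sphere_Fubini(1)[OF N(1,2) M(1,2) k_pair[OF h], symmetric])
      also have "\<dots> = (LINT v|M. b * h v)"
        using mean(2)[OF N(3)] by (intro integral_cong_sphere[OF M(2)]) (simp add: b_def)
      finally show ?thesis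
        by simp
    qed
    \<comment> \<open>The double integral of the kernel alone, computed in both orders; here the
      equality of the total masses enters.\<close>
    have "a * ?m = b * ?m"
    proof -
      have "b * ?m = (LINT u|N. LINT v|M. k u v)"
        using *[of "\<lambda>_. 1"] integral_const_sphere[OF M(2), of 1] by simp
      also have "\<dots> = (LINT u|N. a)"
        using mean(1)[OF M(3)] by (intro integral_cong_sphere[OF N(2)]) (simp add: a_def)
      also have "\<dots> = a * measure N (sphere 0 1)"
        by (rule integral_const_sphere[OF N(2)])
      finally show ?thesis
        using mass(1) by metis
    qed
    then have "a = b"
      using mass(2) by simp
    have "\<bar>a * (LINT v|M. f v) - a * (LINT v|N. f v)\<bar> \<le> a * \<epsilon>"
    proof -
      have lin: "(LINT v|M. k u v * f v) - a * f u = (LINT v|M. k u v * (f v - f u))" if "norm u = 1" for u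
      proof -
        have "(LINT v|M. k u v * (f v - f u)) = (LINT v|M. k u v * f v - k u v * f u)"
          by (simp add: algebra_simps)
        also have "\<dots> = (LINT v|M. k u v * f v) - (LINT v|M. k u v * f u)"
          by (intro Bochner_Integration.integral_diff integrable_continuous_on_sphere[OF M(1,2)]
              continuous_intros k_cont f)
        finally show ?thesis
          using mean(1)[OF M(3) that] by (simp add: a_def)
      qed
      have bound: "\<bar>(LINT v|M. k u v * f v) - a * f u\<bar> \<le> a * \<eta>" if u: "norm u = 1" for u
      proof -
        have "\<bar>(LINT v|M. k u v * f v) - a * f u\<bar> \<le> (LINT v|M. \<bar>k u v * (f v - f u)\<bar>)"
          unfolding lin[OF u] by (rule integral_abs_bound)
        also have "\<dots> \<le> (LINT v|M. k u v * \<eta>)"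
        proof (rule integral_mono_sphere[OF M(1,2)])
          show "\<bar>k u v * (f v - f u)\<bar> \<le> k u v * \<eta>" if "norm v = 1" for v
          proof (cases "dist v u < d")
            case True
            then have "\<bar>f v - f u\<bar> \<le> \<eta>"
              using d(2)[of u v] u that by (simp add: dist_real_def)
            then show ?thesis
              using k_nonneg[of u v] by (simp add: abs_mult mult_left_mono)
          next
            case False
            then show ?thesis
              by (simp add: k_def dist_commute)
          qed
        qed (intro continuous_intros k_cont f)+
        also have "\<dots> = a * \<eta>"
          using mean(1)[OF M(3) u] by (simp add: a_def)
        finally show ?thesis .
      qed
      note int = sphere_Fubini(2)[OF N(1,2) M(1,2) k_pair[OF f]] integrable_continuous_on_sphere[OF N(1,2) f]
      have "a * (LINT v|M. f v) - a * (LINT v|N. f v) = (LINT u|N. (LINT v|M. k u v * f v) - a * f u)"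
        using *[OF f] \<open>a = b\<close> int by simp
      also have "\<bar>\<dots>\<bar> \<le> (LINT u|N. \<bar>(LINT v|M. k u v * f v) - a * f u\<bar>)"
        by (rule integral_abs_bound)
      also have "\<dots> \<le> (LINT u|N. a * \<eta>)"
        using bound int space_sphere_borel[OF N(2)] integrable_continuous_on_sphere[OF N(1,2) continuous_on_const]
        by (intro integral_mono integrable_abs Bochner_Integration.integrable_diff integrable_mult_right) auto
      also have "\<dots> = a * \<eta> * ?m"
        by (subst integral_const_sphere[OF N(2)]) (simp add: mass(1))
      also have "\<dots> = a * \<epsilon>"
        using mass(2) by (simp add: \<eta>_def)
      finally show ?thesis .
    qed
    then have "a * \<bar>(LINT v|M. f v) - (LINT v|N. f v)\<bar> \<le> a * \<epsilon>"
      using \<open>a > 0\<close> by (simp add: right_diff_distrib[symmetric] abs_mult)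
    then show ?thesis
      using \<open>a > 0\<close> by simp
  qed
  then have "\<bar>(LINT v|M. f v) - (LINT v|N. f v)\<bar> \<le> 0"
    by (rule field_le_epsilon)
  then show ?thesis
    by simp
qed

section \<open>First-order area measures\<close>

locale first_area_measures =
  fixes S\<^sub>1 :: "(real ^ 'n) set \<Rightarrow> (real ^ 'n) measure"
  assumes dim: "CARD('n) \<ge> 2"
    and first_area: "convex_body K \<Longrightarrow> is_first_area_measure K (S\<^sub>1 K)"
begin

lemma sets_S\<^sub>1: "convex_body K \<Longrightarrow> sets (S\<^sub>1 K) = sets sphere_borel"
  and finite_S\<^sub>1: "convex_body K \<Longrightarrow> finite_measure (S\<^sub>1 K)"
  using first_area[of K] by (simp_all add: is_first_area_measure_def is_mixed_area_measure_def)

lemma integrable_S\<^sub>1: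
  fixes f :: "real ^ 'n \<Rightarrow> real"
  assumes "convex_body K" "continuous_on (sphere 0 1) f"
  shows "integrable (S\<^sub>1 K) f"
  using integrable_continuous_on_sphere finite_S\<^sub>1 sets_S\<^sub>1 assms by blast

lemma mixed_volume_S\<^sub>1:
  assumes "convex_body K" "convex_body L"
  shows "has_mixed_volume (L # K # replicate (CARD('n) - 2) (cball 0 1)) (1 / real CARD('n) * (LINT u|S\<^sub>1 K. support_fun L u))"
  using first_area[OF assms(1)] assms(2)
  by (simp add: is_first_area_measure_def is_mixed_area_measure_def)

text \<open>Both sides are \<open>n\<close> times the mixed volume V(K, L, B, ..., B) with the unit
  ball B. This symmetry is what moves a kernel into the measure.\<close>

lemma integral_S\<^sub>1_commute:
  assumes "convex_body K" "convex_body L"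
  shows "(LINT u|S\<^sub>1 K. support_fun L u) = (LINT u|S\<^sub>1 L. support_fun K u)"
  using has_mixed_volume_swap[OF mixed_volume_S\<^sub>1[OF assms] mixed_volume_S\<^sub>1[OF assms(2,1)]] by simp

text \<open>\<open>S\<^sub>1\<close> is accessible only through mixed volumes, so the identity is
  first read off for support functions from the invariance of volume, then for constants through the
  unit ball, and then extended by density.\<close>

lemma integral_S\<^sub>1_orthogonal:
  fixes Q :: "real ^ 'n \<Rightarrow> real ^ 'n" and f :: "real ^ 'n \<Rightarrow> real"
  assumes Q: "orthogonal_transformation Q" and K: "convex_body K" and f: "continuous_on (sphere 0 1) f"
  shows "(LINT v|S\<^sub>1 (Q ` K). f v) = (LINT v|S\<^sub>1 K. f (Q v))"
proof -
  have QK: "convex_body (Q ` K)"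
    by (rule convex_body_orthogonal_image[OF Q K])
  have ball: "Q ` cball 0 1 = cball 0 1"
    using image_orthogonal_transformation_cball[OF Q, of 0 1] linear_0[OF orthogonal_transformation_linear[OF Q]]
    by simp
  have body: "(LINT v|S\<^sub>1 (Q ` K). support_fun L v) = (LINT v|S\<^sub>1 K. support_fun L (Q v))" if L: "convex_body L" for L
  proof -
    obtain R where R: "orthogonal_transformation R" "\<And>x. Q (R x) = x" "\<And>x. R (Q x) = x"
      by (rule orthogonal_transformation_inverse[OF Q]) blast
    \<comment> \<open>The test body is pulled back by the inverse \<open>R\<close>, so that applying
      \<open>Q\<close> to the whole list restores \<open>L\<close> and keeps the balls.\<close>
    have RL: "convex_body (R ` L)"
      by (rule convex_body_orthogonal_image[OF R(1) L])
    have "Q ` R ` L = L"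
      using R(2) by (simp add: image_image)
    then have map: "map (image Q) (R ` L # K # replicate (CARD('n) - 2) (cball 0 1))
        = L # Q ` K # replicate (CARD('n) - 2) (cball 0 1)"
      using ball by (simp add: map_replicate)
    have "1 / real CARD('n) * (LINT u|S\<^sub>1 K. support_fun (R ` L) u)
        = 1 / real CARD('n) * (LINT u|S\<^sub>1 (Q ` K). support_fun L u)"
    proof (rule has_mixed_volume_orthogonal[OF mixed_volume_S\<^sub>1[OF K RL] _ Q])
      show "has_mixed_volume (map (image Q) (R ` L # K # replicate (CARD('n) - 2) (cball 0 1)))
          (1 / real CARD('n) * (LINT u|S\<^sub>1 (Q ` K). support_fun L u))"
        unfolding map by (rule mixed_volume_S\<^sub>1[OF QK L])
      show "compact M" if "M \<in> set (R ` L # K # replicate (CARD('n) - 2) (cball 0 1))" for M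
        using that convex_bodyD(1)[OF K] convex_bodyD(1)[OF RL] by (auto split: if_splits)
    qed
    moreover have "support_fun (R ` L) u = support_fun L (Q u)" for u
      using support_fun_orthogonal_image[OF R(1) convex_bodyD(1,3)[OF L], of "Q u"] R(3) by simp
    ultimately show ?thesis
      by simp
  qed
  have const: "(LINT v|S\<^sub>1 (Q ` K). c) = (LINT v|S\<^sub>1 K. c)" for c :: real
  proof -
    have "(LINT v|S\<^sub>1 (Q ` K). support_fun (cball 0 1) v) = (LINT v|S\<^sub>1 K. support_fun (cball 0 1) (Q v))"
      by (rule body) (simp add: convex_body_cball)
    moreover have "(LINT v|S\<^sub>1 (Q ` K). support_fun (cball 0 1) v) = (LINT v|S\<^sub>1 (Q ` K). 1)"
      by (rule integral_cong_sphere[OF sets_S\<^sub>1[OF QK]]) (simp add: support_fun_cball)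
    moreover have "(LINT v|S\<^sub>1 K. support_fun (cball 0 1) (Q v)) = (LINT v|S\<^sub>1 K. 1)"
      by (rule integral_cong_sphere[OF sets_S\<^sub>1[OF K]])
        (simp add: support_fun_cball orthogonal_transformation_sphere(1)[OF Q])
    ultimately show ?thesis
      by simp
  qed
  show ?thesis
  proof (rule sphere_lipschitz_eqI[OF sphere_lipschitz_integral[OF finite_S\<^sub>1[OF QK] sets_S\<^sub>1[OF QK]]
        sphere_lipschitz_orthogonal[OF sphere_lipschitz_integral[OF finite_S\<^sub>1[OF K] sets_S\<^sub>1[OF K]] Q] f])
    fix L :: "(real ^ 'n) set" and c :: real assume L: "convex_body L"
    have cont: "continuous_on (sphere 0 1) (support_fun L)"
      by (rule continuous_on_support_fun[OF convex_bodyD(1,3)[OF L]])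
    show "(LINT v|S\<^sub>1 (Q ` K). support_fun L v - c) = (LINT v|S\<^sub>1 K. support_fun L (Q v) - c)"
      using body[OF L] const[of c] integrable_S\<^sub>1[OF QK cont] integrable_S\<^sub>1[OF QK continuous_on_const]
        integrable_S\<^sub>1[OF K continuous_on_sphere_compose_orthogonal[OF Q cont]] integrable_S\<^sub>1[OF K continuous_on_const]
      by (simp only: Bochner_Integration.integral_diff)
  qed
qed

lemma orthogonal_invariant_S\<^sub>1_cball: "orthogonal_invariant (S\<^sub>1 (cball 0 1))"
  unfolding orthogonal_invariant_def
proof (intro allI impI)
  fix Q :: "real ^ 'n \<Rightarrow> real ^ 'n" and f :: "real ^ 'n \<Rightarrow> real"
  assume Q: "orthogonal_transformation Q" and f: "continuous_on (sphere 0 1) f"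
  have "Q ` cball 0 1 = cball 0 1"
    using image_orthogonal_transformation_cball[OF Q, of 0 1] linear_0[OF orthogonal_transformation_linear[OF Q]]
    by simp
  then show "(LINT v|S\<^sub>1 (cball 0 1). f (Q v)) = (LINT v|S\<^sub>1 (cball 0 1). f v)"
    using integral_S\<^sub>1_orthogonal[OF Q _ f, of "cball 0 1"] by (simp add: convex_body_cball)
qed

text \<open>An instance of the uniqueness of invariant measures. The masses agree because V(B, ...,
  B) is the volume of the unit ball B and the sphere has surface area \<open>n\<close> times
  that.\<close>

lemma integral_S\<^sub>1_cball:
  fixes f :: "real ^ 'n \<Rightarrow> real"
  assumes f: "continuous_on (sphere 0 1) f"
  shows "(LINT v|S\<^sub>1 (cball 0 1). f v) = (LINT v|sphere_measure. f v)"
proof (rule orthogonal_invariant_unique[OF _ _ _ finite_sphere_measure sets_sphere_measure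
      orthogonal_invariant_sphere_measure _ _ f])
  have B: "convex_body (cball 0 1 :: (real ^ 'n) set)"
    by (simp add: convex_body_cball)
  show "finite_measure (S\<^sub>1 (cball 0 1))" "sets (S\<^sub>1 (cball 0 1)) = sets sphere_borel"
    by (rule finite_S\<^sub>1[OF B] sets_S\<^sub>1[OF B])+
  show "orthogonal_invariant (S\<^sub>1 (cball 0 1))"
    by (rule orthogonal_invariant_S\<^sub>1_cball)
  \<comment> \<open>The dimension bound makes the natural subtraction exact: two bodies and
    \<open>CARD('n) - 2\<close> balls are \<open>CARD('n)\<close> bodies.\<close>
  have "CARD('n) = Suc (Suc (CARD('n) - 2))"
    using dim by simp
  then have "cball 0 1 # cball 0 1 # replicate (CARD('n) - 2) (cball 0 1) = replicate CARD('n) (cball (0 :: real ^ 'n) 1)"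
    by (metis replicate_Suc)
  then have "1 / real CARD('n) * (LINT u|S\<^sub>1 (cball 0 1). support_fun (cball 0 1) u) = measure lborel (cball (0 :: real ^ 'n) 1)"
    using has_mixed_volume_unique[OF _ has_mixed_volume_cball] mixed_volume_S\<^sub>1[OF B B] by metis
  moreover have "(LINT u|S\<^sub>1 (cball 0 1). support_fun (cball 0 1) u) = (LINT u|S\<^sub>1 (cball 0 1). 1)"
    by (rule integral_cong_sphere[OF sets_S\<^sub>1[OF B]]) (simp add: support_fun_cball)
  moreover have "(LINT u|S\<^sub>1 (cball 0 1). 1) = 1 * measure (S\<^sub>1 (cball 0 1)) (sphere 0 1)"
    by (rule integral_const_sphere[OF sets_S\<^sub>1[OF B]])
  ultimately show mass: "measure (S\<^sub>1 (cball 0 1)) (sphere 0 1) = measure (sphere_measure :: (real ^ 'n) measure) (sphere 0 1)"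
    by (simp add: measure_sphere_measure field_simps)
  show "measure (S\<^sub>1 (cball 0 1)) (sphere 0 1) > 0"
    unfolding mass by (rule measure_sphere_measure_pos)
qed

text \<open>On the sphere 1 is the support function of the unit ball, and symmetry exchanges this
  ball with \<open>K\<close>.\<close>

lemma measure_S\<^sub>1:
  assumes "convex_body K"
  shows "measure (S\<^sub>1 K) (sphere 0 1) = (LINT u|sphere_measure. support_fun K u)"
proof -
  have "measure (S\<^sub>1 K) (sphere 0 1) = (LINT u|S\<^sub>1 K. 1)"
    using integral_const_sphere[OF sets_S\<^sub>1[OF assms], of 1] by simp
  also have "\<dots> = (LINT u|S\<^sub>1 K. support_fun (cball 0 1) u)"
    by (rule integral_cong_sphere[OF sets_S\<^sub>1[OF assms]]) (simp add: support_fun_cball)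
  also have "\<dots> = (LINT u|S\<^sub>1 (cball 0 1). support_fun K u)"
    by (rule integral_S\<^sub>1_commute[OF assms]) (simp add: convex_body_cball)
  also have "\<dots> = (LINT u|sphere_measure. support_fun K u)"
    by (rule integral_S\<^sub>1_cball[OF continuous_on_support_fun[OF convex_bodyD(1,3)[OF assms]]])
  finally show ?thesis .
qed

end

section \<open>Profiles of zonal functions\<close>

lemma zonal_profile_eq:
  assumes "zonal e f" "norm v = 1"
  shows "zonal_profile e f (v \<bullet> e) = f v"
proof -
  have "\<exists>F. \<forall>u\<in>sphere 0 1. f u = F (u \<bullet> e)"
    using assms(1) by (simp add: zonal_def)
  from someI_ex[OF this] have "\<forall>u\<in>sphere 0 1. f u = zonal_profile e f (u \<bullet> e)"
    unfolding zonal_profile_def .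
  then show ?thesis
    using assms(2) by simp
qed

text \<open>It rewrites the convolution kernel as a rotated copy of \<open>f\<close>, through which
  smoothness and integrals of the generating function pass to the kernel.\<close>

lemma zonal_profile_orthogonal:
  fixes Q :: "real ^ 'n \<Rightarrow> real ^ 'n"
  assumes "zonal e f" "orthogonal_transformation Q" "Q u = e" "norm v = 1"
  shows "zonal_profile e f (u \<bullet> v) = f (Q v)"
proof -
  have "u \<bullet> v = Q v \<bullet> e"
    using assms(2,3) unfolding orthogonal_transformation_def by (metis inner_commute)
  then show ?thesis
    using zonal_profile_eq[OF assms(1), of "Q v"] orthogonal_transformation_sphere(1)[OF assms(2)] assms(4) by simp
qed

lemma orthogonal_unit_vector_exists:
  fixes e :: "real ^ 'n"
  assumes "CARD('n) \<ge> 2" "norm e = 1"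
  obtains y where "norm y = 1" "e \<bullet> y = 0"
proof -
  obtain y where y: "y \<noteq> 0" "orthogonal e y"
    using orthogonal_to_vector_exists[of e] assms(1) by auto
  then show ?thesis
    using that[of "y /\<^sub>R norm y"] by (simp add: orthogonal_def)
qed

lemma continuous_on_zonal_profile:
  fixes e :: "real ^ 'n"
  assumes dim: "CARD('n) \<ge> 2" and e: "norm e = 1" and f: "zonal e f" "continuous_on (sphere 0 1) f"
  shows "continuous_on {-1..1} (zonal_profile e f)"
proof -
  obtain y where y: "norm y = 1" "e \<bullet> y = 0"
    by (rule orthogonal_unit_vector_exists[OF dim e])
  \<comment> \<open>A meridian from \<open>- e\<close> to \<open>e\<close>, parametrised by the
    inner product with \<open>e\<close>; the profile is \<open>f\<close> along it.\<close>
  define p where "p t = t *\<^sub>R e + sqrt (1 - t\<^sup>2) *\<^sub>R y" for t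
  have p_norm: "norm (p t) = 1" if "t \<in> {-1..1}" for t
  proof -
    have "t\<^sup>2 \<le> 1"
      using that by (simp add: abs_square_le_1 abs_le_iff)
    then have "p t \<bullet> p t = 1"
      using e y by (simp add: p_def inner_add inner_commute[of y e] norm_eq_1 power2_eq_square[symmetric])
    then show ?thesis
      by (simp add: norm_eq_1)
  qed
  have p_inner: "p t \<bullet> e = t" for t
    using e y by (simp add: p_def inner_add inner_commute[of y e] norm_eq_1)
  have "continuous_on {-1..1} (\<lambda>t. f (p t))"
  proof (rule continuous_on_compose2[OF f(2)])
    show "continuous_on {-1..1} p"
      unfolding p_def by (intro continuous_intros)
    show "p ` {-1..1} \<subseteq> sphere 0 1"
      using p_norm by auto
  qed
  moreover have "zonal_profile e f t = f (p t)" if "t \<in> {-1..1}" for t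
    using zonal_profile_eq[OF f(1) p_norm[OF that]] p_inner by simp
  ultimately show ?thesis
    using continuous_on_cong by (metis (no_types, lifting))
qed

section \<open>The operator induced on continuous functions\<close>

lemma continuous_on_uniform_approx:
  fixes F :: "'a :: metric_space \<Rightarrow> real"
  assumes "\<And>\<epsilon>. \<epsilon> > 0 \<Longrightarrow> \<exists>h. continuous_on A h \<and> (\<forall>x\<in>A. \<bar>F x - h x\<bar> \<le> \<epsilon>)"
  shows "continuous_on A F"
  unfolding continuous_on_iff
proof (intro ballI allI impI)
  fix x and \<epsilon> :: real assume x: "x \<in> A" and "\<epsilon> > 0"
  obtain h where h: "continuous_on A h" "\<forall>x\<in>A. \<bar>F x - h x\<bar> \<le> \<epsilon> / 4"
    using assms[of "\<epsilon> / 4"] \<open>\<epsilon> > 0\<close> by auto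
  obtain d where d: "d > 0" "\<forall>y\<in>A. dist y x < d \<longrightarrow> dist (h y) (h x) < \<epsilon> / 2"
    using h(1) x \<open>\<epsilon> > 0\<close> unfolding continuous_on_iff by (meson half_gt_zero)
  have "dist (F y) (F x) < \<epsilon>" if "y \<in> A" "dist y x < d" for y
  proof -
    have "\<bar>F y - h y\<bar> \<le> \<epsilon> / 4" "\<bar>F x - h x\<bar> \<le> \<epsilon> / 4" "\<bar>h y - h x\<bar> < \<epsilon> / 2"
      using h(2) d(2) that x by (auto simp: dist_real_def)
    then show ?thesis
      unfolding dist_real_def by linarith
  qed
  then show "\<exists>d>0. \<forall>y\<in>A. dist y x < d \<longrightarrow> dist (F y) (F x) < \<epsilon>"
    using d(1) by blast
qed

locale zonal_operator = first_area_measures S\<^sub>1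
  for S\<^sub>1 :: "(real ^ 'n) set \<Rightarrow> (real ^ 'n) measure" +
  fixes \<Phi> :: "(real ^ 'n) set \<Rightarrow> (real ^ 'n) set" and e :: "real ^ 'n" and g :: "real ^ 'n \<Rightarrow> real"
  assumes e: "norm e = 1"
    and \<Phi>_body: "convex_body K \<Longrightarrow> convex_body (\<Phi> K)"
    and \<Phi>_mono: "convex_body K \<Longrightarrow> convex_body L \<Longrightarrow> K \<subseteq> L \<Longrightarrow> \<Phi> K \<subseteq> \<Phi> L"
    and zonal: "zonal e g" and smooth: "second_order g"
    and support_\<Phi>: "convex_body K \<Longrightarrow> norm u = 1 \<Longrightarrow>
      support_fun (\<Phi> K) u = (LINT v|S\<^sub>1 K. zonal_profile e g (u \<bullet> v))"
begin

abbreviation \<kappa> :: "real ^ 'n \<Rightarrow> real ^ 'n \<Rightarrow> real" where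
  "\<kappa> u v \<equiv> zonal_profile e g (u \<bullet> v)"

abbreviation \<sigma> :: "(real ^ 'n \<Rightarrow> real) \<Rightarrow> real" where
  "\<sigma> f \<equiv> LINT u|sphere_measure. f u"

definition G :: real where
  "G = \<sigma> g"

lemma to_pole:
  fixes u :: "real ^ 'n"
  assumes "norm u = 1"
  obtains Q where "orthogonal_transformation Q" "Q u = e"
  using orthogonal_transformation_exists_1[OF assms e] by blast

lemma second_order_\<kappa>:
  assumes "norm u = 1"
  shows "second_order (\<kappa> u)"
proof -
  obtain Q where Q: "orthogonal_transformation Q" "Q u = e"
    by (rule to_pole[OF assms])
  show ?thesis
    by (rule second_order_cong[OF second_order_orthogonal[OF smooth Q(1)]])
      (simp add: zonal_profile_orthogonal[OF zonal Q])
qed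

lemma continuous_\<kappa>: "norm u = 1 \<Longrightarrow> continuous_on (sphere 0 1) (\<kappa> u)"
  by (intro second_order_continuous_on second_order_\<kappa>)

lemma continuous_\<kappa>_pair: "continuous_on (sphere 0 1 \<times> sphere 0 1) (\<lambda>(u, v). \<kappa> u v)"
proof -
  have "continuous_on (sphere 0 1 \<times> sphere 0 1) (\<lambda>p :: (real ^ 'n) \<times> (real ^ 'n). zonal_profile e g (fst p \<bullet> snd p))"
  proof (rule continuous_on_compose2[OF continuous_on_zonal_profile[OF dim e zonal second_order_continuous_on[OF smooth]]])
    show "continuous_on (sphere 0 1 \<times> sphere 0 1) (\<lambda>p :: (real ^ 'n) \<times> (real ^ 'n). fst p \<bullet> snd p)"
      by (intro continuous_intros)
    show "(\<lambda>p. fst p \<bullet> snd p) ` (sphere (0 :: real ^ 'n) 1 \<times> sphere 0 1) \<subseteq> {-1..1}"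
    proof
      fix t assume "t \<in> (\<lambda>p. fst p \<bullet> snd p) ` (sphere (0 :: real ^ 'n) 1 \<times> sphere 0 1)"
      then obtain a b :: "real ^ 'n" where "norm a = 1" "norm b = 1" "t = a \<bullet> b"
        by auto
      then show "t \<in> {-1..1}"
        using Cauchy_Schwarz_ineq2[of a b] by (simp add: abs_le_iff)
    qed
  qed
  then show ?thesis
    by (simp add: case_prod_unfold)
qed

lemma integral_\<kappa>:
  assumes "norm u = 1"
  shows "\<sigma> (\<kappa> u) = G"
proof -
  obtain Q where Q: "orthogonal_transformation Q" "Q u = e"
    by (rule to_pole[OF assms])
  have "\<sigma> (\<kappa> u) = \<sigma> (\<lambda>v. g (Q v))"
    by (rule integral_cong_sphere[OF sets_sphere_measure]) (simp add: zonal_profile_orthogonal[OF zonal Q])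
  also have "\<dots> = G"
    using orthogonal_invariant_sphere_measure Q second_order_continuous_on[OF smooth]
    unfolding orthogonal_invariant_def G_def by blast
  finally show ?thesis .
qed

text \<open>The kernel itself need not be a support function; the second component is the constant
  that makes it one. Body and constant are chosen together because they belong to each
  other.\<close>

definition \<kappa>_body :: "real ^ 'n \<Rightarrow> (real ^ 'n) set \<times> real" where
  "\<kappa>_body u = (SOME (K, c). convex_body K \<and> (\<forall>v. norm v = 1 \<longrightarrow> support_fun K v = \<kappa> u v + c))"

lemma \<kappa>_body:
  assumes "norm u = 1"
  shows "convex_body (fst (\<kappa>_body u))"
    and "norm v = 1 \<Longrightarrow> support_fun (fst (\<kappa>_body u)) v = \<kappa> u v + snd (\<kappa>_body u)"
proof -
  obtain K c where "convex_body K" "\<And>v. norm v = 1 \<Longrightarrow> support_fun K v = \<kappa> u v + c"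
    by (rule convex_body_of_second_order[OF second_order_\<kappa>[OF assms]]) blast
  then have "\<exists>p. case p of (K, c) \<Rightarrow> convex_body K \<and> (\<forall>v. norm v = 1 \<longrightarrow> support_fun K v = \<kappa> u v + c)"
    by (intro exI[of _ "(K, c)"]) simp
  from someI_ex[OF this] show "convex_body (fst (\<kappa>_body u))"
    and "norm v = 1 \<Longrightarrow> support_fun (fst (\<kappa>_body u)) v = \<kappa> u v + snd (\<kappa>_body u)"
    unfolding \<kappa>_body_def[symmetric] by (simp_all add: case_prod_unfold)
qed

text \<open>
  The continuous extension of \<open>h\<^sub>K \<mapsto> h\<^sub>\<Phi>\<^sub>K(u)\<close>. Writing the kernel as a support function minus a
  constant and using the symmetry of mixed volumes moves the kernel into the measure.
\<close>
definition \<Lambda> :: "real ^ 'n \<Rightarrow> (real ^ 'n \<Rightarrow> real) \<Rightarrow> real" where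
  "\<Lambda> u f = (LINT v|S\<^sub>1 (fst (\<kappa>_body u)). f v) - snd (\<kappa>_body u) * \<sigma> f"

text \<open>The constant depends on \<open>u\<close> and is crude, but it suffices for density
  arguments; once positivity is known, \<open>\<Lambda>_dist_le\<close> improves it to
  \<open>G\<close>.\<close>

lemma sphere_lipschitz_\<Lambda>:
  assumes "norm u = 1"
  obtains C where "sphere_lipschitz C (\<Lambda> u)"
  using sphere_lipschitz_diff[OF sphere_lipschitz_integral[OF finite_S\<^sub>1 sets_S\<^sub>1]
      sphere_lipschitz_cmult[OF sphere_lipschitz_integral[OF finite_sphere_measure sets_sphere_measure]]]
    \<kappa>_body(1)[OF assms] that unfolding \<Lambda>_def[abs_def] by blast

lemma integrable_\<sigma>: "continuous_on (sphere 0 1) f \<Longrightarrow> integrable sphere_measure (f :: real ^ 'n \<Rightarrow> real)"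
  by (intro integrable_continuous_on_sphere finite_sphere_measure sets_sphere_measure)

lemma \<Lambda>_add:
  assumes "norm u = 1" "continuous_on (sphere 0 1) f" "continuous_on (sphere 0 1) h"
  shows "\<Lambda> u (\<lambda>v. f v + h v) = \<Lambda> u f + \<Lambda> u h"
  using integrable_S\<^sub>1[OF \<kappa>_body(1)[OF assms(1)]] integrable_\<sigma> assms
  by (simp add: \<Lambda>_def distrib_left)

lemma \<Lambda>_cmult: "\<Lambda> u (\<lambda>v. a * f v) = a * \<Lambda> u f"
  by (simp add: \<Lambda>_def right_diff_distrib)

lemma \<Lambda>_diff:
  assumes "norm u = 1" "continuous_on (sphere 0 1) f" "continuous_on (sphere 0 1) h"
  shows "\<Lambda> u (\<lambda>v. f v - h v) = \<Lambda> u f - \<Lambda> u h"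
  using \<Lambda>_add[OF assms(1,2), of "\<lambda>v. -1 * h v"] \<Lambda>_cmult[of u "-1" h] assms(3)
  by (simp add: continuous_on_minus)

lemma \<Lambda>_cong:
  assumes "norm u = 1" "\<And>v. norm v = 1 \<Longrightarrow> f v = h v"
  shows "\<Lambda> u f = \<Lambda> u h"
proof -
  have "(LINT v|S\<^sub>1 (fst (\<kappa>_body u)). f v) = (LINT v|S\<^sub>1 (fst (\<kappa>_body u)). h v)" "\<sigma> f = \<sigma> h"
    by (rule integral_cong_sphere; intro sets_S\<^sub>1 \<kappa>_body(1) sets_sphere_measure assms; assumption)+
  then show ?thesis
    by (simp add: \<Lambda>_def)
qed

lemma continuous_support_fun: "convex_body K \<Longrightarrow> continuous_on A (support_fun K)"
  by (intro continuous_on_support_fun convex_bodyD)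

text \<open>Symmetry replaces the integral of \<open>support_fun K\<close> by that of the kernel
  plus its constant against \<open>S\<^sub>1 K\<close>. The constant contributes its multiple of the
  mass of \<open>S\<^sub>1 K\<close>, which is exactly the term subtracted in
  \<open>\<Lambda>\<close>.\<close>

lemma \<Lambda>_support_fun:
  assumes u: "norm u = 1" and K: "convex_body K"
  shows "\<Lambda> u (support_fun K) = support_fun (\<Phi> K) u"
proof -
  let ?L = "fst (\<kappa>_body u)" and ?c = "snd (\<kappa>_body u)"
  note L = \<kappa>_body[OF u]
  have "(LINT v|S\<^sub>1 ?L. support_fun K v) = (LINT v|S\<^sub>1 K. support_fun ?L v)"
    by (rule integral_S\<^sub>1_commute[OF L(1) K])
  also have "\<dots> = (LINT v|S\<^sub>1 K. \<kappa> u v + ?c)"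
    by (rule integral_cong_sphere[OF sets_S\<^sub>1[OF K] L(2)])
  also have "\<dots> = (LINT v|S\<^sub>1 K. \<kappa> u v) + (LINT v|S\<^sub>1 K. ?c)"
    by (intro Bochner_Integration.integral_add integrable_S\<^sub>1[OF K] continuous_\<kappa>[OF u] continuous_on_const)
  also have "(LINT v|S\<^sub>1 K. ?c) = ?c * \<sigma> (support_fun K)"
    by (simp only: integral_const_sphere[OF sets_S\<^sub>1[OF K]] measure_S\<^sub>1[OF K])
  finally show ?thesis
    using support_\<Phi>[OF K u] by (simp add: \<Lambda>_def)
qed

lemma \<Phi>_cball:
  assumes "norm u = 1" "r > 0"
  shows "support_fun (\<Phi> (cball 0 r)) u = r * G"
proof -
  have "support_fun (\<Phi> (cball 0 r)) u = \<Lambda> u (support_fun (cball 0 r))"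
    using \<Lambda>_support_fun assms convex_body_cball by metis
  also have "\<dots> = \<Lambda> u (\<lambda>v. r * support_fun (cball 0 1) v)"
    by (rule \<Lambda>_cong[OF assms(1)]) (use assms(2) in \<open>simp add: support_fun_cball\<close>)
  also have "\<dots> = r * support_fun (\<Phi> (cball 0 1)) u"
    using \<Lambda>_support_fun[OF assms(1), of "cball 0 1"] by (simp add: \<Lambda>_cmult convex_body_cball)
  also have "support_fun (\<Phi> (cball 0 1)) u = (LINT v|S\<^sub>1 (cball 0 1). \<kappa> u v)"
    using assms(1) by (intro support_\<Phi>) (simp_all add: convex_body_cball)
  also have "\<dots> = G"
    using integral_S\<^sub>1_cball[OF continuous_\<kappa>[OF assms(1)]] integral_\<kappa>[OF assms(1)] by simp
  finally show ?thesis .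
qed

lemma \<Lambda>_const:
  assumes "norm u = 1"
  shows "\<Lambda> u (\<lambda>v. c) = c * G"
proof -
  have "\<Lambda> u (\<lambda>v. c) = \<Lambda> u (\<lambda>v. c * support_fun (cball 0 1) v)"
    by (rule \<Lambda>_cong[OF assms]) (simp add: support_fun_cball)
  then show ?thesis
    using \<Lambda>_support_fun[OF assms, of "cball 0 1"] \<Phi>_cball[OF assms, of 1]
    by (simp add: \<Lambda>_cmult convex_body_cball)
qed

lemma \<Lambda>_support_fun_diff:
  assumes "norm u = 1" "convex_body K"
  shows "\<Lambda> u (\<lambda>v. support_fun K v - c) = support_fun (\<Phi> K) u - c * G"
  using \<Lambda>_diff[OF assms(1) continuous_support_fun[OF assms(2)] continuous_on_const, of c]
    \<Lambda>_support_fun[OF assms] \<Lambda>_const[OF assms(1)] by simp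

text \<open>The image of the unit ball has width \<open>2 * G\<close> in direction \<open>e\<close>
  and, having interior, contains a ball of radius \<open>d\<close>. Using both \<open>e\<close> and
  \<open>- e\<close> cancels the unknown centre.\<close>

lemma G_pos: "G > 0"
proof -
  have B: "convex_body (cball 0 1 :: (real ^ 'n) set)"
    by (simp add: convex_body_cball)
  have "interior (\<Phi> (cball 0 1)) \<noteq> {}"
    using convex_bodyD(4)[OF \<Phi>_body[OF B]] .
  then obtain x where "x \<in> interior (\<Phi> (cball 0 1))"
    by blast
  then obtain d where d: "d > 0" "cball x d \<subseteq> \<Phi> (cball 0 1)"
    by (auto simp: mem_interior_cball)
  have "x + d *\<^sub>R e \<in> \<Phi> (cball 0 1)" "x - d *\<^sub>R e \<in> \<Phi> (cball 0 1)"
    using d e by (auto intro!: subsetD[OF d(2)] simp: dist_norm)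
  then have "e \<bullet> (x + d *\<^sub>R e) \<le> support_fun (\<Phi> (cball 0 1)) e" "- e \<bullet> (x - d *\<^sub>R e) \<le> support_fun (\<Phi> (cball 0 1)) (- e)"
    using inner_le_support_fun[OF convex_bodyD(1)[OF \<Phi>_body[OF B]]] by blast+
  then have "e \<bullet> (x + d *\<^sub>R e) + - e \<bullet> (x - d *\<^sub>R e) \<le> 2 * G"
    using \<Phi>_cball[of e 1] \<Phi>_cball[of "- e" 1] e by simp
  moreover have "e \<bullet> (x + d *\<^sub>R e) + - e \<bullet> (x - d *\<^sub>R e) = 2 * d"
    using e by (simp add: inner_add_right inner_diff_right norm_eq_1)
  ultimately show ?thesis
    using d(1) by simp
qed

text \<open>The only use of monotonicity: a body with large support function contains a large ball.\<close>
lemma \<Lambda>_nonneg: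
  assumes u: "norm u = 1" and f: "continuous_on (sphere 0 1) f" "\<And>v. norm v = 1 \<Longrightarrow> f v \<ge> 0"
  shows "\<Lambda> u f \<ge> 0"
proof -
  obtain C where C: "sphere_lipschitz C (\<Lambda> u)"
    by (rule sphere_lipschitz_\<Lambda>[OF u])
  have bound: "- (\<epsilon> * (G + C)) \<le> \<Lambda> u f" if \<epsilon>: "\<epsilon> > 0" "\<epsilon> < 1" for \<epsilon>
  proof -
    obtain K c where K: "convex_body K" "c \<ge> 1" "\<And>v. norm v = 1 \<Longrightarrow> \<bar>f v - (support_fun K v - c)\<bar> \<le> \<epsilon>"
      by (rule support_fun_dense[OF f(1) \<epsilon>(1)]) blast
    \<comment> \<open>Since \<open>c \<ge> 1\<close> and \<open>\<epsilon> < 1\<close> the radius is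
      positive; the ball fits into \<open>K\<close> because \<open>f \<ge> 0\<close> makes the
      support function at least \<open>c - \<epsilon>\<close>.\<close>
    have ball: "convex_body (cball 0 (c - \<epsilon>) :: (real ^ 'n) set)"
      using K(2) \<epsilon> by (intro convex_body_cball) simp
    have "cball 0 (c - \<epsilon>) \<subseteq> K"
    proof (rule support_fun_le_imp_subset)
      fix v :: "real ^ 'n" assume v: "norm v = 1"
      have "c - \<epsilon> \<le> support_fun K v"
        using f(2)[OF v] K(3)[OF v] by linarith
      then show "support_fun (cball 0 (c - \<epsilon>)) v \<le> support_fun K v"
        using support_fun_cball[of "c - \<epsilon>" v] v K(2) \<epsilon> by simp
    qed (use convex_bodyD[OF K(1)] convex_bodyD[OF ball] in simp_all)
    then have "support_fun (\<Phi> (cball 0 (c - \<epsilon>))) u \<le> support_fun (\<Phi> K) u"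
      using \<Phi>_mono[OF ball K(1)] convex_bodyD[OF \<Phi>_body[OF ball]] convex_bodyD[OF \<Phi>_body[OF K(1)]]
      by (intro support_fun_mono) simp_all
    then have "(c - \<epsilon>) * G \<le> support_fun (\<Phi> K) u"
      using \<Phi>_cball[OF u, of "c - \<epsilon>"] K(2) \<epsilon> by simp
    moreover have "\<bar>\<Lambda> u f - \<Lambda> u (\<lambda>v. support_fun K v - c)\<bar> \<le> C * \<epsilon>"
      using K by (intro sphere_lipschitzD[OF C] f(1) continuous_intros continuous_support_fun)
    ultimately show ?thesis
      unfolding \<Lambda>_support_fun_diff[OF u K(1)] by (simp add: algebra_simps abs_le_iff)
  qed
  have "((\<lambda>\<epsilon>. - (\<epsilon> * (G + C))) \<longlongrightarrow> - (0 * (G + C))) (at_right 0)"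
    by (intro tendsto_intros)
  moreover have "\<forall>\<^sub>F \<epsilon> in at_right 0. - (\<epsilon> * (G + C)) \<le> \<Lambda> u f"
    unfolding eventually_at_right_field using bound by (intro exI[of _ 1]) auto
  ultimately show ?thesis
    using tendsto_upperbound[of "\<lambda>\<epsilon>. - (\<epsilon> * (G + C))" _ "at_right 0" "\<Lambda> u f"] by simp
qed

lemma \<Lambda>_mono:
  assumes "norm u = 1" "continuous_on (sphere 0 1) f" "continuous_on (sphere 0 1) h"
    "\<And>v. norm v = 1 \<Longrightarrow> f v \<le> h v"
  shows "\<Lambda> u f \<le> \<Lambda> u h"
  using \<Lambda>_nonneg[OF assms(1), of "\<lambda>v. h v - f v"] \<Lambda>_diff[OF assms(1,3,2)] assms(2-4)
  by (simp add: continuous_on_diff)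

text \<open>Positivity together with the value on constants gives the bound \<open>G\<close>
  uniformly in \<open>u\<close>, which the continuity in \<open>u\<close> and the passage to limits
  rely on.\<close>

lemma \<Lambda>_dist_le:
  assumes "norm u = 1" "continuous_on (sphere 0 1) f" "continuous_on (sphere 0 1) h"
    "\<And>v. norm v = 1 \<Longrightarrow> \<bar>f v - h v\<bar> \<le> \<epsilon>"
  shows "\<bar>\<Lambda> u f - \<Lambda> u h\<bar> \<le> G * \<epsilon>"
proof -
  have "\<Lambda> u f \<le> \<Lambda> u h + G * \<epsilon>" if "continuous_on (sphere 0 1) f" "continuous_on (sphere 0 1) h"
    "\<And>v. norm v = 1 \<Longrightarrow> \<bar>f v - h v\<bar> \<le> \<epsilon>" for f h
  proof -
    have "\<Lambda> u f \<le> \<Lambda> u (\<lambda>v. h v + \<epsilon>)"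
    proof (rule \<Lambda>_mono[OF assms(1) that(1)])
      show "f v \<le> h v + \<epsilon>" if "norm v = 1" for v
        using \<open>\<And>v. norm v = 1 \<Longrightarrow> \<bar>f v - h v\<bar> \<le> \<epsilon>\<close>[OF that] by linarith
    qed (intro continuous_intros that)
    then show ?thesis
      using \<Lambda>_add[OF assms(1) that(2) continuous_on_const, of \<epsilon>] \<Lambda>_const[OF assms(1), of \<epsilon>]
      by (simp add: mult.commute)
  qed
  from this[of f h] this[of h f] show ?thesis
    using assms by (simp add: abs_le_iff abs_minus_commute)
qed

text \<open>On a function \<open>support_fun K v - c\<close> the result is a support function minus
  a constant, hence continuous in \<open>u\<close>; the approximation is uniform by
  \<open>\<Lambda>_dist_le\<close>.\<close>

lemma \<Lambda>_continuous:
  assumes f: "continuous_on (sphere 0 1) f"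
  shows "continuous_on (sphere 0 1) (\<lambda>u. \<Lambda> u f)"
proof (rule continuous_on_uniform_approx)
  fix \<epsilon> :: real assume "\<epsilon> > 0"
  then have "\<epsilon> / G > 0"
    using G_pos by simp
  then obtain K c where K: "convex_body K" "\<And>v. norm v = 1 \<Longrightarrow> \<bar>f v - (support_fun K v - c)\<bar> \<le> \<epsilon> / G"
    by (rule support_fun_dense[OF f]) blast
  have "\<bar>\<Lambda> u f - (support_fun (\<Phi> K) u - c * G)\<bar> \<le> \<epsilon>" if "norm u = 1" for u
    using \<Lambda>_dist_le[OF that f, of "\<lambda>v. support_fun K v - c" "\<epsilon> / G"] K G_pos
      \<Lambda>_support_fun_diff[OF that K(1), of c] by (simp add: continuous_on_diff continuous_support_fun)
  then show "\<exists>h. continuous_on (sphere 0 1) h \<and> (\<forall>u\<in>sphere 0 1. \<bar>\<Lambda> u f - h u\<bar> \<le> \<epsilon>)"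
    using \<Phi>_body[OF K(1)]
    by (intro exI[of _ "\<lambda>u. support_fun (\<Phi> K) u - c * G"]) (simp add: continuous_on_diff continuous_support_fun)
qed

text \<open>The source is the orthogonal invariance of \<open>S\<^sub>1\<close> and of the inner
  product in the kernel, so that reflections are covered along with rotations.\<close>

lemma \<Lambda>_orthogonal:
  fixes Q :: "real ^ 'n \<Rightarrow> real ^ 'n"
  assumes Q: "orthogonal_transformation Q" and u: "norm u = 1" and f: "continuous_on (sphere 0 1) f"
  shows "\<Lambda> u (\<lambda>v. f (Q v)) = \<Lambda> (Q u) f"
proof -
  have Qu: "norm (Q u) = 1"
    using orthogonal_transformation_sphere(1)[OF Q] u by simp
  obtain C D where C: "sphere_lipschitz C (\<Lambda> u)" and D: "sphere_lipschitz D (\<Lambda> (Q u))"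
    using sphere_lipschitz_\<Lambda>[OF u] sphere_lipschitz_\<Lambda>[OF Qu] by metis
  show ?thesis
  proof (rule sphere_lipschitz_eqI[OF sphere_lipschitz_orthogonal[OF C Q] D f])
    fix K :: "(real ^ 'n) set" and c :: real assume K: "convex_body K"
    obtain R where R: "orthogonal_transformation R" "\<And>x. Q (R x) = x" "\<And>x. R (Q x) = x"
      by (rule orthogonal_transformation_inverse[OF Q]) blast
    have RK: "convex_body (R ` K)"
      by (rule convex_body_orthogonal_image[OF R(1) K])
    have "support_fun K (Q v) = support_fun (R ` K) v" for v
      using support_fun_orthogonal_image[OF R(1) convex_bodyD(1,3)[OF K], of "Q v"] R(3) by simp
    then have "\<Lambda> u (\<lambda>v. support_fun K (Q v) - c) = support_fun (\<Phi> (R ` K)) u - c * G"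
      using \<Lambda>_support_fun_diff[OF u RK] by simp
    also have "support_fun (\<Phi> (R ` K)) u = (LINT v|S\<^sub>1 (R ` K). \<kappa> u v)"
      by (rule support_\<Phi>[OF RK u])
    also have "\<dots> = (LINT v|S\<^sub>1 K. \<kappa> u (R v))"
      by (rule integral_S\<^sub>1_orthogonal[OF R(1) K continuous_\<kappa>[OF u]])
    also have "(\<lambda>v. \<kappa> u (R v)) = \<kappa> (Q u)"
    proof
      fix v
      have "u \<bullet> R v = Q u \<bullet> v"
        using Q R(2)[of v] unfolding orthogonal_transformation_def by metis
      then show "\<kappa> u (R v) = \<kappa> (Q u) v"
        by simp
    qed
    also have "(LINT v|S\<^sub>1 K. \<kappa> (Q u) v) = support_fun (\<Phi> K) (Q u)"
      by (rule support_\<Phi>[OF K Qu, symmetric])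
    also have "\<dots> - c * G = \<Lambda> (Q u) (\<lambda>v. support_fun K v - c)"
      by (rule \<Lambda>_support_fun_diff[OF Qu K, symmetric])
    finally show "\<Lambda> u (\<lambda>v. support_fun K (Q v) - c) = \<Lambda> (Q u) (\<lambda>v. support_fun K v - c)" .
  qed
qed

text \<open>The kernel is symmetric in its two arguments, so after Fubini the inner integral is
  \<open>G\<close> again.\<close>

lemma \<Lambda>_mean_support_fun:
  assumes K: "convex_body K"
  shows "\<sigma> (support_fun (\<Phi> K)) = G * \<sigma> (support_fun K)"
proof -
  have "\<sigma> (support_fun (\<Phi> K)) = \<sigma> (\<lambda>u. LINT v|S\<^sub>1 K. \<kappa> u v)"
    by (rule integral_cong_sphere[OF sets_sphere_measure]) (rule support_\<Phi>[OF K])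
  also have "\<dots> = (LINT v|S\<^sub>1 K. \<sigma> (\<lambda>u. \<kappa> u v))"
    by (rule sphere_Fubini(1)[OF finite_sphere_measure sets_sphere_measure finite_S\<^sub>1[OF K] sets_S\<^sub>1[OF K]
          continuous_\<kappa>_pair, symmetric])
  also have "\<dots> = (LINT v|S\<^sub>1 K. G)"
    by (rule integral_cong_sphere[OF sets_S\<^sub>1[OF K]]) (subst inner_commute, rule integral_\<kappa>)
  also have "\<dots> = G * \<sigma> (support_fun K)"
    by (simp only: integral_const_sphere[OF sets_S\<^sub>1[OF K]] measure_S\<^sub>1[OF K])
  finally show ?thesis .
qed

lemma \<Lambda>_mean:
  assumes f: "continuous_on (sphere 0 1) f"
  shows "\<sigma> (\<lambda>u. \<Lambda> u f) = G * \<sigma> f"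
proof -
  let ?m = "measure (sphere_measure :: (real ^ 'n) measure) (sphere 0 1)"
  have "sphere_lipschitz (?m * G) (\<lambda>f. \<sigma> (\<lambda>u. \<Lambda> u f))"
    unfolding sphere_lipschitz_def
  proof (intro allI impI)
    fix f h :: "real ^ 'n \<Rightarrow> real" and \<epsilon> :: real
    assume "continuous_on (sphere 0 1) f" "continuous_on (sphere 0 1) h" "\<forall>v. norm v = 1 \<longrightarrow> \<bar>f v - h v\<bar> \<le> \<epsilon>"
    then have "\<bar>\<sigma> (\<lambda>u. \<Lambda> u f) - \<sigma> (\<lambda>u. \<Lambda> u h)\<bar> \<le> ?m * (G * \<epsilon>)"
      by (intro integral_dist_le_sphere[OF finite_sphere_measure sets_sphere_measure] \<Lambda>_continuous \<Lambda>_dist_le) auto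
    then show "\<bar>\<sigma> (\<lambda>u. \<Lambda> u f) - \<sigma> (\<lambda>u. \<Lambda> u h)\<bar> \<le> ?m * G * \<epsilon>"
      by (simp only: mult.assoc)
  qed
  then show ?thesis
  proof (rule sphere_lipschitz_eqI[OF _ sphere_lipschitz_cmult[OF sphere_lipschitz_integral[OF
          finite_sphere_measure sets_sphere_measure]] f])
    fix K :: "(real ^ 'n) set" and c :: real assume K: "convex_body K"
    have "\<sigma> (\<lambda>u. \<Lambda> u (\<lambda>v. support_fun K v - c)) = \<sigma> (\<lambda>u. support_fun (\<Phi> K) u - c * G)"
      by (rule integral_cong_sphere[OF sets_sphere_measure]) (rule \<Lambda>_support_fun_diff[OF _ K])
    also have "\<dots> = \<sigma> (support_fun (\<Phi> K)) - \<sigma> (\<lambda>_. c * G)"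
      by (intro Bochner_Integration.integral_diff integrable_\<sigma> continuous_support_fun \<Phi>_body[OF K] continuous_on_const)
    also have "\<dots> = G * (\<sigma> (support_fun K) - \<sigma> (\<lambda>_. c))"
      by (simp add: \<Lambda>_mean_support_fun[OF K] algebra_simps)
    also have "\<sigma> (support_fun K) - \<sigma> (\<lambda>_. c) = \<sigma> (\<lambda>v. support_fun K v - c)"
      by (intro Bochner_Integration.integral_diff[symmetric] integrable_\<sigma> continuous_support_fun[OF K] continuous_on_const)
    finally show "\<sigma> (\<lambda>u. \<Lambda> u (\<lambda>v. support_fun K v - c)) = G * \<sigma> (\<lambda>v. support_fun K v - c)" .
  qed
qed

end

section \<open>Rotations in a plane\<close>

text \<open>Rotation in the plane of the orthonormal pair \<open>x\<close>, \<open>y\<close> through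
  the angle with cosine \<open>c\<close> and sine \<open>s\<close>. It is written as
  \<open>v\<close> plus a displacement because the displacement is what gets estimated.\<close>

definition plane_rotation :: "'a :: real_inner \<Rightarrow> 'a \<Rightarrow> real \<Rightarrow> real \<Rightarrow> 'a \<Rightarrow> 'a" where
  "plane_rotation x y c s v =
     v + ((c - 1) * (x \<bullet> v) - s * (y \<bullet> v)) *\<^sub>R x + ((c - 1) * (y \<bullet> v) + s * (x \<bullet> v)) *\<^sub>R y"

lemma plane_rotation:
  assumes xy: "norm x = 1" "norm y = 1" "x \<bullet> y = 0" and cs: "c\<^sup>2 + s\<^sup>2 = 1"
  shows "orthogonal_transformation (plane_rotation x y c s)"
    and "x \<bullet> plane_rotation x y c s v = c * (x \<bullet> v) - s * (y \<bullet> v)"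
    and "(norm (plane_rotation x y c s v - v))\<^sup>2 = (2 - 2 * c) * ((x \<bullet> v)\<^sup>2 + (y \<bullet> v)\<^sup>2)"
    and "(x \<bullet> v)\<^sup>2 + (y \<bullet> v)\<^sup>2 \<le> (norm v)\<^sup>2"
proof -
  have xx: "x \<bullet> x = 1" "y \<bullet> y = 1" "y \<bullet> x = 0"
    using xy by (simp_all add: norm_eq_1 inner_commute)
  have lin: "linear (plane_rotation x y c s)"
    by (rule linearI) (simp_all add: plane_rotation_def inner_add_right algebra_simps)
  have inner: "(\<alpha> *\<^sub>R x + \<beta> *\<^sub>R y) \<bullet> (\<alpha> *\<^sub>R x + \<beta> *\<^sub>R y) = \<alpha>\<^sup>2 + \<beta>\<^sup>2" for \<alpha> \<beta>
    using xx xy(3) by (simp add: inner_add_left inner_add_right power2_eq_square)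
  have sq: "((c - 1) * a - s * b)\<^sup>2 + ((c - 1) * b + s * a)\<^sup>2 = (2 - 2 * c) * (a\<^sup>2 + b\<^sup>2)" for a b
  proof -
    have "((c - 1) * a - s * b)\<^sup>2 + ((c - 1) * b + s * a)\<^sup>2 = ((c\<^sup>2 + s\<^sup>2) + 1 - 2 * c) * (a\<^sup>2 + b\<^sup>2)"
      by (simp add: power2_eq_square algebra_simps)
    then show ?thesis
      by (simp add: cs)
  qed
  have diff: "plane_rotation x y c s v - v
      = ((c - 1) * (x \<bullet> v) - s * (y \<bullet> v)) *\<^sub>R x + ((c - 1) * (y \<bullet> v) + s * (x \<bullet> v)) *\<^sub>R y" for v
    by (simp add: plane_rotation_def)
  have norm_diff: "(norm (plane_rotation x y c s v - v))\<^sup>2 = (2 - 2 * c) * ((x \<bullet> v)\<^sup>2 + (y \<bullet> v)\<^sup>2)" for v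
    unfolding diff power2_norm_eq_inner inner by (rule sq)
  show "(norm (plane_rotation x y c s v - v))\<^sup>2 = (2 - 2 * c) * ((x \<bullet> v)\<^sup>2 + (y \<bullet> v)\<^sup>2)"
    by (rule norm_diff)
  have "norm (plane_rotation x y c s v) = norm v" for v
  proof -
    define w where "w = plane_rotation x y c s v - v"
    have "v \<bullet> w = ((c - 1) * (x \<bullet> v) - s * (y \<bullet> v)) * (x \<bullet> v) + ((c - 1) * (y \<bullet> v) + s * (x \<bullet> v)) * (y \<bullet> v)"
      by (simp add: w_def diff inner_add_right inner_commute)
    also have "\<dots> = (c - 1) * ((x \<bullet> v)\<^sup>2 + (y \<bullet> v)\<^sup>2)"
      by (simp add: power2_eq_square algebra_simps)
    finally have "2 * (v \<bullet> w) + w \<bullet> w = 0"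
      using norm_diff[of v] by (simp add: w_def[symmetric] power2_norm_eq_inner algebra_simps)
    then have "(v + w) \<bullet> (v + w) = v \<bullet> v"
      by (simp add: inner_add_left inner_add_right inner_commute)
    then show ?thesis
      by (simp add: w_def norm_eq_sqrt_inner)
  qed
  then show "orthogonal_transformation (plane_rotation x y c s)"
    using lin by (simp add: orthogonal_transformation)
  show "x \<bullet> plane_rotation x y c s v = c * (x \<bullet> v) - s * (y \<bullet> v)"
    using xx xy(3) by (simp add: plane_rotation_def inner_add_right algebra_simps)
  have "0 \<le> (v - ((x \<bullet> v) *\<^sub>R x + (y \<bullet> v) *\<^sub>R y)) \<bullet> (v - ((x \<bullet> v) *\<^sub>R x + (y \<bullet> v) *\<^sub>R y))"
    by (rule inner_ge_zero)
  also have "\<dots> = v \<bullet> v - ((x \<bullet> v)\<^sup>2 + (y \<bullet> v)\<^sup>2)"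
    unfolding inner_diff_left inner_diff_right inner
    by (simp add: inner_add_left inner_add_right inner_commute[of v x] inner_commute[of v y] power2_eq_square)
  finally show "(x \<bullet> v)\<^sup>2 + (y \<bullet> v)\<^sup>2 \<le> (norm v)\<^sup>2"
    by (simp add: power2_norm_eq_inner)
qed

lemma orthogonal_transformation_reflection:
  fixes w :: "real ^ 'n"
  assumes "w \<noteq> 0"
  shows "orthogonal_transformation (\<lambda>v. v - (2 * (w \<bullet> v) / (w \<bullet> w)) *\<^sub>R w)"
proof -
  define k where "k = w \<bullet> w"
  have k: "k \<noteq> 0"
    using assms by (simp add: k_def)
  have "linear (\<lambda>v. v - (2 * (w \<bullet> v) / k) *\<^sub>R w)"
    by (rule linearI)
      (simp_all add: inner_add_right distrib_left add_divide_distrib scaleR_add_left scaleR_diff_right)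
  moreover have "(v - (2 * (w \<bullet> v) / k) *\<^sub>R w) \<bullet> (u - (2 * (w \<bullet> u) / k) *\<^sub>R w) = v \<bullet> u" for v u
  proof -
    have "(v - (2 * (w \<bullet> v) / k) *\<^sub>R w) \<bullet> (u - (2 * (w \<bullet> u) / k) *\<^sub>R w)
        = v \<bullet> u - (2 * (w \<bullet> u) / k) * (w \<bullet> v) - (2 * (w \<bullet> v) / k) * ((w \<bullet> u) - (2 * (w \<bullet> u) / k) * k)"
      by (simp add: inner_diff_left inner_diff_right k_def inner_commute[of v w])
    also have "\<dots> = v \<bullet> u"
      using k by simp
    finally show ?thesis .
  qed
  ultimately show ?thesis
    unfolding orthogonal_transformation_def k_def by blast
qed

text \<open>After moving \<open>a\<close> to \<open>p\<close>, reflect in the hyperplane orthogonal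
  to \<open>P b - q\<close>. The reflection fixes \<open>p\<close> because \<open>P b\<close> and
  \<open>q\<close> have the same inner product with it.\<close>

lemma orthogonal_transformation_pair:
  fixes a b p q :: "real ^ 'n"
  assumes unit: "norm a = 1" "norm b = 1" "norm p = 1" "norm q = 1" and inner: "a \<bullet> b = p \<bullet> q"
  obtains Q where "orthogonal_transformation Q" "Q a = p" "Q b = q"
proof -
  obtain P where P: "orthogonal_transformation P" "P a = p"
    using orthogonal_transformation_exists_1[OF unit(1,3)] by blast
  show ?thesis
  proof (cases "P b = q")
    case True
    then show ?thesis
      using that P by blast
  next
    case False
    define w where "w = P b - q"
    define H where "H v = v - (2 * (w \<bullet> v) / (w \<bullet> w)) *\<^sub>R w" for v
    have "w \<noteq> 0"
      using False by (simp add: w_def)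
    then have "orthogonal_transformation H"
      unfolding H_def[abs_def] by (rule orthogonal_transformation_reflection)
    have Pb: "P b \<bullet> P b = 1" "q \<bullet> q = 1"
      using orthogonal_transformation_sphere(1)[OF P(1), of b] unit by (simp_all add: norm_eq_1)
    have "p \<bullet> P b = a \<bullet> b"
      using P unfolding orthogonal_transformation_def by metis
    then have "w \<bullet> p = 0"
      using inner by (simp add: w_def inner_diff_left inner_commute[of "P b" p] inner_commute[of q p])
    then have "H p = p"
      by (simp add: H_def)
    have "2 * (w \<bullet> P b) = w \<bullet> w"
      using Pb by (simp add: w_def inner_diff_left inner_diff_right inner_commute)
    then have "H (P b) = q"
      using \<open>w \<noteq> 0\<close> by (simp add: H_def w_def)
    have "orthogonal_transformation (H \<circ> P)"
      using \<open>orthogonal_transformation H\<close> P(1) by (simp add: orthogonal_transformation_compose)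
    then show ?thesis
      using that[of "H \<circ> P"] P(2) \<open>H p = p\<close> \<open>H (P b) = q\<close> by simp
  qed
qed

lemma unit_vector_decomp:
  fixes p q :: "real ^ 'n"
  assumes "CARD('n) \<ge> 2" "norm p = 1" "norm q = 1"
  obtains r \<phi> where "norm r = 1" "p \<bullet> r = 0" "0 \<le> \<phi>" "q = cos \<phi> *\<^sub>R p + sin \<phi> *\<^sub>R r"
proof -
  define t where "t = p \<bullet> q"
  define w where "w = q - t *\<^sub>R p"
  have t: "\<bar>t\<bar> \<le> 1"
    using Cauchy_Schwarz_ineq2[of p q] assms by (simp add: t_def)
  have pw: "p \<bullet> w = 0"
    using assms(2) by (simp add: w_def t_def inner_diff_right norm_eq_1)
  have "w \<bullet> w = 1 - t\<^sup>2"
    using assms(2,3) by (simp add: w_def inner_diff t_def inner_commute[of q p] norm_eq_1 power2_eq_square)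
  then have norm_w: "norm w = sqrt (1 - t\<^sup>2)"
    by (simp add: norm_eq_sqrt_inner)
  have "cos (arccos t) = t" "sin (arccos t) = sqrt (1 - t\<^sup>2)" "0 \<le> arccos t"
    using t by (auto simp: sin_arccos_abs arccos_lbound abs_le_iff)
  show ?thesis
  proof (cases "w = 0")
    case True
    obtain r where r: "norm r = 1" "p \<bullet> r = 0"
      by (rule orthogonal_unit_vector_exists[OF assms(1,2)])
    then show ?thesis
      using that[of r "arccos t"] True norm_w \<open>cos (arccos t) = t\<close> \<open>sin (arccos t) = sqrt (1 - t\<^sup>2)\<close> \<open>0 \<le> arccos t\<close>
      by (simp add: w_def)
  next
    case False
    have "sin (arccos t) = norm w"
      using norm_w \<open>sin (arccos t) = sqrt (1 - t\<^sup>2)\<close> by simp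
    then have "sin (arccos t) *\<^sub>R (w /\<^sub>R norm w) = w"
      using False by simp
    moreover have "q = t *\<^sub>R p + w"
      by (simp add: w_def)
    ultimately have "q = cos (arccos t) *\<^sub>R p + sin (arccos t) *\<^sub>R (w /\<^sub>R norm w)"
      by (simp only: \<open>cos (arccos t) = t\<close>)
    moreover have "norm (w /\<^sub>R norm w) = 1" "p \<bullet> (w /\<^sub>R norm w) = 0"
      using False pw by simp_all
    ultimately show ?thesis
      using that \<open>0 \<le> arccos t\<close> by blast
  qed
qed

text \<open>
  Invariance under arbitrarily small steps forces a continuous function to be constant: walk from \<open>p\<close>
  along the great circle through \<open>q\<close> in steps of a small angle.
\<close>
lemma constant_of_small_steps:
  fixes f :: "real ^ 'n \<Rightarrow> real"
  assumes dim: "CARD('n) \<ge> 2" and f: "continuous_on (sphere 0 1) f"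
    and step: "\<And>\<delta>. \<delta> > 0 \<Longrightarrow> \<exists>t. 1 - \<delta> < t \<and> t < 1 \<and> (\<forall>p q. norm p = 1 \<longrightarrow> norm q = 1 \<longrightarrow> p \<bullet> q = t \<longrightarrow> f p = f q)"
    and pq: "norm p = 1" "norm q = 1"
  shows "f p = f q"
proof -
  obtain r \<phi> where r: "norm r = 1" "p \<bullet> r = 0" and \<phi>: "0 \<le> \<phi>" "q = cos \<phi> *\<^sub>R p + sin \<phi> *\<^sub>R r"
    by (rule unit_vector_decomp[OF dim pq])
  \<comment> \<open>Unit-speed parametrisation of the great circle through \<open>p\<close> and
    \<open>q\<close>, starting at \<open>p\<close>.\<close>
  define c where "c \<alpha> = cos \<alpha> *\<^sub>R p + sin \<alpha> *\<^sub>R r" for \<alpha>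
  have c_inner: "c \<alpha> \<bullet> c \<beta> = cos (\<alpha> - \<beta>)" for \<alpha> \<beta>
    using pq(1) r by (simp add: c_def inner_add inner_commute[of r p] norm_eq_1 cos_diff)
  then have c_norm: "norm (c \<alpha>) = 1" for \<alpha>
    by (simp add: norm_eq_1)
  have "dist (f p) (f q) \<le> 0 + \<epsilon>" if "\<epsilon> > 0" for \<epsilon>
  proof -
    have "continuous_on (sphere 0 1) f \<and> q \<in> sphere 0 1"
      using f pq by simp
    then obtain d where d: "d > 0" "\<And>x. x \<in> sphere 0 1 \<Longrightarrow> dist x q < d \<Longrightarrow> dist (f x) (f q) < \<epsilon>"
      using \<open>\<epsilon> > 0\<close> unfolding continuous_on_iff by blast
    \<comment> \<open>\<open>d / 3\<close> leaves room for the last step to stay within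
      \<open>d\<close> of \<open>q\<close>; the bound 1 keeps the angle below pi, where the cosine
      is monotone.\<close>
    define \<eta> where "\<eta> = min (d / 3) 1"
    have \<eta>: "0 < \<eta>" "\<eta> \<le> d / 3" "\<eta> < pi"
      using d(1) pi_gt3 by (auto simp: \<eta>_def)
    have "cos \<eta> < 1"
      using cos_monotone_0_pi[of 0 \<eta>] \<eta> by simp
    then obtain t where t: "cos \<eta> < t" "t < 1" "\<And>p q. norm p = 1 \<Longrightarrow> norm q = 1 \<Longrightarrow> p \<bullet> q = t \<Longrightarrow> f p = f q"
      using step[of "1 - cos \<eta>"] by auto
    define \<theta> where "\<theta> = arccos t"
    have "-1 \<le> t"
      using t(1) cos_ge_minus_one[of \<eta>] by linarith
    then have \<theta>: "cos \<theta> = t" "0 \<le> \<theta>" "\<theta> \<le> pi"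
      using t(2) by (simp_all add: \<theta>_def arccos_lbound arccos_ubound)
    have "\<theta> \<noteq> 0"
      using \<theta>(1) t(2) by auto
    have "\<theta> < \<eta>"
      using cos_monotone_0_pi_le[of \<eta> \<theta>] \<eta>(1) \<theta> t(1) by (meson less_imp_le linorder_not_less)
    have "c \<phi> = q"
      using \<phi>(2) by (simp add: c_def)
    have "f (c (real k * \<theta>)) = f p" for k
    proof (induction k)
      case 0
      then show ?case
        by (simp add: c_def)
    next
      case (Suc k)
      have "c (real (Suc k) * \<theta>) \<bullet> c (real k * \<theta>) = t"
        using \<theta>(1) by (simp add: c_inner algebra_simps)
      then show ?case
        using t(3)[OF c_norm c_norm] Suc by metis
    qed
    \<comment> \<open>The largest number of steps that does not pass \<open>q\<close>; the remaining
      angle is less than one step.\<close>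
    moreover define k where "k = nat \<lfloor>\<phi> / \<theta>\<rfloor>"
    have "real k = of_int \<lfloor>\<phi> / \<theta>\<rfloor>"
      using \<phi>(1) \<theta>(2) by (simp add: k_def)
    then have "real k \<le> \<phi> / \<theta>" "\<phi> / \<theta> < real k + 1"
      by linarith+
    then have "real k * \<theta> \<le> \<phi>" "\<phi> < real k * \<theta> + \<theta>"
      using \<theta>(2) \<open>\<theta> \<noteq> 0\<close> by (simp_all add: field_simps)
    then have "\<bar>real k * \<theta> - \<phi>\<bar> \<le> \<theta>"
      by simp
    moreover have "dist (c \<alpha>) (c \<beta>) \<le> \<bar>\<alpha> - \<beta>\<bar>" for \<alpha> \<beta>
    proof (rule power2_le_imp_le)
      define x where "x = (\<alpha> - \<beta>) / 2"
      then have "2 * x = \<alpha> - \<beta>"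
        by simp
      have "(dist (c \<alpha>) (c \<beta>))\<^sup>2 = 2 - 2 * cos (\<alpha> - \<beta>)"
        using inner_unit_eq[OF c_norm c_norm, of \<alpha> \<beta>] by (simp add: dist_norm c_inner)
      also have "\<dots> = 4 * (sin x)\<^sup>2"
        using cos_double_sin[of x] \<open>2 * x = \<alpha> - \<beta>\<close> by simp
      also have "\<dots> \<le> 4 * x\<^sup>2"
        using abs_sin_x_le_abs_x[of x] by (simp add: abs_le_square_iff[symmetric])
      also have "\<dots> = \<bar>\<alpha> - \<beta>\<bar>\<^sup>2"
        by (simp add: x_def power_divide)
      finally show "(dist (c \<alpha>) (c \<beta>))\<^sup>2 \<le> \<bar>\<alpha> - \<beta>\<bar>\<^sup>2" .
    qed simp
    then have "dist (c (real k * \<theta>)) (c \<phi>) \<le> \<bar>real k * \<theta> - \<phi>\<bar>" .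
    ultimately have "dist (c (real k * \<theta>)) q < d"
      using \<open>\<theta> < \<eta>\<close> \<eta> \<open>c \<phi> = q\<close> d(1) by simp
    then have "dist (f (c (real k * \<theta>))) (f q) < \<epsilon>"
      using d(2)[of "c (real k * \<theta>)"] c_norm by simp
    then show ?thesis
      using \<open>\<And>k. f (c (real k * \<theta>)) = f p\<close> by simp
  qed
  then have "dist (f p) (f q) \<le> 0"
    by (rule field_le_epsilon)
  then show ?thesis
    by simp
qed

text \<open>With \<open>a\<close> and \<open>b\<close> the inner products of \<open>v\<close> with
  \<open>x\<close> and \<open>y\<close>, the right side is the second difference of the absolute
  value of \<open>x \<bullet> v\<close> under rotation by opposite angles. Near the kink
  \<open>a = 0\<close> it is of first order in \<open>s\<close>; elsewhere it loses at most second
  order, since \<open>1 - c \<le> s\<^sup>2\<close>.\<close>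

lemma abs_rotation_ge:
  fixes a b c s :: real
  assumes cs: "c\<^sup>2 + s\<^sup>2 = 1" "0 \<le> c" "0 \<le> s" and a: "\<bar>a\<bar> \<le> 1"
  shows "2 * max (\<bar>b\<bar> * s - \<bar>a\<bar>) 0 - 2 * s\<^sup>2 \<le> \<bar>c * a - s * b\<bar> + \<bar>c * a + s * b\<bar> - 2 * \<bar>a\<bar>"
proof -
  have "c \<le> 1"
  proof (rule power2_le_imp_le)
    show "c\<^sup>2 \<le> 1\<^sup>2"
      using cs(1) zero_le_power2[of s] unfolding power_one by linarith
  qed simp
  then have "c\<^sup>2 \<le> c"
    using cs(2) by (simp add: power2_eq_square mult_left_le)
  then have "1 - c \<le> s\<^sup>2"
    using cs(1) by linarith
  then have "(1 - c) * \<bar>a\<bar> \<le> s\<^sup>2 * 1"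
    using a \<open>c \<le> 1\<close> by (intro mult_mono) auto
  then have "\<bar>a\<bar> - c * \<bar>a\<bar> \<le> s\<^sup>2"
    by (simp add: left_diff_distrib)
  moreover have "2 * (c * \<bar>a\<bar>) \<le> \<bar>c * a - s * b\<bar> + \<bar>c * a + s * b\<bar>"
  proof -
    have "\<bar>2 * (c * a)\<bar> \<le> \<bar>c * a - s * b\<bar> + \<bar>c * a + s * b\<bar>"
      using abs_triangle_ineq[of "c * a - s * b" "c * a + s * b"] by simp
    then show ?thesis
      using cs(2) by (simp add: abs_mult)
  qed
  moreover have "2 * (\<bar>b\<bar> * s) \<le> \<bar>c * a - s * b\<bar> + \<bar>c * a + s * b\<bar>"
  proof -
    have "\<bar>2 * (s * b)\<bar> \<le> \<bar>c * a - s * b\<bar> + \<bar>c * a + s * b\<bar>"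
      using abs_triangle_ineq4[of "c * a + s * b" "c * a - s * b"] by simp
    then show ?thesis
      using cs(3) by (simp add: abs_mult mult.commute)
  qed
  moreover have "0 \<le> s\<^sup>2"
    by simp
  ultimately have "2 * (\<bar>b\<bar> * s - \<bar>a\<bar>) - 2 * s\<^sup>2 \<le> \<bar>c * a - s * b\<bar> + \<bar>c * a + s * b\<bar> - 2 * \<bar>a\<bar> \<and>
    2 * 0 - 2 * s\<^sup>2 \<le> \<bar>c * a - s * b\<bar> + \<bar>c * a + s * b\<bar> - 2 * \<bar>a\<bar>"
    by argo
  then show ?thesis
    by (cases "\<bar>b\<bar> * s - \<bar>a\<bar> \<le> 0") (simp_all only: max_absorb1 max_absorb2 linorder_not_le less_imp_le)
qed

text \<open>The body is the segment from \<open>- x\<close> to \<open>x\<close> thickened by a ball;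
  a subgradient serves as tangent, with no quadratic error.\<close>

lemma abs_inner_body:
  fixes x :: "real ^ 'n"
  obtains K c where "convex_body K" "\<And>v. norm v = 1 \<Longrightarrow> support_fun K v = \<bar>x \<bullet> v\<bar> + c"
proof -
  have "continuous_on (sphere 0 1) (\<lambda>v. \<bar>x \<bullet> v\<bar>)"
    by (intro continuous_intros)
  moreover have "(sgn (x \<bullet> z) *\<^sub>R x) \<bullet> z = \<bar>x \<bullet> z\<bar>" for z
    by (simp add: abs_sgn mult.commute)
  moreover have "(sgn (x \<bullet> z) *\<^sub>R x) \<bullet> v - 0 * (norm (v - z))\<^sup>2 \<le> \<bar>x \<bullet> v\<bar>" for v z
    by (simp add: sgn_if abs_ge_self abs_ge_minus_self)
  ultimately show ?thesis
    using convex_body_of_tangents[of "\<lambda>v. \<bar>x \<bullet> v\<bar>" "\<lambda>z. sgn (x \<bullet> z) *\<^sub>R x" 0] that by metis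
qed

section \<open>Smoothness of \<open>g\<close> against kinks of support functions\<close>

context zonal_operator
begin

text \<open>In the sum over the two opposite rotations the first-order terms of the tangent at
  \<open>v\<close> cancel; what remains is of size \<open>1 - c\<close> or quadratic in the
  displacement, both bounded by multiples of \<open>s\<^sup>2\<close>.\<close>

lemma second_difference_le:
  assumes xy: "norm x = 1" "norm y = 1" "x \<bullet> y = 0"
  obtains D where "D \<ge> 0" "\<And>c s v. c\<^sup>2 + s\<^sup>2 = 1 \<Longrightarrow> 0 \<le> c \<Longrightarrow> norm v = 1 \<Longrightarrow>
    g (plane_rotation x y c s v) + g (plane_rotation x y c (-s) v) - 2 * g v \<le> D * s\<^sup>2"
proof -
  obtain T B C where "B \<ge> 0" "C \<ge> 0" and T: "\<And>z. norm z = 1 \<Longrightarrow> T z \<bullet> z = g z"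
    and B: "\<And>z. norm z = 1 \<Longrightarrow> norm (T z) \<le> B"
    and C: "\<And>x z. norm x = 1 \<Longrightarrow> norm z = 1 \<Longrightarrow> \<bar>g x - T z \<bullet> x\<bar> \<le> C * (norm (x - z))\<^sup>2"
    by (rule second_order_boundedE[OF smooth]) blast
  have "g (plane_rotation x y c s v) + g (plane_rotation x y c (-s) v) - 2 * g v \<le> (2 * B + 4 * C) * s\<^sup>2"
    if cs: "c\<^sup>2 + s\<^sup>2 = 1" "0 \<le> c" and v: "norm v = 1" for c s v
  proof -
    let ?R = "\<lambda>s. plane_rotation x y c s v"
    define q where "q = (x \<bullet> v)\<^sup>2 + (y \<bullet> v)\<^sup>2"
    have cs': "c\<^sup>2 + (-s)\<^sup>2 = 1"
      using cs by simp
    note R = plane_rotation[OF xy cs(1)] and R' = plane_rotation[OF xy cs']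
    have q: "0 \<le> q" "q \<le> 1"
      using R(4)[of v] v by (simp_all add: q_def)
    have "c \<le> 1"
    proof (rule power2_le_imp_le)
      show "c\<^sup>2 \<le> 1\<^sup>2"
        using cs(1) zero_le_power2[of s] unfolding power_one by linarith
    qed simp
    then have "c\<^sup>2 \<le> c"
      using cs(2) by (simp add: power2_eq_square mult_left_le)
    then have c: "1 - c \<le> s\<^sup>2"
      using cs(1) by linarith
    have near: "g (?R t) - T v \<bullet> ?R t \<le> C * (2 * s\<^sup>2)" if "t = s \<or> t = - s" for t
    proof -
      have "norm (?R t) = 1" "(norm (?R t - v))\<^sup>2 = (2 - 2 * c) * q"
        using that R(3) R'(3) orthogonal_transformation_sphere(1)[OF R(1)] orthogonal_transformation_sphere(1)[OF R'(1)] v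
        by (auto simp: q_def)
      moreover have "(2 - 2 * c) * q \<le> (2 * s\<^sup>2) * 1"
        using c q \<open>c \<le> 1\<close> by (intro mult_mono) auto
      ultimately have "g (?R t) - T v \<bullet> ?R t \<le> C * ((2 - 2 * c) * q)" "C * ((2 - 2 * c) * q) \<le> C * (2 * s\<^sup>2)"
        using C[of "?R t" v] v \<open>C \<ge> 0\<close> by (auto simp: abs_le_iff intro: mult_left_mono)
      then show ?thesis
        by linarith
    qed
    define p where "p = (x \<bullet> v) *\<^sub>R x + (y \<bullet> v) *\<^sub>R y"
    have "?R s + ?R (-s) = (v + v) + ((c - 1) *\<^sub>R p + (c - 1) *\<^sub>R p)"
      by (simp add: plane_rotation_def p_def algebra_simps)
    then have "T v \<bullet> ?R s + T v \<bullet> ?R (-s) = T v \<bullet> ((v + v) + ((c - 1) *\<^sub>R p + (c - 1) *\<^sub>R p))"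
      by (simp only: inner_add_right[symmetric])
    then have sum: "T v \<bullet> ?R s + T v \<bullet> ?R (-s) = 2 * g v + 2 * (c - 1) * (T v \<bullet> p)"
      using T[OF v] unfolding inner_add_right inner_scaleR_right by (simp add: algebra_simps)
    have "p \<bullet> p = q"
      using xy by (simp add: p_def q_def inner_add inner_commute[of y x] norm_eq_1 power2_eq_square)
    then have "norm p \<le> 1"
      using q by (simp add: norm_eq_sqrt_inner)
    then have "\<bar>T v \<bullet> p\<bar> \<le> B * 1"
      using Cauchy_Schwarz_ineq2[of "T v" p] mult_mono[OF B[OF v] \<open>norm p \<le> 1\<close>] \<open>B \<ge> 0\<close> by simp
    then have "\<bar>2 * (c - 1) * (T v \<bullet> p)\<bar> \<le> (2 * s\<^sup>2) * B"
      unfolding abs_mult using c \<open>c \<le> 1\<close> by (intro mult_mono) auto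
    then have "2 * (c - 1) * (T v \<bullet> p) \<le> 2 * B * s\<^sup>2"
      by (simp add: abs_le_iff mult.commute mult.left_commute)
    then have "g (?R s) + g (?R (-s)) - 2 * g v \<le> 2 * B * s\<^sup>2 + 2 * (C * (2 * s\<^sup>2))"
      using near[of s] near[of "-s"] sum by simp
    then show ?thesis
      by (simp add: algebra_simps)
  qed
  then show ?thesis
    using that[of "2 * B + 4 * C"] \<open>B \<ge> 0\<close> \<open>C \<ge> 0\<close> by simp
qed

lemma continuous_on_abs_inner: "continuous_on A (\<lambda>v. \<bar>x \<bullet> v\<bar>)"
  by (intro continuous_intros)

text \<open>
  Great subspheres carry no mass of \<open>\<Lambda> e\<close>. The body \<open>K\<close> with support function \<open>\<bar>x \<bullet> v\<bar> + c\<close> has a kink along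
  the subsphere orthogonal to \<open>x\<close>, which mass there would pass on to \<open>\<Phi> K\<close>; but the support function of
  \<open>\<Phi> K\<close> is as smooth as \<open>g\<close>.
\<close>
lemma no_mass_on_great_sphere:
  assumes xy: "norm x = 1" "norm y = 1" "x \<bullet> y = 0"
  obtains C where "C \<ge> 0"
    "\<And>s. 0 \<le> s \<Longrightarrow> s \<le> 1 \<Longrightarrow> \<Lambda> e (\<lambda>v. max (\<bar>y \<bullet> v\<bar> * s - \<bar>x \<bullet> v\<bar>) 0) \<le> C * s\<^sup>2"
proof -
  obtain D where D: "D \<ge> 0" "\<And>c s v. c\<^sup>2 + s\<^sup>2 = 1 \<Longrightarrow> 0 \<le> c \<Longrightarrow> norm v = 1 \<Longrightarrow>
      g (plane_rotation x y c s v) + g (plane_rotation x y c (-s) v) - 2 * g v \<le> D * s\<^sup>2"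
    by (rule second_difference_le[OF xy]) blast
  obtain K k where K: "convex_body K" "\<And>v. norm v = 1 \<Longrightarrow> support_fun K v = \<bar>x \<bullet> v\<bar> + k"
    by (rule abs_inner_body[of x]) blast
  define h where "h v = \<bar>x \<bullet> v\<bar>" for v
  have h_cont: "continuous_on A h" for A
    unfolding h_def by (rule continuous_on_abs_inner)
  let ?m = "measure (S\<^sub>1 K) (sphere 0 1)"
  have \<Lambda>_h: "\<Lambda> u h = (LINT v|S\<^sub>1 K. \<kappa> u v) - k * G" if "norm u = 1" for u
  proof -
    have "\<Lambda> u h = \<Lambda> u (\<lambda>v. support_fun K v - k)"
      using K(2) by (intro \<Lambda>_cong[OF that]) (simp add: h_def)
    then show ?thesis
      using \<Lambda>_support_fun_diff[OF that K(1)] support_\<Phi>[OF K(1) that] by simp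
  qed
  have "\<Lambda> e (\<lambda>v. max (\<bar>y \<bullet> v\<bar> * s - \<bar>x \<bullet> v\<bar>) 0) \<le> (D * ?m + 2 * G) * s\<^sup>2" if s: "0 \<le> s" "s \<le> 1" for s
  proof -
    define c where "c = sqrt (1 - s\<^sup>2)"
    have "s\<^sup>2 \<le> 1"
      using s by (simp add: power_le_one)
    then have cs: "c\<^sup>2 + s\<^sup>2 = 1" "0 \<le> c"
      by (simp_all add: c_def)
    then have cs': "c\<^sup>2 + (-s)\<^sup>2 = 1"
      by simp
    let ?R = "\<lambda>s. plane_rotation x y c s"
    note R = plane_rotation[OF xy cs(1)] and R' = plane_rotation[OF xy cs']
    \<comment> \<open>The rotation passes from the kinked function \<open>h\<close> to the smooth
      function \<open>g\<close>: \<open>P\<close> is the adjoint of \<open>Q\<close>, so it takes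
      \<open>Q e\<close> back to the pole and the kernel at \<open>Q e\<close> becomes
      \<open>g\<close> composed with \<open>P\<close>.\<close>
    have rot: "\<Lambda> e (\<lambda>v. h (Q v)) = (LINT v|S\<^sub>1 K. g (P v)) - k * G"
      if Q: "orthogonal_transformation Q" and P: "orthogonal_transformation P" "\<And>v w. P v \<bullet> w = v \<bullet> Q w" for P Q
    proof -
      have Qe: "norm (Q e) = 1"
        using orthogonal_transformation_sphere(1)[OF Q] e by simp
      have "P (Q e) = e"
        using P(2) Q unfolding orthogonal_transformation_def by (metis vector_eq_rdot)
      have "\<Lambda> e (\<lambda>v. h (Q v)) = (LINT v|S\<^sub>1 K. \<kappa> (Q e) v) - k * G"
        using \<Lambda>_orthogonal[OF Q e h_cont] \<Lambda>_h[OF Qe] by simp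
      also have "(LINT v|S\<^sub>1 K. \<kappa> (Q e) v) = (LINT v|S\<^sub>1 K. g (P v))"
        by (rule integral_cong_sphere[OF sets_S\<^sub>1[OF K(1)]])
          (rule zonal_profile_orthogonal[OF zonal P(1) \<open>P (Q e) = e\<close>])
      finally show ?thesis .
    qed
    have adj: "?R t v \<bullet> w = v \<bullet> ?R (-t) w" for t v w
      by (simp add: plane_rotation_def inner_add_left inner_add_right inner_commute[of v] algebra_simps)
    have cont_g: "continuous_on (sphere 0 1) (\<lambda>v. g (?R s v))" "continuous_on (sphere 0 1) (\<lambda>v. g (?R (-s) v))"
      "continuous_on (sphere 0 1) g"
      using second_order_continuous_on[OF smooth] continuous_on_sphere_compose_orthogonal R(1) R'(1) by blast+
    have cont_h: "continuous_on (sphere 0 1) (\<lambda>v. h (?R s v))" "continuous_on (sphere 0 1) (\<lambda>v. h (?R (-s) v))"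
      using continuous_on_sphere_compose_orthogonal[OF _ h_cont] R(1) R'(1) by blast+
    have \<Lambda>_e: "\<Lambda> e h = (LINT v|S\<^sub>1 K. g v) - k * G"
      using rot[of "\<lambda>v. v" "\<lambda>v. v"] orthogonal_transformation_id by (simp add: id_def)
    have "\<Lambda> e (\<lambda>v. h (?R s v)) + \<Lambda> e (\<lambda>v. h (?R (-s) v)) - 2 * \<Lambda> e h
        = (LINT v|S\<^sub>1 K. g (?R (-s) v)) + (LINT v|S\<^sub>1 K. g (?R s v)) - 2 * (LINT v|S\<^sub>1 K. g v)"
      using rot[OF R(1) R'(1)] rot[OF R'(1) R(1)] adj[of s] adj[of "-s"] \<Lambda>_e by simp
    also have "\<dots> = (LINT v|S\<^sub>1 K. g (?R s v) + g (?R (-s) v) - 2 * g v)"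
      using integrable_S\<^sub>1[OF K(1) cont_g(1)] integrable_S\<^sub>1[OF K(1) cont_g(2)] integrable_S\<^sub>1[OF K(1) cont_g(3)]
      by simp
    also have "\<dots> \<le> (LINT v|S\<^sub>1 K. D * s\<^sup>2)"
      by (rule integral_mono_sphere[OF finite_S\<^sub>1[OF K(1)] sets_S\<^sub>1[OF K(1)]])
        (intro continuous_intros cont_g D(2)[OF cs]; assumption)+
    also have "\<dots> = D * s\<^sup>2 * ?m"
      by (rule integral_const_sphere[OF sets_S\<^sub>1[OF K(1)]])
    finally have upper: "\<Lambda> e (\<lambda>v. h (?R s v)) + \<Lambda> e (\<lambda>v. h (?R (-s) v)) - 2 * \<Lambda> e h \<le> D * s\<^sup>2 * ?m" .
    let ?\<psi> = "\<lambda>v. max (\<bar>y \<bullet> v\<bar> * s - \<bar>x \<bullet> v\<bar>) 0"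
    have \<psi>_cont: "continuous_on (sphere 0 1) ?\<psi>"
      by (intro continuous_intros)
    \<comment> \<open>The same second difference is now bounded from below, through the kink of
      \<open>h\<close>, by the mass near the great subsphere.\<close>
    have "2 * \<Lambda> e ?\<psi> - \<Lambda> e (\<lambda>v. 2 * s\<^sup>2) = \<Lambda> e (\<lambda>v. 2 * ?\<psi> v - 2 * s\<^sup>2)"
      using \<Lambda>_diff[OF e, of "\<lambda>v. 2 * ?\<psi> v" "\<lambda>v. 2 * s\<^sup>2"] \<psi>_cont \<Lambda>_cmult[of e 2 ?\<psi>]
      by (simp add: continuous_on_mult_left)
    also have "\<dots> \<le> \<Lambda> e (\<lambda>v. (h (?R s v) + h (?R (-s) v)) - 2 * h v)"
    proof (rule \<Lambda>_mono[OF e])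
      show "2 * ?\<psi> v - 2 * s\<^sup>2 \<le> (h (?R s v) + h (?R (-s) v)) - 2 * h v" if "norm v = 1" for v
        using abs_rotation_ge[OF cs s(1), of "x \<bullet> v" "y \<bullet> v"] Cauchy_Schwarz_ineq2[of x v] xy(1) that
        by (simp add: h_def R(2) R'(2))
    qed (intro continuous_intros cont_h h_cont)+
    also have "\<dots> = \<Lambda> e (\<lambda>v. h (?R s v)) + \<Lambda> e (\<lambda>v. h (?R (-s) v)) - 2 * \<Lambda> e h"
      using \<Lambda>_diff[OF e, of "\<lambda>v. h (?R s v) + h (?R (-s) v)" "\<lambda>v. 2 * h v"]
        \<Lambda>_add[OF e cont_h] \<Lambda>_cmult[of e 2 h] cont_h h_cont by (simp add: continuous_on_add continuous_on_mult_left)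
    finally have "2 * \<Lambda> e ?\<psi> \<le> D * s\<^sup>2 * ?m + 2 * s\<^sup>2 * G"
      using upper \<Lambda>_const[OF e, of "2 * s\<^sup>2"] by simp
    moreover have "0 \<le> D * s\<^sup>2 * ?m"
      using D(1) by simp
    ultimately have "\<Lambda> e ?\<psi> \<le> D * s\<^sup>2 * ?m + 2 * s\<^sup>2 * G"
      using G_pos zero_le_power2[of s] mult_nonneg_nonneg[of "s\<^sup>2" G] by linarith
    then show ?thesis
      by (simp add: algebra_simps)
  qed
  moreover have "D * ?m + 2 * G \<ge> 0"
    using D(1) G_pos by simp
  ultimately show ?thesis
    using that by blast
qed

end

section \<open>Convergence of the iterates\<close>

context zonal_operator
begin

lemma \<Lambda>_sum:
  assumes "norm u = 1" "finite I" "\<And>i. i \<in> I \<Longrightarrow> continuous_on (sphere 0 1) (h i)"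
  shows "\<Lambda> u (\<lambda>v. \<Sum>i\<in>I. h i v) = (\<Sum>i\<in>I. \<Lambda> u (h i))"
  using assms(2,3)
proof (induction I rule: finite_induct)
  case empty
  then show ?case
    using \<Lambda>_const[OF assms(1), of 0] by simp
next
  case (insert i I)
  then have "continuous_on (sphere 0 1) (h i)" "continuous_on (sphere 0 1) (\<lambda>v. \<Sum>i\<in>I. h i v)"
    by (auto intro: continuous_on_sum)
  then have "\<Lambda> u (\<lambda>v. h i v + (\<Sum>i\<in>I. h i v)) = \<Lambda> u (h i) + \<Lambda> u (\<lambda>v. \<Sum>i\<in>I. h i v)"
    by (rule \<Lambda>_add[OF assms(1)])
  then show ?case
    using insert by simp
qed

text \<open>A stand-in for the support of the measure that represents \<open>\<Lambda> e\<close>: a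
  point lies outside the support when some null function is positive there.\<close>

definition null_fun :: "(real ^ 'n \<Rightarrow> real) \<Rightarrow> bool" where
  "null_fun h \<longleftrightarrow> continuous_on (sphere 0 1) h \<and> (\<forall>v. norm v = 1 \<longrightarrow> h v \<ge> 0) \<and> \<Lambda> e h = 0"

lemma null_fun_sum:
  assumes "finite I" "\<And>i. i \<in> I \<Longrightarrow> null_fun (h i)"
  shows "null_fun (\<lambda>v. \<Sum>i\<in>I. h i v)"
  unfolding null_fun_def
proof (intro conjI allI impI)
  show "continuous_on (sphere 0 1) (\<lambda>v. \<Sum>i\<in>I. h i v)"
    using assms unfolding null_fun_def by (intro continuous_on_sum) auto
  show "(\<Sum>i\<in>I. h i v) \<ge> 0" if "norm v = 1" for v
    using assms that unfolding null_fun_def by (intro sum_nonneg) auto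
  show "\<Lambda> e (\<lambda>v. \<Sum>i\<in>I. h i v) = 0"
    using assms unfolding null_fun_def by (subst \<Lambda>_sum[OF e]) auto
qed

text \<open>The sets where single null functions are positive are relatively open; a finite subcover
  suffices, and the sum of its functions is the required one.\<close>

lemma null_fun_positive_on_compact:
  assumes Z: "compact Z" "Z \<subseteq> sphere 0 1"
    and null: "\<And>v. v \<in> Z \<Longrightarrow> \<exists>h. null_fun h \<and> h v > 0"
  obtains d where "null_fun d" "\<And>v. v \<in> Z \<Longrightarrow> d v > 0"
proof -
  define h where "h v = (SOME h. null_fun h \<and> h v > 0)" for v
  have h: "null_fun (h v)" "h v v > 0" if "v \<in> Z" for v
    using someI_ex[OF null[OF that]] by (simp_all add: h_def)
  have "\<exists>T. open T \<and> T \<inter> sphere 0 1 = h v -` {0<..} \<inter> sphere 0 1" if "v \<in> Z" for v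
    using h(1)[OF that] unfolding null_fun_def continuous_on_open_invariant by (metis open_greaterThan)
  note ex = this
  define T where "T v = (SOME T. open T \<and> T \<inter> sphere 0 1 = h v -` {0<..} \<inter> sphere 0 1)" for v
  have T: "open (T v)" "T v \<inter> sphere 0 1 = h v -` {0<..} \<inter> sphere 0 1" if "v \<in> Z" for v
    using someI_ex[OF ex[OF that]] by (simp_all add: T_def)
  have cover: "Z \<subseteq> (\<Union>v\<in>Z. T v)"
  proof
    fix v assume "v \<in> Z"
    then have "v \<in> h v -` {0<..} \<inter> sphere 0 1"
      using h(2) Z(2) by auto
    then have "v \<in> T v"
      using T(2)[OF \<open>v \<in> Z\<close>] by blast
    then show "v \<in> (\<Union>v\<in>Z. T v)"
      using \<open>v \<in> Z\<close> by blast
  qed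
  obtain I where I: "I \<subseteq> Z" "finite I" "Z \<subseteq> (\<Union>v\<in>I. T v)"
    using compactE_image[where S = Z and C = Z and f = T, OF Z(1) T(1) cover] by blast
  have "null_fun (\<lambda>w. \<Sum>v\<in>I. h v w)"
    using I(1) h(1) by (intro null_fun_sum I(2)) blast
  moreover have "(\<Sum>v\<in>I. h v w) > 0" if "w \<in> Z" for w
  proof -
    have w: "w \<in> sphere 0 1"
      using Z(2) that by blast
    obtain v where v: "v \<in> I" "w \<in> T v"
      using I(3) \<open>w \<in> Z\<close> by blast
    then have "w \<in> T v \<inter> sphere 0 1"
      using w by blast
    then have "h v w > 0"
      using T(2)[OF subsetD[OF I(1) v(1)]] by simp
    moreover have "h i w \<ge> 0" if "i \<in> I" for i
      using h(1)[OF subsetD[OF I(1) that]] w by (simp add: null_fun_def)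
    ultimately show ?thesis
      by (intro sum_pos2[OF I(2) v(1)])
  qed
  ultimately show ?thesis
    by (rule that)
qed

text \<open>If \<open>\<Lambda> e\<close> lived on finitely many points, it would charge a great subsphere through one of them.\<close>
lemma finite_support_impossible:
  assumes A: "finite A" "A \<subseteq> sphere 0 1"
    and null: "\<And>v. norm v = 1 \<Longrightarrow> v \<notin> A \<Longrightarrow> \<exists>h. null_fun h \<and> h v > 0"
  shows False
proof -
  define x where "x a = (SOME x. norm x = 1 \<and> a \<bullet> x = 0)" for a :: "real ^ 'n"
  have x: "norm (x a) = 1" "a \<bullet> x a = 0" if "a \<in> A" for a
  proof -
    have "norm a = 1"
      using A(2) that by auto
    then have "\<exists>x. norm x = 1 \<and> a \<bullet> x = 0"
      using orthogonal_unit_vector_exists[OF dim] by metis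
    from someI_ex[OF this] show "norm (x a) = 1" "a \<bullet> x a = 0"
      by (simp_all add: x_def)
  qed
  \<comment> \<open>It equals \<open>s\<close> at \<open>a\<close>, which lies on the great
    subsphere orthogonal to \<open>x a\<close>, and is positive only close to that
    subsphere.\<close>
  define \<psi> where "\<psi> s a v = max (\<bar>a \<bullet> v\<bar> * s - \<bar>x a \<bullet> v\<bar>) 0" for s :: real and a v :: "real ^ 'n"
  have \<psi>_cont: "continuous_on B (\<psi> s a)" for B s a
    unfolding \<psi>_def by (intro continuous_intros)
  have "\<exists>C. C \<ge> 0 \<and> (\<forall>s. 0 \<le> s \<longrightarrow> s \<le> 1 \<longrightarrow> \<Lambda> e (\<psi> s a) \<le> C * s\<^sup>2)" if a: "a \<in> A" for a
  proof -
    have "norm (x a) = 1" "norm a = 1" "x a \<bullet> a = 0"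
      using x[OF a] A(2) a by (auto simp: inner_commute)
    then show ?thesis
      unfolding \<psi>_def by (rule no_mass_on_great_sphere) blast
  qed
  note ex = this
  define C where "C a = (SOME C. C \<ge> 0 \<and> (\<forall>s. 0 \<le> s \<longrightarrow> s \<le> 1 \<longrightarrow> \<Lambda> e (\<psi> s a) \<le> C * s\<^sup>2))" for a
  have C: "C a \<ge> 0" "\<And>s. 0 \<le> s \<Longrightarrow> s \<le> 1 \<Longrightarrow> \<Lambda> e (\<psi> s a) \<le> C a * s\<^sup>2" if "a \<in> A" for a
    using someI_ex[OF ex[OF that]] by (simp_all add: C_def)
  define D where "D = (\<Sum>a\<in>A. C a)"
  have "D \<ge> 0"
    unfolding D_def using C(1) by (intro sum_nonneg)
  \<comment> \<open>The functions attached to the points of \<open>A\<close> would have to carry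
    total mass of order \<open>s\<close>, whereas great subspheres admit only order
    \<open>s\<^sup>2\<close>.\<close>
  have key: "s / 2 * G \<le> D * s\<^sup>2" if s: "0 < s" "s \<le> 1" for s
  proof -
    define \<Psi> where "\<Psi> v = (\<Sum>a\<in>A. \<psi> s a v)" for v
    have \<Psi>_cont: "continuous_on B \<Psi>" for B
      unfolding \<Psi>_def using \<psi>_cont by (intro continuous_on_sum)
    have \<psi>_nonneg: "\<psi> s a v \<ge> 0" for a v
      by (simp add: \<psi>_def)
    then have \<Psi>_nonneg: "\<Psi> v \<ge> 0" for v
      unfolding \<Psi>_def by (intro sum_nonneg)
    have \<Psi>_A: "\<Psi> a \<ge> s" if a: "a \<in> A" for a
    proof -
      have "norm a = 1"
        using A(2) a by auto
      then have "s = \<psi> s a a"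
        using x(2)[OF a] s(1) by (simp add: \<psi>_def inner_commute[of "x a" a] norm_eq_1)
      also have "\<dots> \<le> \<Psi> a"
        unfolding \<Psi>_def using \<psi>_nonneg by (intro member_le_sum a A(1))
      finally show ?thesis .
    qed
    \<comment> \<open>The region where the sum is too small. It is compact and misses
      \<open>A\<close>, so one null function is bounded away from zero on it.\<close>
    define Z where "Z = sphere 0 1 \<inter> {v. \<Psi> v \<le> s / 2}"
    have "compact Z"
      unfolding Z_def using \<Psi>_cont[of UNIV] by (intro compact_Int_closed closed_Collect_le continuous_on_const) auto
    have Z: "\<exists>h. null_fun h \<and> h v > 0" if "v \<in> Z" for v
    proof (rule null)
      show "norm v = 1"
        using that by (simp add: Z_def)
      show "v \<notin> A"
        using \<Psi>_A[of v] that s(1) by (auto simp: Z_def)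
    qed
    have "Z \<subseteq> sphere 0 1"
      by (auto simp: Z_def)
    obtain d where d: "null_fun d" "\<And>v. v \<in> Z \<Longrightarrow> d v > 0"
      by (rule null_fun_positive_on_compact[OF \<open>compact Z\<close> \<open>Z \<subseteq> sphere 0 1\<close> Z]) blast+
    have d_cont: "continuous_on (sphere 0 1) d" and d_nonneg: "\<And>v. norm v = 1 \<Longrightarrow> d v \<ge> 0" and d_null: "\<Lambda> e d = 0"
      using d(1) by (simp_all add: null_fun_def)
    obtain \<eta> where \<eta>: "\<eta> > 0" "\<And>v. v \<in> Z \<Longrightarrow> \<eta> \<le> d v"
    proof (cases "Z = {}")
      case True
      then show ?thesis
        using that[of 1] by simp
    next
      case False
      then obtain w where "w \<in> Z" "\<And>v. v \<in> Z \<Longrightarrow> d w \<le> d v"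
        using continuous_attains_inf[OF \<open>compact Z\<close> False continuous_on_subset[OF d_cont \<open>Z \<subseteq> sphere 0 1\<close>]] by blast
      then show ?thesis
        using that[of "d w"] d(2) by simp
    qed
    have "s / 2 * G = \<Lambda> e (\<lambda>v. s / 2)"
      using \<Lambda>_const[OF e] by simp
    \<comment> \<open>The null function, scaled to reach \<open>s / 2\<close> on \<open>Z\<close>,
      fills the gap at no cost.\<close>
    also have "\<dots> \<le> \<Lambda> e (\<lambda>v. \<Psi> v + s / (2 * \<eta>) * d v)"
    proof (rule \<Lambda>_mono[OF e])
      fix v :: "real ^ 'n" assume v: "norm v = 1"
      show "s / 2 \<le> \<Psi> v + s / (2 * \<eta>) * d v"
      proof (cases "v \<in> Z")
        case True
        have "s / 2 = s / (2 * \<eta>) * \<eta>"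
          using \<eta>(1) by simp
        also have "\<dots> \<le> s / (2 * \<eta>) * d v"
          using \<eta>(1) s(1) \<eta>(2)[OF True] by (intro mult_left_mono) auto
        finally show ?thesis
          using \<Psi>_nonneg[of v] by linarith
      next
        case False
        then have "s / 2 \<le> \<Psi> v"
          using v by (simp add: Z_def)
        moreover have "0 \<le> s / (2 * \<eta>) * d v"
          using \<eta>(1) s(1) d_nonneg[OF v] by simp
        ultimately show ?thesis
          by linarith
      qed
    qed (intro continuous_intros \<Psi>_cont d_cont)+
    also have "\<dots> = \<Lambda> e \<Psi> + \<Lambda> e (\<lambda>v. s / (2 * \<eta>) * d v)"
      by (intro \<Lambda>_add[OF e] \<Psi>_cont continuous_intros d_cont)
    also have "\<dots> = (\<Sum>a\<in>A. \<Lambda> e (\<psi> s a))"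
      unfolding \<Psi>_def \<Lambda>_cmult using \<Lambda>_sum[OF e A(1) \<psi>_cont] d_null by simp
    also have "\<dots> \<le> (\<Sum>a\<in>A. C a * s\<^sup>2)"
      using C(2) s by (intro sum_mono) simp
    also have "\<dots> = D * s\<^sup>2"
      by (simp add: D_def sum_distrib_right)
    finally show ?thesis .
  qed
  \<comment> \<open>Chosen so that \<open>D * s\<close> is at most a quarter of \<open>G\<close>,
    against the half that \<open>key\<close> demands.\<close>
  define s where "s = min 1 (G / (4 * (D + 1)))"
  have "0 < s" "s \<le> 1"
    using G_pos \<open>D \<ge> 0\<close> by (simp_all add: s_def)
  then have "s * (G / 2) \<le> s * (D * s)"
    using key[of s] by (simp add: power2_eq_square mult.left_commute mult.commute)
  then have "G / 2 \<le> D * s"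
    using \<open>0 < s\<close> by simp
  also have "\<dots> \<le> D * (G / (4 * (D + 1)))"
    using \<open>D \<ge> 0\<close> by (intro mult_left_mono) (simp_all add: s_def)
  also have "\<dots> \<le> G / 4"
    using \<open>D \<ge> 0\<close> G_pos by (simp add: field_simps)
  finally show False
    using G_pos by simp
qed

text \<open>\<open>A\<close> collects the points at which every rotated copy of \<open>f\<close>
  takes the value on which \<open>\<Lambda> e\<close> concentrates it; outside \<open>A\<close> some
  null function is positive. Two points of \<open>A\<close> force \<open>f\<close> to agree on every
  pair with the same inner product. Being infinite, \<open>A\<close> accumulates, which supplies
  inner products arbitrarily close to 1.\<close>

lemma constant_of_concentrated:
  assumes f: "continuous_on (sphere 0 1) f"
    and conc: "\<And>u. norm u = 1 \<Longrightarrow> \<Lambda> u (\<lambda>v. \<bar>f v - \<Lambda> u f / G\<bar>) = 0"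
    and pq: "norm p = 1" "norm q = 1"
  shows "f p = f q"
proof -
  define A where "A = {v \<in> sphere 0 1. \<forall>Q. orthogonal_transformation Q \<longrightarrow> f (Q v) = \<Lambda> (Q e) f / G}"
  have A_sub: "A \<subseteq> sphere 0 1"
    by (auto simp: A_def)
  have same: "f p = f q" if A: "a \<in> A" "b \<in> A" and pq: "norm p = 1" "norm q = 1" "p \<bullet> q = a \<bullet> b" for a b p q
  proof -
    have "norm a = 1" "norm b = 1"
      using A A_sub by auto
    then obtain Q where "orthogonal_transformation Q" "Q a = p" "Q b = q"
      using orthogonal_transformation_pair pq by metis
    then have "f p = \<Lambda> (Q e) f / G" "f q = \<Lambda> (Q e) f / G"
      using A unfolding A_def by blast+
    then show ?thesis
      by simp
  qed
  have "infinite A"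
  proof
    assume "finite A"
    then show False
    proof (rule finite_support_impossible[OF _ A_sub])
      fix v assume v: "norm v = 1" "v \<notin> A"
      then obtain Q where Q: "orthogonal_transformation Q" "f (Q v) \<noteq> \<Lambda> (Q e) f / G"
        by (auto simp: A_def)
      define h where "h w = \<bar>f w - \<Lambda> (Q e) f / G\<bar>" for w
      have h_cont: "continuous_on (sphere 0 1) h"
        unfolding h_def by (intro continuous_intros f)
      have "norm (Q e) = 1"
        using orthogonal_transformation_sphere(1)[OF Q(1)] e by simp
      then have "\<Lambda> (Q e) h = 0"
        unfolding h_def by (rule conc)
      then have "\<Lambda> e (\<lambda>w. h (Q w)) = 0"
        using \<Lambda>_orthogonal[OF Q(1) e h_cont] by simp
      then have "null_fun (\<lambda>w. h (Q w))"
        using continuous_on_sphere_compose_orthogonal[OF Q(1) h_cont] by (simp add: null_fun_def h_def)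
      moreover have "h (Q v) > 0"
        using Q(2) by (simp add: h_def)
      ultimately show "\<exists>h. null_fun h \<and> h v > 0"
        by blast
    qed
  qed
  then obtain l where l: "l islimpt A"
    using Heine_Borel_imp_Bolzano_Weierstrass[OF compact_sphere _ A_sub] by blast
  show ?thesis
  proof (rule constant_of_small_steps[OF dim f _ pq])
    fix \<delta> :: real assume "\<delta> > 0"
    \<comment> \<open>Two points within \<open>d\<close> of \<open>l\<close> satisfy 1 - a \<bullet>
      b < 2 d^2 \<le> d < \<delta>.\<close>
    define d where "d = min \<delta> 1 / 2"
    have d: "0 < d" "d \<le> \<delta> / 2" "d \<le> 1 / 2"
      using \<open>\<delta> > 0\<close> by (auto simp: d_def)
    obtain a where a: "a \<in> A" "a \<noteq> l" "dist a l < d"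
      using l d(1) unfolding islimpt_approachable by blast
    \<comment> \<open>Taking \<open>b\<close> strictly closer to \<open>l\<close> than
      \<open>a\<close> keeps the two points distinct.\<close>
    obtain b where b: "b \<in> A" "b \<noteq> l" "dist b l < dist a l"
      using l a(2) unfolding islimpt_approachable by (metis zero_less_dist_iff)
    have "a \<noteq> b"
      using b(3) by auto
    have ab: "norm a = 1" "norm b = 1"
      using a(1) b(1) A_sub by auto
    have "norm (a - b) < 2 * d"
      using dist_triangle2[of a b l] a(3) b(3) by (simp add: dist_norm)
    then have "(norm (a - b))\<^sup>2 < (2 * d)\<^sup>2"
      by (intro power_strict_mono) auto
    also have "(2 * d)\<^sup>2 = 4 * (d * d)"
      by (simp add: power2_eq_square)
    also have "\<dots> \<le> 4 * (d * (1 / 2))"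
      using d by (intro mult_left_mono) auto
    finally have "1 - a \<bullet> b < \<delta>"
      using inner_unit_eq[OF ab] d(2) \<open>\<delta> > 0\<close> by linarith
    moreover have "0 < (norm (a - b))\<^sup>2"
      using \<open>a \<noteq> b\<close> by simp
    then have "a \<bullet> b < 1"
      using inner_unit_eq[OF ab] by linarith
    ultimately show "\<exists>t. 1 - \<delta> < t \<and> t < 1 \<and> (\<forall>p q. norm p = 1 \<longrightarrow> norm q = 1 \<longrightarrow> p \<bullet> q = t \<longrightarrow> f p = f q)"
      using same[OF a(1) b(1)] by (intro exI[of _ "a \<bullet> b"]) auto
  qed
qed


section \<open>Truncated means and limit points\<close>

lemma mass_pos: "measure (sphere_measure :: (real ^ 'n) measure) (sphere 0 1) > 0"
  by (rule measure_sphere_measure_pos)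

lemma continuous_on_max_const:
  fixes f :: "'a :: topological_space \<Rightarrow> real"
  shows "continuous_on A f \<Longrightarrow> continuous_on A (\<lambda>v. max (f v) t)"
  by (intro continuous_intros)

lemma \<Lambda>_div_continuous: "continuous_on (sphere 0 1) f \<Longrightarrow> continuous_on (sphere 0 1) (\<lambda>u. \<Lambda> u f / G)"
  using G_pos by (intro continuous_intros \<Lambda>_continuous) auto

text \<open>Jensen's inequality for truncation: monotonicity compares with \<open>f\<close> and with
  the constant \<open>t\<close> separately.\<close>

lemma max_le_\<Lambda>_max:
  assumes "norm u = 1" "continuous_on (sphere 0 1) f"
  shows "max (\<Lambda> u f / G) t \<le> \<Lambda> u (\<lambda>v. max (f v) t) / G"
proof -
  have "\<Lambda> u f \<le> \<Lambda> u (\<lambda>v. max (f v) t)" "\<Lambda> u (\<lambda>v. t) \<le> \<Lambda> u (\<lambda>v. max (f v) t)"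
    by (intro \<Lambda>_mono[OF assms(1)] continuous_on_max_const continuous_on_const assms(2); simp)+
  then show ?thesis
    using \<Lambda>_const[OF assms(1), of t] G_pos by (simp add: divide_right_mono pos_le_divide_eq)
qed

lemma \<sigma>_\<Lambda>_div:
  assumes "continuous_on (sphere 0 1) f"
  shows "\<sigma> (\<lambda>u. \<Lambda> u f / G) = \<sigma> f"
proof -
  have "\<sigma> (\<lambda>u. \<Lambda> u f / G) = \<sigma> (\<lambda>u. \<Lambda> u f) / G"
    by simp
  then show ?thesis
    using \<Lambda>_mean[OF assms] G_pos by simp
qed

lemma \<sigma>_mono:
  assumes "continuous_on (sphere 0 1) f" "continuous_on (sphere 0 1) h" "\<And>v. norm v = 1 \<Longrightarrow> f v \<le> h v"
  shows "\<sigma> f \<le> \<sigma> h"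
  using integral_mono_sphere[OF finite_sphere_measure sets_sphere_measure assms] .

lemma \<sigma>_tendsto:
  assumes cont: "\<And>n. continuous_on (sphere 0 1) (F n)" "continuous_on (sphere 0 1) f"
    and lim: "\<And>\<epsilon>. \<epsilon> > 0 \<Longrightarrow> \<forall>\<^sub>F n in sequentially. \<forall>v. norm v = 1 \<longrightarrow> \<bar>F n v - f v\<bar> \<le> \<epsilon>"
  shows "(\<lambda>n. \<sigma> (F n)) \<longlonglongrightarrow> \<sigma> f"
proof (rule tendstoI)
  let ?m = "measure (sphere_measure :: (real ^ 'n) measure) (sphere 0 1)"
  fix \<epsilon> :: real assume "\<epsilon> > 0"
  have m: "?m > 0"
    by (rule measure_sphere_measure_pos)
  then have "\<forall>\<^sub>F n in sequentially. \<forall>v. norm v = 1 \<longrightarrow> \<bar>F n v - f v\<bar> \<le> \<epsilon> / (2 * ?m)"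
    using \<open>\<epsilon> > 0\<close> by (intro lim) simp
  then show "\<forall>\<^sub>F n in sequentially. dist (\<sigma> (F n)) (\<sigma> f) < \<epsilon>"
  proof (rule eventually_mono)
    fix n assume "\<forall>v. norm v = 1 \<longrightarrow> \<bar>F n v - f v\<bar> \<le> \<epsilon> / (2 * ?m)"
    then have "\<bar>\<sigma> (F n) - \<sigma> f\<bar> \<le> ?m * (\<epsilon> / (2 * ?m))"
      by (intro integral_dist_le_sphere[OF finite_sphere_measure sets_sphere_measure] cont) simp
    also have "\<dots> < \<epsilon>"
      using m \<open>\<epsilon> > 0\<close> by simp
    finally show "dist (\<sigma> (F n)) (\<sigma> f) < \<epsilon>"
      by (simp add: dist_real_def)
  qed
qed

text \<open>
  A limit point whose truncated means are all preserved is constant: \<open>\<Lambda>/G\<close> is positive with mean one, so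
  equality in \<open>max (\<Lambda> f / G) t \<le> \<Lambda> (max f t) / G\<close> at level \<open>t = \<Lambda> u f / G\<close> means that \<open>f\<close> equals \<open>t\<close> almost
  everywhere with respect to \<open>\<Lambda> u\<close>.
\<close>
lemma constant_of_preserved_means:
  assumes f: "continuous_on (sphere 0 1) f"
    and eq: "\<And>t. \<sigma> (\<lambda>u. max (\<Lambda> u f / G) t) = \<sigma> (\<lambda>u. max (f u) t)"
    and pq: "norm p = 1" "norm q = 1"
  shows "f p = f q"
proof (rule constant_of_concentrated[OF f _ pq])
  fix u :: "real ^ 'n" assume u: "norm u = 1"
  define t where "t = \<Lambda> u f / G"
  note ft = continuous_on_max_const[OF f, of t]
  define h where "h w = \<Lambda> w (\<lambda>v. max (f v) t) / G - max (\<Lambda> w f / G) t" for w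
  have h_cont: "continuous_on (sphere 0 1) h"
    unfolding h_def by (intro continuous_on_diff continuous_on_max_const \<Lambda>_div_continuous f ft)
  have "\<sigma> h = \<sigma> (\<lambda>w. \<Lambda> w (\<lambda>v. max (f v) t) / G) - \<sigma> (\<lambda>w. max (\<Lambda> w f / G) t)"
    unfolding h_def
    by (intro Bochner_Integration.integral_diff integrable_\<sigma> continuous_on_max_const \<Lambda>_div_continuous f ft)
  then have "\<sigma> h = 0"
    using \<sigma>_\<Lambda>_div[OF ft] eq[of t] by simp
  then have "h u = 0"
    using max_le_\<Lambda>_max[OF _ f, of _ t]
    by (intro orthogonal_invariant_full_support[OF finite_sphere_measure sets_sphere_measure
          orthogonal_invariant_sphere_measure measure_sphere_measure_pos h_cont _ _ u]) (simp_all add: h_def)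
  then have max_t: "\<Lambda> u (\<lambda>v. max (f v) t) = t * G"
    using G_pos by (simp add: h_def t_def[symmetric] field_simps)
  have ft': "continuous_on (sphere 0 1) (\<lambda>v. 2 * max (f v) t)"
    by (intro continuous_intros f)
  \<comment> \<open>The absolute deviation is 2 max(f, t) - f - t, so equality in Jensen's
    inequality at the mean value \<open>t\<close> makes it vanish.\<close>
  have "\<Lambda> u (\<lambda>v. \<bar>f v - t\<bar>) = \<Lambda> u (\<lambda>v. (2 * max (f v) t - f v) - t)"
    by (rule \<Lambda>_cong[OF u]) (simp add: max_def)
  also have "\<dots> = 2 * \<Lambda> u (\<lambda>v. max (f v) t) - \<Lambda> u f - t * G"
    using \<Lambda>_diff[OF u continuous_on_diff[OF ft' f] continuous_on_const, of t] \<Lambda>_diff[OF u ft' f]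
      \<Lambda>_cmult[of u 2 "\<lambda>v. max (f v) t"] \<Lambda>_const[OF u, of t] by simp
  also have "\<dots> = 0"
    using max_t G_pos by (simp add: t_def)
  finally show "\<Lambda> u (\<lambda>v. \<bar>f v - \<Lambda> u f / G\<bar>) = 0"
    by (simp add: t_def)
qed

lemma iterates_tendsto_mean:
  assumes cont: "\<And>m. continuous_on (sphere 0 1) (f m)"
    and step: "\<And>m u. norm u = 1 \<Longrightarrow> f (Suc m) u = \<Lambda> u (f m) / G"
    and bound: "\<And>m u. norm u = 1 \<Longrightarrow> \<bar>f m u\<bar> \<le> R"
    and lipschitz: "\<And>m u v. norm u = 1 \<Longrightarrow> norm v = 1 \<Longrightarrow> \<bar>f m u - f m v\<bar> \<le> R * norm (u - v)"
    and "\<epsilon> > 0"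
  shows "\<forall>\<^sub>F m in sequentially. \<forall>u. norm u = 1 \<longrightarrow>
     \<bar>f m u - \<sigma> (f 0) / measure (sphere_measure :: (real ^ 'n) measure) (sphere 0 1)\<bar> \<le> \<epsilon>"
proof (rule ccontr)
  let ?m = "measure (sphere_measure :: (real ^ 'n) measure) (sphere 0 1)"
  define k where "k = \<sigma> (f 0) / ?m"
  define far where "far = {m. \<exists>u. norm u = 1 \<and> \<bar>f m u - k\<bar> > \<epsilon>}"
  assume "\<not> ?thesis"
  then have "\<exists>\<^sub>F m in sequentially. m \<in> far"
    unfolding far_def k_def frequently_def by (simp add: not_le[symmetric])
  then have "infinite far"
    using frequently_cofinite[of "\<lambda>m. m \<in> far"] by (simp add: cofinite_eq_sequentially)
  then obtain r :: "nat \<Rightarrow> nat" where r: "strict_mono r" "\<And>n. r n \<in> far"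
    using infinite_enumerate[of far] by blast
  have "R \<ge> 0"
    using bound[OF e, of 0] by linarith
  have equi: "\<exists>d>0. \<forall>n y. y \<in> sphere 0 1 \<and> norm (x - y) < d \<longrightarrow> norm (f (r n) x - f (r n) y) < \<epsilon>'"
    if "x \<in> sphere 0 1" "0 < \<epsilon>'" for x and \<epsilon>' :: real
  proof (intro exI[of _ "\<epsilon>' / (R + 1)"] conjI allI impI)
    show "\<epsilon>' / (R + 1) > 0"
      using \<open>R \<ge> 0\<close> that(2) by simp
    fix n and y :: "real ^ 'n" assume y: "y \<in> sphere 0 1 \<and> norm (x - y) < \<epsilon>' / (R + 1)"
    have "norm (f (r n) x - f (r n) y) \<le> R * norm (x - y)"
      using lipschitz[of x y] y that(1) by simp
    also have "\<dots> \<le> (R + 1) * norm (x - y)"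
      by (simp add: mult_right_mono)
    also have "\<dots> < \<epsilon>'"
      using y \<open>R \<ge> 0\<close> by (simp add: pos_less_divide_eq mult.commute)
    finally show "norm (f (r n) x - f (r n) y) < \<epsilon>'" .
  qed
  have bd: "norm (f (r n) x) \<le> R" if "x \<in> sphere 0 1" for n x
    using bound[of x "r n"] that by simp
  obtain F s where F: "continuous_on (sphere 0 1) F" and s: "strict_mono (s :: nat \<Rightarrow> nat)"
    and lim: "\<And>\<epsilon>. 0 < \<epsilon> \<Longrightarrow> \<exists>N. \<forall>n x. n \<ge> N \<and> x \<in> sphere 0 1 \<longrightarrow> norm (f (r (s n)) x - F x) < \<epsilon>"
    using Arzela_Ascoli[of "sphere 0 1" "\<lambda>n. f (r n)" R, OF compact_sphere bd equi] by blast
  define j where "j n = r (s n)" for n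
  have j: "strict_mono j"
    using r(1) s unfolding j_def[abs_def] by (simp add: strict_mono_def)
  have lim_j: "\<forall>\<^sub>F n in sequentially. \<forall>v. norm v = 1 \<longrightarrow> \<bar>f (j n) v - F v\<bar> \<le> \<delta>" if "\<delta> > 0" for \<delta>
  proof -
    obtain N where "\<forall>n x. n \<ge> N \<and> x \<in> sphere 0 1 \<longrightarrow> norm (f (r (s n)) x - F x) < \<delta>"
      using lim[OF \<open>\<delta> > 0\<close>] by blast
    then show ?thesis
      unfolding eventually_sequentially j_def by (intro exI[of _ N]) (auto intro: less_imp_le)
  qed
  \<comment> \<open>The indices shifted by one converge as well, to the image of the limit point
    under the normalized operator.\<close>
  have lim_Suc: "\<forall>\<^sub>F n in sequentially. \<forall>v. norm v = 1 \<longrightarrow> \<bar>f (Suc (j n)) v - \<Lambda> v F / G\<bar> \<le> \<delta>" if "\<delta> > 0" for \<delta>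
  proof (rule eventually_mono[OF lim_j[OF that]], intro allI impI)
    fix n and v :: "real ^ 'n"
    assume near: "\<forall>v. norm v = 1 \<longrightarrow> \<bar>f (j n) v - F v\<bar> \<le> \<delta>" and v: "norm v = 1"
    have "\<bar>\<Lambda> v (f (j n)) - \<Lambda> v F\<bar> \<le> G * \<delta>"
      using near by (intro \<Lambda>_dist_le[OF v cont F]) simp
    then have "\<bar>\<Lambda> v (f (j n)) - \<Lambda> v F\<bar> / G \<le> \<delta>"
      using G_pos by (simp add: pos_divide_le_eq mult.commute)
    then show "\<bar>f (Suc (j n)) v - \<Lambda> v F / G\<bar> \<le> \<delta>"
      using G_pos by (simp add: step[OF v] diff_divide_distrib[symmetric])
  qed
  have max_le: "\<bar>max a t - max b t\<bar> \<le> \<bar>a - b\<bar>" for a b t :: real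
    by (simp add: max_def)
  have trunc: "(\<lambda>n. \<sigma> (\<lambda>v. max (h n v) t)) \<longlonglongrightarrow> \<sigma> (\<lambda>v. max (H v) t)"
    if "\<And>n. continuous_on (sphere 0 1) (h n)" "continuous_on (sphere 0 1) H"
      "\<And>\<delta>. \<delta> > 0 \<Longrightarrow> \<forall>\<^sub>F n in sequentially. \<forall>v. norm v = 1 \<longrightarrow> \<bar>h n v - H v\<bar> \<le> \<delta>" for h H t
  proof (rule \<sigma>_tendsto)
    fix \<delta> :: real assume "\<delta> > 0"
    show "\<forall>\<^sub>F n in sequentially. \<forall>v. norm v = 1 \<longrightarrow> \<bar>max (h n v) t - max (H v) t\<bar> \<le> \<delta>"
    proof (rule eventually_mono[OF that(3)[OF \<open>\<delta> > 0\<close>]], intro allI impI)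
      fix n and v :: "real ^ 'n"
      assume "\<forall>v. norm v = 1 \<longrightarrow> \<bar>h n v - H v\<bar> \<le> \<delta>" "norm v = 1"
      then have "\<bar>h n v - H v\<bar> \<le> \<delta>"
        by blast
      with max_le[of "h n v" t "H v"] show "\<bar>max (h n v) t - max (H v) t\<bar> \<le> \<delta>"
        by (rule order_trans)
    qed
  qed (intro continuous_on_max_const that)+
  \<comment> \<open>The truncated means decrease and are bounded below, so they converge along the
    whole sequence; the subsequence \<open>j\<close> and its shift by one share the limit.\<close>
  have preserved: "\<sigma> (\<lambda>u. max (\<Lambda> u F / G) t) = \<sigma> (\<lambda>u. max (F u) t)" for t
  proof -
    define V where "V m = \<sigma> (\<lambda>v. max (f m v) t)" for m
    have "V (Suc m) \<le> V m" for m
    proof -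
      have "V (Suc m) = \<sigma> (\<lambda>u. max (\<Lambda> u (f m) / G) t)"
        unfolding V_def by (rule integral_cong_sphere[OF sets_sphere_measure]) (simp add: step)
      also have "\<dots> \<le> \<sigma> (\<lambda>u. \<Lambda> u (\<lambda>v. max (f m v) t) / G)"
        by (intro \<sigma>_mono continuous_on_max_const \<Lambda>_div_continuous cont max_le_\<Lambda>_max)
      also have "\<dots> = V m"
        unfolding V_def by (intro \<sigma>_\<Lambda>_div continuous_on_max_const cont)
      finally show ?thesis .
    qed
    then have "decseq V"
      by (rule decseq_SucI)
    moreover have "V m \<ge> \<sigma> (\<lambda>v. t)" for m
      unfolding V_def by (intro \<sigma>_mono continuous_on_max_const continuous_on_const cont) simp
    ultimately obtain l where l: "V \<longlonglongrightarrow> l"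
      using decseq_convergent[of V] by blast
    have "(\<lambda>n. V (j n)) \<longlonglongrightarrow> l"
      using LIMSEQ_subseq_LIMSEQ[OF l j] by (simp add: o_def)
    moreover have "(\<lambda>n. V (j n)) \<longlonglongrightarrow> \<sigma> (\<lambda>v. max (F v) t)"
      unfolding V_def by (rule trunc[OF cont F lim_j])
    moreover have "strict_mono (\<lambda>n. Suc (j n))"
      using j by (simp add: strict_mono_def)
    then have "(\<lambda>n. V (Suc (j n))) \<longlonglongrightarrow> l"
      using LIMSEQ_subseq_LIMSEQ[OF l] by (auto simp: o_def)
    moreover have "(\<lambda>n. V (Suc (j n))) \<longlonglongrightarrow> \<sigma> (\<lambda>v. max (\<Lambda> v F / G) t)"
      unfolding V_def by (rule trunc[OF cont \<Lambda>_div_continuous[OF F] lim_Suc])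
    ultimately show ?thesis
      using LIMSEQ_unique by metis
  qed
  have F_const: "F v = F e" if "norm v = 1" for v
    by (rule constant_of_preserved_means[OF F preserved that e])
  have mean: "\<sigma> (f m) = \<sigma> (f 0)" for m
  proof (induction m)
    case (Suc m)
    have "\<sigma> (f (Suc m)) = \<sigma> (\<lambda>u. \<Lambda> u (f m) / G)"
      by (rule integral_cong_sphere[OF sets_sphere_measure step])
    then show ?case
      using Suc \<sigma>_\<Lambda>_div[OF cont] by simp
  qed simp
  have "(\<lambda>n. \<sigma> (f (j n))) \<longlonglongrightarrow> \<sigma> F"
    by (rule \<sigma>_tendsto[OF cont F lim_j])
  moreover have "(\<lambda>n. \<sigma> (f (j n))) = (\<lambda>n. \<sigma> (f 0))"
    by (rule ext) (rule mean)
  ultimately have "(\<lambda>n. \<sigma> (f 0)) \<longlonglongrightarrow> \<sigma> F"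
    by (rule subst[rotated])
  then have "\<sigma> F = \<sigma> (f 0)"
    by (rule LIMSEQ_unique[OF _ tendsto_const])
  moreover have "\<sigma> F = \<sigma> (\<lambda>_. F e)"
    by (rule integral_cong_sphere[OF sets_sphere_measure F_const])
  moreover have "\<sigma> (\<lambda>_. F e) = F e * ?m"
    by (rule integral_const_sphere[OF sets_sphere_measure])
  ultimately have "F e = k"
    using mass_pos by (simp add: k_def field_simps)
  obtain n where n: "\<forall>v. norm v = 1 \<longrightarrow> \<bar>f (j n) v - F v\<bar> \<le> \<epsilon>"
    using eventually_happens[OF lim_j[OF \<open>\<epsilon> > 0\<close>]] by auto
  have "j n \<in> far"
    using r(2) by (simp add: j_def)
  then obtain u where u: "norm u = 1" "\<bar>f (j n) u - k\<bar> > \<epsilon>"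
    unfolding far_def by blast
  have "\<bar>f (j n) u - F u\<bar> \<le> \<epsilon>"
    using n u(1) by blast
  then show False
    using u F_const[OF u(1)] \<open>F e = k\<close> by simp
qed

section \<open>Iterates of a convex body\<close>

lemma body_iterate: "convex_body K \<Longrightarrow> convex_body ((\<Phi> ^^ m) K)"
  by (induction m) (simp_all add: \<Phi>_body)

text \<open>\<open>K\<close> contains a ball of radius \<open>d\<close> about some \<open>x\<close>;
  the linear part contributed by \<open>x\<close> integrates to zero by antipodal symmetry.\<close>

lemma mean_support_fun_pos:
  assumes K: "convex_body K"
  shows "\<sigma> (support_fun K) > 0"
proof -
  obtain x where "x \<in> interior K"
    using convex_bodyD(4)[OF K] by blast
  then obtain d where d: "d > 0" "cball x d \<subseteq> K"
    by (auto simp: mem_interior_cball)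
  have cont: "continuous_on (sphere 0 1) (\<lambda>u. u \<bullet> x)" "continuous_on (sphere 0 1) (\<lambda>u. u \<bullet> x + d)"
    by (intro continuous_intros)+
  have "\<sigma> (\<lambda>u. - u \<bullet> x) = \<sigma> (\<lambda>u. u \<bullet> x)"
    using orthogonal_invariant_sphere_measure cont(1) orthogonal_transformation_neg[of "\<lambda>u. u"] orthogonal_transformation_id
    unfolding orthogonal_invariant_def id_def by blast
  then have "\<sigma> (\<lambda>u. u \<bullet> x) = 0"
    by simp
  then have "\<sigma> (\<lambda>u. u \<bullet> x + d) = d * measure (sphere_measure :: (real ^ 'n) measure) (sphere 0 1)"
    using integrable_\<sigma>[OF cont(1)] integrable_\<sigma>[OF continuous_on_const, of d]
      integral_const_sphere[OF sets_sphere_measure, of d] by simp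
  moreover have "\<sigma> (\<lambda>u. u \<bullet> x + d) \<le> \<sigma> (support_fun K)"
  proof (intro \<sigma>_mono cont continuous_support_fun K)
    fix u :: "real ^ 'n" assume u: "norm u = 1"
    have "x + d *\<^sub>R u \<in> K"
      using d u by (intro subsetD[OF d(2)]) (simp add: dist_norm)
    then show "u \<bullet> x + d \<le> support_fun K u"
      using inner_le_support_fun[OF convex_bodyD(1)[OF K], of "x + d *\<^sub>R u" u] u
      by (simp add: inner_add_right norm_eq_1)
  qed
  moreover have "d * measure (sphere_measure :: (real ^ 'n) measure) (sphere 0 1) > 0"
    using d(1) mass_pos by simp
  ultimately show ?thesis
    by linarith
qed

lemma iterates_converge:
  assumes K: "convex_body K"
  shows "(\<lambda>m. hausdorff_dist (dilate (inverse (mean_width K / 2 * G ^ m)) ((\<Phi> ^^ m) K)) (cball 0 1)) \<longlonglongrightarrow> 0"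
proof -
  define k where "k = mean_width K / 2"
  have k_eq: "k = \<sigma> (support_fun K) / measure (sphere_measure :: (real ^ 'n) measure) (sphere 0 1)"
    by (simp add: k_def mean_width_def)
  then have "k > 0"
    using mean_support_fun_pos[OF K] mass_pos by simp
  define L where "L m = (\<Phi> ^^ m) K" for m
  have L: "convex_body (L m)" for m
    unfolding L_def by (rule body_iterate[OF K])
  define f where "f m u = support_fun (L m) u / G ^ m" for m u
  obtain R where R: "R > 0" "K \<subseteq> ball 0 R"
    using bounded_subset_ballD[OF convex_bodyD(6)[OF K]] by blast
  have f_cont: "continuous_on A (f m)" for m A
    unfolding f_def using G_pos by (intro continuous_intros continuous_support_fun L) auto
  have step: "f (Suc m) u = \<Lambda> u (f m) / G" if u: "norm u = 1" for m u
  proof -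
    have "\<Lambda> u (f m) = \<Lambda> u (\<lambda>v. inverse (G ^ m) * support_fun (L m) v)"
      by (rule \<Lambda>_cong[OF u]) (simp add: f_def divide_inverse mult.commute)
    also have "\<dots> = inverse (G ^ m) * support_fun (\<Phi> (L m)) u"
      unfolding \<Lambda>_cmult by (simp add: \<Lambda>_support_fun[OF u L])
    finally show ?thesis
      by (simp add: f_def L_def field_simps)
  qed
  have bound: "\<bar>f m u\<bar> \<le> R" if "norm u = 1" for m u
    using that
  proof (induction m arbitrary: u)
    case 0
    have "support_fun K 0 = 0"
      using convex_bodyD(3)[OF K] by (auto intro: support_fun_eqI)
    moreover have "K \<subseteq> cball 0 R"
      using R(2) ball_subset_cball by blast
    ultimately show ?case
      using support_fun_lipschitz[OF convex_bodyD(1,3)[OF K], of R u 0] 0 by (simp add: f_def L_def)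
  next
    case (Suc m)
    have "\<bar>\<Lambda> u (f m) - \<Lambda> u (\<lambda>_. 0)\<bar> \<le> G * R"
      using Suc.IH by (intro \<Lambda>_dist_le[OF Suc.prems f_cont continuous_on_const]) simp
    then have "\<bar>\<Lambda> u (f m)\<bar> / G \<le> R"
      using \<Lambda>_const[OF Suc.prems, of 0] G_pos by (simp add: pos_divide_le_eq mult.commute)
    then show ?case
      using G_pos by (simp add: step[OF Suc.prems])
  qed
  \<comment> \<open>Convexity supplies equicontinuity: a bound on the support function confines the
    body to a ball, whose radius is a Lipschitz constant of the support function.\<close>
  have lip: "\<bar>f m u - f m v\<bar> \<le> R * norm (u - v)" for m u v
  proof -
    have "L m \<subseteq> cball 0 (R * G ^ m)"
    proof (rule support_fun_le_imp_subset)
      fix w :: "real ^ 'n" assume w: "norm w = 1"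
      have "f m w \<le> R"
        using bound[OF w] abs_le_D1 by blast
      then have "support_fun (L m) w \<le> R * G ^ m"
        using G_pos by (simp add: f_def pos_divide_le_eq)
      then show "support_fun (L m) w \<le> support_fun (cball 0 (R * G ^ m)) w"
        using support_fun_cball[of "R * G ^ m" w] w R(1) G_pos by simp
    qed (use convex_bodyD[OF L] R(1) zero_less_power[OF G_pos, of m] in \<open>simp_all add: not_less\<close>)
    then have "\<bar>support_fun (L m) u - support_fun (L m) v\<bar> \<le> R * G ^ m * norm (u - v)"
      by (rule support_fun_lipschitz[OF convex_bodyD(1,3)[OF L]])
    then have "\<bar>support_fun (L m) u - support_fun (L m) v\<bar> / G ^ m \<le> R * norm (u - v)"
      using G_pos by (simp add: pos_divide_le_eq mult.commute mult.left_commute)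
    then show ?thesis
      using G_pos by (simp add: f_def diff_divide_distrib[symmetric])
  qed
  have conv: "\<forall>\<^sub>F m in sequentially. \<forall>u. norm u = 1 \<longrightarrow> \<bar>f m u - k\<bar> \<le> \<epsilon>" if "\<epsilon> > 0" for \<epsilon>
  proof -
    have "\<sigma> (f 0) / measure (sphere_measure :: (real ^ 'n) measure) (sphere 0 1) = k"
      by (simp add: k_eq f_def[abs_def] L_def)
    then show ?thesis
      using iterates_tendsto_mean[of f R, OF f_cont step bound lip that] by (simp only:)
  qed
  show ?thesis
  proof (rule tendstoI)
    fix \<epsilon> :: real assume "\<epsilon> > 0"
    \<comment> \<open>\<open>\<epsilon> / 2\<close> makes the final inequality strict;
      \<open>1 / 2\<close> keeps \<delta> below 1 for the comparison with the unit ball.\<close>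
    define \<delta> where "\<delta> = min (\<epsilon> / 2) (1 / 2)"
    have \<delta>: "0 < \<delta>" "\<delta> < 1" "\<delta> < \<epsilon>"
      using \<open>\<epsilon> > 0\<close> by (auto simp: \<delta>_def)
    have "k * \<delta> > 0"
      using \<open>k > 0\<close> \<delta> by simp
    from conv[OF this]
    show "\<forall>\<^sub>F m in sequentially.
        dist (hausdorff_dist (dilate (inverse (mean_width K / 2 * G ^ m)) ((\<Phi> ^^ m) K)) (cball 0 1)) 0 < \<epsilon>"
    proof (rule eventually_mono)
      fix m assume near: "\<forall>u. norm u = 1 \<longrightarrow> \<bar>f m u - k\<bar> \<le> k * \<delta>"
      define c where "c = inverse (k * G ^ m)"
      have "c > 0"
        using \<open>k > 0\<close> G_pos by (simp add: c_def)
      have "support_fun (dilate c (L m)) u = f m u / k" for u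
        using support_fun_dilate[OF convex_bodyD(1,3)[OF L], of c m u] \<open>c > 0\<close>
        by (simp add: f_def c_def divide_inverse mult.commute mult.left_commute)
      moreover have "\<bar>f m u / k - 1\<bar> \<le> \<delta>" if "norm u = 1" for u
      proof -
        have "\<bar>f m u - k\<bar> \<le> k * \<delta>"
          using near that by blast
        moreover have "f m u / k - 1 = (f m u - k) / k"
          using \<open>k > 0\<close> by (simp add: diff_divide_distrib)
        ultimately show ?thesis
          using \<open>k > 0\<close> by (simp add: pos_divide_le_eq mult.commute)
      qed
      ultimately have near1: "\<bar>support_fun (dilate c (L m)) u - 1\<bar> \<le> \<delta>" if "norm u = 1" for u
        using that by simp
      have "compact (dilate c (L m))" "convex (dilate c (L m))" "dilate c (L m) \<noteq> {}"
        using convex_bodyD[OF L] by (auto intro: compact_scaling convex_scaling)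
      then have "0 \<le> hausdorff_dist (dilate c (L m)) (cball 0 1)" "hausdorff_dist (dilate c (L m)) (cball 0 1) \<le> \<delta>"
        using hausdorff_dist_cball_le[OF _ _ _ _ \<delta>(2) near1] \<delta>(1) by simp_all
      then show "dist (hausdorff_dist (dilate (inverse (mean_width K / 2 * G ^ m)) ((\<Phi> ^^ m) K)) (cball 0 1)) 0 < \<epsilon>"
        using \<delta>(3) by (simp add: c_def k_def L_def)
    qed
  qed
qed

end

theorem theorem2:
  fixes \<Phi> :: "(real ^ 'n) set \<Rightarrow> (real ^ 'n) set"
    and g :: "real ^ 'n \<Rightarrow> real"
    and e :: "real ^ 'n"
  assumes "CARD('n) \<ge> 2"
    and "norm e = 1"
    and "minkowski_valuation \<Phi>"
    and "translation_invariant \<Phi>"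
    and "monotone_on_bodies \<Phi>"
    and "degree_one \<Phi>"
    and "commutes_with_SO \<Phi>"
    and "generating_function e \<Phi> g"
    and "C2_on_sphere g"
  shows "\<forall>K. convex_body K \<longrightarrow>
    (\<lambda>m. hausdorff_dist
       (dilate (inverse (mean_width K / 2 * (LINT u|sphere_measure. g u) ^ m)) ((\<Phi> ^^ m) K))
       (cball 0 1)) \<longlonglongrightarrow> 0"
proof (intro allI impI)
  fix K :: "(real ^ 'n) set" assume K: "convex_body K"
  \<comment> \<open>Area measure and convolution formula are chosen together, so that the formula
    holds for the chosen measure.\<close>
  define S\<^sub>1 where "S\<^sub>1 L = (SOME S. is_first_area_measure L S \<and>
      (\<forall>u\<in>sphere 0 1. support_fun (\<Phi> L) u = sphere_conv e S g u))" for L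
  have S\<^sub>1: "is_first_area_measure L (S\<^sub>1 L) \<and> (\<forall>u\<in>sphere 0 1. support_fun (\<Phi> L) u = sphere_conv e (S\<^sub>1 L) g u)"
    if "convex_body L" for L
  proof -
    have "\<exists>S. is_first_area_measure L S \<and> (\<forall>u\<in>sphere 0 1. support_fun (\<Phi> L) u = sphere_conv e S g u)"
      by (rule assms(8)[unfolded generating_function_def, THEN conjunct2, THEN conjunct2, THEN spec, THEN mp, OF that])
    from someI_ex[OF this] show ?thesis
      unfolding S\<^sub>1_def .
  qed
  interpret zonal_operator S\<^sub>1 \<Phi> e g
  proof
    show "2 \<le> CARD('n)" "norm e = 1"
      by fact+
    show "second_order g"
      by (rule C2_on_sphere_imp_second_order) fact
    show "Defs.zonal e g"
      using assms(8) by (simp add: generating_function_def)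
    show "is_first_area_measure L (S\<^sub>1 L)" if "convex_body L" for L
      using S\<^sub>1[OF that] by blast
    show "convex_body (\<Phi> L)" if "convex_body L" for L
      using assms(3) that by (simp add: minkowski_valuation_def)
    show "\<Phi> L \<subseteq> \<Phi> M" if "convex_body L" "convex_body M" "L \<subseteq> M" for L M
      using assms(5) that by (simp add: monotone_on_bodies_def)
    show "support_fun (\<Phi> L) u = (LINT v|S\<^sub>1 L. zonal_profile e g (u \<bullet> v))" if "convex_body L" "norm u = 1" for L u
      using S\<^sub>1[OF that(1)] that(2) by (simp add: sphere_conv_def)
  qed
  show "(\<lambda>m. hausdorff_dist
       (dilate (inverse (mean_width K / 2 * (LINT u|sphere_measure. g u) ^ m)) ((\<Phi> ^^ m) K))
       (cball 0 1)) \<longlonglongrightarrow> 0"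
    using iterates_converge[OF K] by (simp only: G_def)
qed

end
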